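(* Let $0<\rho\le\frac13$, $\mathcal I_\rho=[-\rho,1+\rho]$, $n\ge1$ and $0\le k\le n-1$. Let $\Pi^{\otimes n}_k\colon(L^2\Lambda^{\otimes n})^k\to(\mathbb P\Lambda^{\otimes n})^k$, $\Pi^{\otimes n}_k=\sum_{\mathbf i\in\chi_k}\Pi_{i_1}\otimes\cdots\otimes\Pi_{i_n}$, be the tensor product quasi-interpolation operators defined in the context. Then $\Pi^{\otimes n}_k$ commutes with the exterior derivative: for every $u\in(H\Lambda^{\otimes n})^k$ there holds $$\Pi^{\otimes n}_{k+1}(d^ku)=d^k\,\Pi^{\otimes n}_ku.$$
   Context: One-dimensional operators. On an interval, $0$-forms are functions and $1$-forms $v\,dx$ are identified with their coefficient $v$; $L^2\Lambda^0,L^2\Lambda^1$ denote the spaces of $L^2$ $0$- and $1$-forms on $\mathcal I_\rho$. $H\Lambda^k=\{u\in L^2\Lambda^k: du\in L^2\Lambda^{k+1}\}$ on $\mathcal I_\rho$, with inner product $(u,v)_{L^2}+(du,dv)_{L^2}$; so $H\Lambda^0=H^1(\mathcal I_\rho)$ and $H\Lambda^1=L^2\Lambda^1$. Let $\eta(x)=C\exp\bigl(\frac1{|x|^2-1}\bigr)$ for $|x|<1$, $\eta(x)=0$ for $|x|\ge1$, with $\int_{\mathbb R}\eta=1$; $\eta_l(x)=\frac1\rho\eta(\frac x\rho)$, $\eta_r(x)=\frac1\rho\eta(\frac{x-1}\rho)$; $B_l,B_r$ the intervals of radius $\rho$ centered at $0$ and $1$. For $y_l\in B_l$, $y_r\in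 B_r$ set $\widetilde{\mathcal N^0_1}(u)=u'(y_l)$, $\widetilde{\mathcal N^0_2}(u)=u'(y_r)$, $\widetilde{\mathcal N^0_3}(u)=u(y_r)-u(y_l)$, $\widetilde{\mathcal N^0_4}(u)=u(y_r)+u(y_l)$ for $u\in C^1(\mathcal I_\rho)$, and $\widetilde{\mathcal N^1_1}(v)=v(y_l)$, $\widetilde{\mathcal N^1_2}(v)=v(y_r)$, $\widetilde{\mathcal N^1_3}(v)=\int_{y_l}^{y_r}v\,dx$ for $v\in C^0(\mathcal I_\rho)$. Set $\overline{\mathcal N^k_i}(u)=\int_{B_l}\int_{B_r}\eta_l(\xi_l)\eta_r(\xi_r)\widetilde{\mathcal N^k_i}(u)\,d\xi_r\,d\xi_l$ with $y_l=\xi_l$, $y_r=\xi_r$; these functionals are $L^2(\mathcal I_\rho)$-bounded and are extended by continuity to $L^2(\mathcal I_\rho)$. Let $\varphi^0_1=x-2x^2+x^3$, $\varphi^0_2=-x^2+x^3$, $\varphi^0_3=-\frac12+3x^2-2x^3$, $\varphi^0_4=\frac12$; $\varphi^1_1=1-4x+3x^2$, $\varphi^1_2=-2x+3x^2$, $\varphi^1_3=6x-6x^2$. Define $\Pi_0u=\sum_{i=1}^4\overline{\mathcal N^0_i}(u)\varphi^0_i$ for $u\in L^2\Lambda^0$ and $\Pi_1v=\sum_{i=1}^3\overline{\mathcal N^1_i}(v)\varphi^1_i$ for $v\in L^2\Lambda^1$; moreover $\Pi_0$ is extended by $0$ to $1$-forms and $\Pi_1$ by $0$ to $0$-forms. Tensor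 products. $\chi_k=\{\boldsymbol\ell\in\{0,1\}^n:\sum_j\ell_j=k\}$. All tensor products of Hilbert spaces are completed with respect to the product inner product, e.g. $(v_1\otimes w_1,v_2\otimes w_2)=(v_1,v_2)(w_1,w_2)$. $(L^2\Lambda^{\otimes n})^k=\bigoplus_{\mathbf i\in\chi_k}L^2\Lambda^{i_1}\otimes\cdots\otimes L^2\Lambda^{i_n}$ and $(H\Lambda^{\otimes n})^k=\bigoplus_{\mathbf i\in\chi_k}H\Lambda^{i_1}\otimes\cdots\otimes H\Lambda^{i_n}$ are spaces of $k$-forms on $\mathcal I_\rho^{\times n}$. $(\mathbb P\Lambda^{\otimes n})^k=\bigoplus_{\mathbf i\in\chi_k}\mathbb P\Lambda^{i_1}\otimes\cdots\otimes\mathbb P\Lambda^{i_n}$ with $\mathbb P\Lambda^0=\mathbb P_3\Lambda^0$ ($0$-forms, polynomials of degree $\le3$) and $\mathbb P\Lambda^1=\mathbb P_2\Lambda^1$ ($1$-forms with polynomial coefficient of degree $\le2$). Tensor products of bounded operators are defined by $(F\otimes G)(v\otimes w)=F(v)\otimes G(w)$ and extension by linearity and density; thus $\Pi^{\otimes n}_k(u_1\otimes\cdots\otimes u_n)=\Pi_{i_1}(u_1)\otimes\cdots\otimes\Pi_{i_n}(u_n)$ for $u_j\in L^2\Lambda^{i_j}$, $\mathbf i\in\chi_k$. The exterior derivative $d^k\colon(H\Lambda^{\otimes n})^k\to(H\Lambda^{\otimes n})^{k+1}$ is given on $u_j\in H\Lambda^{i_j}$, $\mathbf i\in\chi_k$,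 by $d^k(u_1\otimes\cdots\otimes u_n)=\sum_{j=1}^n(-1)^{\sum_{\ell=1}^{j-1}i_\ell}\,u_1\otimes\cdots\otimes du_j\otimes\cdots\otimes u_n$ (with $du_j=0$ if $i_j=1$), extended by linearity and density; the same formula defines $d^k$ on $(\mathbb P\Lambda^{\otimes n})^k$. *)

theory Defs
  imports
    "HOL-Analysis.Analysis"
    "HOL-Computational_Algebra.Polynomial"
begin

section \<open>Hilbert space tensor products\<close>

text \<open>
  A (semi-)inner product space is given by a carrier and an inner product. The inner product may be
  degenerate: spaces such as \<open>L\<^sup>2\<close> are represented by their functions instead of classes of functions,
  and the construction of the tensor product below identifies vectors at distance 0.
\<close>

record 'a ipspace =
  vecs :: "'a set"
  ip :: "'a \<Rightarrow> 'a \<Rightarrow> real"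

text \<open>
  A formal tensor, i.e. a list of pairs \<open>(c, u)\<close>, stands for the algebraic tensor
  \<open>\<Sum> c \<cdot> u 0 \<otimes> \<dots> \<otimes> u (n - 1)\<close>; only the values of \<open>u\<close> below \<open>n\<close> matter.
\<close>

type_synonym 'a formal_tensor = "(real \<times> (nat \<Rightarrow> 'a)) list"

definition formal_tensors :: "nat \<Rightarrow> (nat \<Rightarrow> 'a ipspace) \<Rightarrow> 'a formal_tensor set" where
  "formal_tensors n V = {w. \<forall>(c, u) \<in> set w. \<forall>j<n. u j \<in> vecs (V j)}"

definition formal_ip ::
    "nat \<Rightarrow> (nat \<Rightarrow> 'a ipspace) \<Rightarrow> 'a formal_tensor \<Rightarrow> 'a formal_tensor \<Rightarrow> real" where
  "formal_ip n V w w' =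
     (\<Sum>(c, u) \<leftarrow> w. \<Sum>(c', u') \<leftarrow> w'. c * c' * (\<Prod>j<n. ip (V j) (u j) (u' j)))"

definition formal_diff :: "'a formal_tensor \<Rightarrow> 'a formal_tensor \<Rightarrow> 'a formal_tensor" where
  "formal_diff w w' = w @ map (\<lambda>(c, u). (- c, u)) w'"

definition formal_Cauchy ::
    "nat \<Rightarrow> (nat \<Rightarrow> 'a ipspace) \<Rightarrow> (nat \<Rightarrow> 'a formal_tensor) \<Rightarrow> bool" where
  "formal_Cauchy n V w \<longleftrightarrow>
     (\<forall>e>0. \<exists>N. \<forall>p\<ge>N. \<forall>q\<ge>N.
        sqrt (formal_ip n V (formal_diff (w p) (w q)) (formal_diff (w p) (w q))) < e)"

text \<open>
  As in the usual construction of the tensor product of Hilbert spaces, \<open>u 0 \<otimes> \<dots> \<otimes> u (n - 1)\<close> is the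
  multilinear form \<open>v \<mapsto> \<Prod>j<n. \<langle>u j, v j\<rangle>\<close>. An element \<open>T\<close> of the completion is likewise identified
  with the form \<open>v \<mapsto> \<langle>T, v 0 \<otimes> \<dots> \<otimes> v (n - 1)\<rangle>\<close>, which determines \<open>T\<close> because the elementary tensors
  span a dense subspace. The forms are set to 0 outside of the carriers, so that equality of tensors
  is equality of functions. For a Cauchy sequence \<open>w\<close> of algebraic tensors (w.r.t. the product inner
  product), \<open>tensor_lim n V w \<Phi>\<close> says that \<open>\<Phi>\<close> is its limit in the completion.
\<close>

definition tensor_form ::
    "nat \<Rightarrow> (nat \<Rightarrow> 'a ipspace) \<Rightarrow> 'a formal_tensor \<Rightarrow> (nat \<Rightarrow> 'a) \<Rightarrow> real" where
  "tensor_form n V w v =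
     (if \<forall>j<n. v j \<in> vecs (V j) then formal_ip n V w [(1, v)] else 0)"

definition tensor_lim ::
    "nat \<Rightarrow> (nat \<Rightarrow> 'a ipspace) \<Rightarrow> (nat \<Rightarrow> 'a formal_tensor) \<Rightarrow> ((nat \<Rightarrow> 'a) \<Rightarrow> real) \<Rightarrow> bool" where
  "tensor_lim n V w \<Phi> \<longleftrightarrow>
     (\<forall>m. w m \<in> formal_tensors n V) \<and> formal_Cauchy n V w \<and>
     (\<forall>v. (\<lambda>m. tensor_form n V (w m) v) \<longlonglongrightarrow> \<Phi> v)"

definition hilbert_tensor :: "nat \<Rightarrow> (nat \<Rightarrow> 'a ipspace) \<Rightarrow> ((nat \<Rightarrow> 'a) \<Rightarrow> real) set" where
  "hilbert_tensor n V = {\<Phi>. \<exists>w. tensor_lim n V w \<Phi>}"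

text \<open>
  The operator \<open>F 0 \<otimes> \<dots> \<otimes> F (n - 1)\<close>, defined on elementary tensors by applying the factors and
  extended by linearity and density. The uniqueness demanded by the definite description is the
  independence of the approximating sequence; it holds for bounded linear factors.
\<close>

definition tensor_op ::
    "nat \<Rightarrow> (nat \<Rightarrow> 'a ipspace) \<Rightarrow> (nat \<Rightarrow> 'b ipspace) \<Rightarrow> (nat \<Rightarrow> 'a \<Rightarrow> 'b) \<Rightarrow>
     ((nat \<Rightarrow> 'a) \<Rightarrow> real) \<Rightarrow> (nat \<Rightarrow> 'b) \<Rightarrow> real" where
  "tensor_op n V W F \<Phi> =
     (THE \<Psi>. \<exists>w. tensor_lim n V w \<Phi> \<and>
        tensor_lim n W (\<lambda>m. map (\<lambda>(c, u). (c, \<lambda>j. F j (u j))) (w m)) \<Psi>)"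


section \<open>Tensor product forms\<close>

text \<open>
  Multi-indices are 0-based: \<open>i j\<close> with \<open>j < n\<close> is the form degree in the \<open>(j+1)\<close>-st variable.
  \<open>S 0\<close> and \<open>S 1\<close> are the spaces of 0- and 1-forms on the interval.
\<close>

definition chi :: "nat \<Rightarrow> nat \<Rightarrow> (nat \<Rightarrow> nat) set" where
  "chi n k = {i \<in> {..<n} \<rightarrow>\<^sub>E {0, 1}. (\<Sum>j<n. i j) = k}"

type_synonym 'a tensor_kform = "(nat \<Rightarrow> nat) \<Rightarrow> (nat \<Rightarrow> 'a) \<Rightarrow> real"

definition tensor_forms :: "(nat \<Rightarrow> 'a ipspace) \<Rightarrow> nat \<Rightarrow> nat \<Rightarrow> 'a tensor_kform set" where
  "tensor_forms S n k = (\<Pi>\<^sub>E i \<in> chi n k. hilbert_tensor n (\<lambda>j. S (i j)))"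

definition tensor_forms_op ::
    "(nat \<Rightarrow> 'a ipspace) \<Rightarrow> (nat \<Rightarrow> 'b ipspace) \<Rightarrow> (nat \<Rightarrow> 'a \<Rightarrow> 'b) \<Rightarrow> nat \<Rightarrow> nat \<Rightarrow>
     'a tensor_kform \<Rightarrow> 'b tensor_kform" where
  "tensor_forms_op S S' F n k \<omega> =
     (\<lambda>i \<in> chi n k. tensor_op n (\<lambda>j. S (i j)) (\<lambda>j. S' (i j)) (\<lambda>j. F (i j)) (\<omega> i))"

text \<open>
  The exterior derivative induced by \<open>D\<close>, the derivative from 0-forms to 1-forms on the interval. The
  \<open>j\<close>-th summand of the derivative of an elementary tensor of multi-degree \<open>i\<close> has multi-degree
  \<open>i(j := 1)\<close>, and it vanishes if \<open>i j = 1\<close>.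
\<close>

definition tensor_d ::
    "(nat \<Rightarrow> 'a ipspace) \<Rightarrow> ('a \<Rightarrow> 'a) \<Rightarrow> nat \<Rightarrow> nat \<Rightarrow> 'a tensor_kform \<Rightarrow> 'a tensor_kform" where
  "tensor_d S D n k \<omega> =
     (\<lambda>i' \<in> chi n (k + 1). \<lambda>v.
        \<Sum>i \<in> chi n k. \<Sum>j \<in> {j. j < n \<and> i j = 0 \<and> i(j := 1) = i'}.
          (- 1) ^ (\<Sum>l<j. i l) *
          tensor_op n (\<lambda>l. S (i l)) (\<lambda>l. S (i' l)) (\<lambda>l. if l = j then D else id) (\<omega> i) v)"


section \<open>Forms on the interval\<close>

definition I_rho :: "real \<Rightarrow> real set" where
  "I_rho \<rho> = {- \<rho>..1 + \<rho>}"

definition L2_fun :: "real \<Rightarrow> (real \<Rightarrow> real) set" where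
  "L2_fun \<rho> = {u \<in> borel_measurable (lebesgue_on (I_rho \<rho>)).
                 integrable (lebesgue_on (I_rho \<rho>)) (\<lambda>x. (u x)\<^sup>2)}"

definition L2_ip :: "real \<Rightarrow> (real \<Rightarrow> real) \<Rightarrow> (real \<Rightarrow> real) \<Rightarrow> real" where
  "L2_ip \<rho> u v = (LINT x|lebesgue_on (I_rho \<rho>). u x * v x)"

definition test_fun :: "real \<Rightarrow> (real \<Rightarrow> real) \<Rightarrow> bool" where
  "test_fun \<rho> \<phi> \<longleftrightarrow>
     (\<forall>m x. (deriv ^^ m) \<phi> field_differentiable at x) \<and>
     (\<exists>K. compact K \<and> K \<subseteq> interior (I_rho \<rho>) \<and> (\<forall>x. x \<notin> K \<longrightarrow> \<phi> x = 0))"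

definition is_weak_deriv :: "real \<Rightarrow> (real \<Rightarrow> real) \<Rightarrow> (real \<Rightarrow> real) \<Rightarrow> bool" where
  "is_weak_deriv \<rho> u g \<longleftrightarrow>
     g \<in> L2_fun \<rho> \<and> (\<forall>\<phi>. test_fun \<rho> \<phi> \<longrightarrow> L2_ip \<rho> u (deriv \<phi>) = - L2_ip \<rho> g \<phi>)"

text \<open>The weak derivative is unique up to null sets, so the choice of a representative is immaterial.\<close>

definition weak_deriv :: "real \<Rightarrow> (real \<Rightarrow> real) \<Rightarrow> real \<Rightarrow> real" where
  "weak_deriv \<rho> u = (SOME g. is_weak_deriv \<rho> u g)"

text \<open>1-forms are identified with their coefficients, and the derivative of a 1-form is 0.\<close>

definition L2_forms :: "real \<Rightarrow> nat \<Rightarrow> (real \<Rightarrow> real) ipspace" where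
  "L2_forms \<rho> k = \<lparr>vecs = L2_fun \<rho>, ip = L2_ip \<rho>\<rparr>"

definition H_forms :: "real \<Rightarrow> nat \<Rightarrow> (real \<Rightarrow> real) ipspace" where
  "H_forms \<rho> k =
     (if k = 0 then
        \<lparr>vecs = {u \<in> L2_fun \<rho>. \<exists>g. is_weak_deriv \<rho> u g},
         ip = (\<lambda>u v. L2_ip \<rho> u v + L2_ip \<rho> (weak_deriv \<rho> u) (weak_deriv \<rho> v))\<rparr>
      else L2_forms \<rho> k)"

text \<open>
  The polynomial forms are a finite-dimensional subspace of \<open>H_forms\<close>, whose inner product they
  inherit. (In finite dimension, any other inner product yields
  an isomorphic tensor product.)
\<close>

definition P_forms :: "real \<Rightarrow> nat \<Rightarrow> (real \<Rightarrow> real) ipspace" where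
  "P_forms \<rho> k =
     \<lparr>vecs = {poly p | p. degree p \<le> (if k = 0 then 3 else 2)}, ip = ip (H_forms \<rho> k)\<rparr>"


section \<open>The quasi-interpolation operators\<close>

definition bump :: "real \<Rightarrow> real" where
  "bump x = (if \<bar>x\<bar> < 1 then exp (1 / (\<bar>x\<bar>\<^sup>2 - 1)) else 0)"

definition eta :: "real \<Rightarrow> real" where
  "eta x = 1 / (LINT y|lebesgue. bump y) * bump x"

definition eta_l :: "real \<Rightarrow> real \<Rightarrow> real" where
  "eta_l \<rho> x = 1 / \<rho> * eta (x / \<rho>)"

definition eta_r :: "real \<Rightarrow> real \<Rightarrow> real" where
  "eta_r \<rho> x = 1 / \<rho> * eta ((x - 1) / \<rho>)"

text \<open>
  The nodal degrees of freedom on \<open>k\<close>-forms. The nodes lie in the interior of the interval, so that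
  \<open>deriv\<close> only depends on the function on the interval.
\<close>

definition nodal_dof :: "nat \<Rightarrow> nat \<Rightarrow> real \<Rightarrow> real \<Rightarrow> (real \<Rightarrow> real) \<Rightarrow> real" where
  "nodal_dof k i y\<^sub>l y\<^sub>r u =
     (if k = 0 then
        (if i = 1 then deriv u y\<^sub>l
         else if i = 2 then deriv u y\<^sub>r
         else if i = 3 then u y\<^sub>r - u y\<^sub>l
         else u y\<^sub>r + u y\<^sub>l)
      else
        (if i = 1 then u y\<^sub>l
         else if i = 2 then u y\<^sub>r
         else (LINT x:{y\<^sub>l..y\<^sub>r}|lebesgue. u x)))"

definition smooth_forms :: "real \<Rightarrow> nat \<Rightarrow> (real \<Rightarrow> real) set" where
  "smooth_forms \<rho> k =
     (if k = 0 then
        {u. \<exists>u'. continuous_on (I_rho \<rho>) u' \<and>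
              (\<forall>x \<in> I_rho \<rho>. (u has_real_derivative u' x) (at x within I_rho \<rho>))}
      else {v. continuous_on (I_rho \<rho>) v})"

definition mean_dof :: "real \<Rightarrow> nat \<Rightarrow> nat \<Rightarrow> (real \<Rightarrow> real) \<Rightarrow> real" where
  "mean_dof \<rho> k i u =
     (LINT \<xi>\<^sub>l:ball 0 \<rho>|lebesgue. LINT \<xi>\<^sub>r:ball 1 \<rho>|lebesgue.
        eta_l \<rho> \<xi>\<^sub>l * eta_r \<rho> \<xi>\<^sub>r * nodal_dof k i \<xi>\<^sub>l \<xi>\<^sub>r u)"

text \<open>
  Extension by continuity to \<open>L\<^sup>2\<close>. As in \<open>tensor_op\<close>, the definite description requires the limit
  to be independent of the approximating sequence.
\<close>

definition L2_dof :: "real \<Rightarrow> nat \<Rightarrow> nat \<Rightarrow> (real \<Rightarrow> real) \<Rightarrow> real" where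
  "L2_dof \<rho> k i u =
     (THE c. \<exists>f. (\<forall>m. f m \<in> smooth_forms \<rho> k) \<and>
        (\<lambda>m. sqrt (L2_ip \<rho> (\<lambda>x. f m x - u x) (\<lambda>x. f m x - u x))) \<longlonglongrightarrow> 0 \<and>
        (\<lambda>m. mean_dof \<rho> k i (f m)) \<longlonglongrightarrow> c)"

definition basis_fun :: "nat \<Rightarrow> nat \<Rightarrow> real \<Rightarrow> real" where
  "basis_fun k i x =
     (if k = 0 then
        (if i = 1 then x - 2 * x^2 + x^3
         else if i = 2 then - (x^2) + x^3
         else if i = 3 then - 1/2 + 3 * x^2 - 2 * x^3
         else 1/2)
      else
        (if i = 1 then 1 - 4 * x + 3 * x^2
         else if i = 2 then - 2 * x + 3 * x^2
         else 6 * x - 6 * x^2))"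

definition Pi_1d :: "real \<Rightarrow> nat \<Rightarrow> (real \<Rightarrow> real) \<Rightarrow> real \<Rightarrow> real" where
  "Pi_1d \<rho> k u = (\<lambda>x. \<Sum>i = 1..(if k = 0 then 4 else 3). L2_dof \<rho> k i u * basis_fun k i x)"


section \<open>The operators on tensor product forms\<close>

definition Pi_tensor ::
    "real \<Rightarrow> nat \<Rightarrow> nat \<Rightarrow> (real \<Rightarrow> real) tensor_kform \<Rightarrow> (real \<Rightarrow> real) tensor_kform" where
  "Pi_tensor \<rho> = tensor_forms_op (L2_forms \<rho>) (P_forms \<rho>) (Pi_1d \<rho>)"

text \<open>
  The inclusion of \<open>H\<close>-forms in \<open>L\<^sup>2\<close>-forms. It has to be explicit, because a tensor is represented by
  its inner products with elementary tensors, and these differ in the two spaces.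
\<close>

definition H_to_L2 ::
    "real \<Rightarrow> nat \<Rightarrow> nat \<Rightarrow> (real \<Rightarrow> real) tensor_kform \<Rightarrow> (real \<Rightarrow> real) tensor_kform" where
  "H_to_L2 \<rho> = tensor_forms_op (H_forms \<rho>) (L2_forms \<rho>) (\<lambda>_. id)"

definition d_H ::
    "real \<Rightarrow> nat \<Rightarrow> nat \<Rightarrow> (real \<Rightarrow> real) tensor_kform \<Rightarrow> (real \<Rightarrow> real) tensor_kform" where
  "d_H \<rho> = tensor_d (H_forms \<rho>) (weak_deriv \<rho>)"

definition d_P ::
    "real \<Rightarrow> nat \<Rightarrow> nat \<Rightarrow> (real \<Rightarrow> real) tensor_kform \<Rightarrow> (real \<Rightarrow> real) tensor_kform" where
  "d_P \<rho> = tensor_d (P_forms \<rho>) deriv"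

end

theory Submission imports Defs begin

text \<open>
  Both sides are sums of tensor products of bounded operators between the factors, so it suffices that
  tensor products of bounded operators are well defined and functorial, and that \<open>\<Pi>\<^sub>1 u' = (\<Pi>\<^sub>0 u)'\<close> for
  \<open>u\<close> in \<open>H\<^sup>1\<close> of the interval.

  A bound \<open>\<parallel>F x\<parallel>\<^sup>2 \<le> C \<parallel>x\<parallel>\<^sup>2\<close> for a linear map says that the kernel \<open>C \<langle>x, y\<rangle> - \<langle>F x, F y\<rangle>\<close> is positive
  semidefinite. By the Schur product theorem, such bounds are inherited by tensor products.

  For the commutation in one dimension, the averaged degrees of freedom on 1-forms are inner products
  with smooth functions \<open>\<psi>\<^sub>i\<close> that vanish outside the interval: \<open>\<eta>\<^sub>l\<close>, \<open>\<eta>\<^sub>r\<close> and the antiderivative of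
  \<open>\<eta>\<^sub>l - \<eta>\<^sub>r\<close>. The first three degrees of freedom on 0-forms are, by partial integration, the inner
  products with \<open>- \<psi>\<^sub>i'\<close>, and the definition of the weak derivative of \<open>u\<close> identifies the two.
\<close>

section \<open>Positive semidefinite kernels and tensor products of bounded operators\<close>

text \<open>Norm bounds on the factors control elementary tensors only and say nothing about their
  sums, whereas positive semidefiniteness of a kernel speaks about all finite combinations at once.
  Kernels also suit the encoding: carriers are bare sets, inner products may be degenerate, and
  \<open>weak_deriv\<close> picks a representative, so it is linear only up to null functions.
  \<open>tensor_op\<close> and \<open>L2_dof\<close> are definite descriptions, so each use rests on
  existence and uniqueness of a limit, which norm bounds and, for \<open>L2_dof\<close>, density of
  the polynomials supply. The supports of the mollifiers reach the ends of the interval, so the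
  \<psi> are not test functions with compact support in its interior; a further limit is needed
  before the weak derivative can be tested with them. The antiderivative of
  \<open>eta_l - eta_r\<close> vanishes at both ends because both mollifiers have mass 1. The bound
  on \<rho> keeps the left node to the left of the right one. The fourth degree of freedom on
  0-forms has no partner on 1-forms; its basis function is constant and disappears under
  differentiation.\<close>

definition psd :: "'a set \<Rightarrow> ('a \<Rightarrow> 'a \<Rightarrow> real) \<Rightarrow> bool" where
  "psd X K \<longleftrightarrow>
     (\<forall>x\<in>X. \<forall>y\<in>X. K x y = K y x) \<and>
     (\<forall>(N::nat) u c. (\<forall>a<N. u a \<in> X) \<longrightarrow> 0 \<le> (\<Sum>a<N. \<Sum>b<N. c a * c b * K (u a) (u b)))"

lemma psd_sym: "psd X K \<Longrightarrow> x \<in> X \<Longrightarrow> y \<in> X \<Longrightarrow> K x y = K y x"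
  by (simp add: psd_def)

lemma psd_nonneg:
  "psd X K \<Longrightarrow> (\<And>a. a < N \<Longrightarrow> u a \<in> X) \<Longrightarrow> 0 \<le> (\<Sum>a<N. \<Sum>b<N. c a * c b * K (u a) (u b))"
  for N :: nat
  by (simp add: psd_def)

lemma psd_diag_nonneg:
  assumes "psd X K" "x \<in> X"
  shows "0 \<le> K x x"
  using psd_nonneg[OF assms(1), of 1 "\<lambda>_. x" "\<lambda>_. 1"] assms(2) by simp

text \<open>Near \<open>t = 0\<close> a linear term dominates the quadratic one and would change
  sign. This is the Cauchy-Schwarz inequality at a vector of norm 0, where the usual division is
  impossible.\<close>

lemma linear_coeff_eq_zero:
  fixes p q :: real
  assumes "\<And>t. 0 \<le> t * t * p + 2 * t * q"
  shows "q = 0"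
proof (rule ccontr)
  assume q: "q \<noteq> 0"
  \<comment> \<open>\<open>2 * s\<close> exceeds \<open>p\<close> for either sign of
    \<open>p\<close>; the value at \<open>t\<close> is then
    \<open>(q / s)\<^sup>2 * (p - 2 * s)\<close>, hence negative.\<close>
  define s where "s = \<bar>p\<bar> + 1"
  define t where "t = - q / s"
  have "s > 0" "p < 2 * s" by (auto simp: s_def)
  then have "t * t * p + 2 * t * q = (q / s)\<^sup>2 * (p - 2 * s)"
    unfolding t_def by (simp add: field_simps power2_eq_square)
  moreover have "(q / s)\<^sup>2 > 0"
    using q \<open>s > 0\<close> by simp
  ultimately have "t * t * p + 2 * t * q < 0"
    using \<open>p < 2 * s\<close> by (simp add: mult_pos_neg)
  with assms[of t] show False by simp
qed

lemma psd_Cauchy_Schwarz: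
  assumes "psd X K" "x \<in> X" "y \<in> X"
  shows "\<bar>K x y\<bar> \<le> sqrt (K x x) * sqrt (K y y)"
proof -
  have *: "0 \<le> s * s * K x x + 2 * (s * t) * K x y + t * t * K y y" for s t
    using psd_nonneg[OF assms(1), of 2 "\<lambda>a. if a = 0 then x else y" "\<lambda>a. if a = 0 then s else t"]
      assms psd_sym[OF assms]
    by (auto simp: numeral_2_eq_2 algebra_simps split: if_splits)
  have x0: "0 \<le> K x x" and y0: "0 \<le> K y y"
    using psd_diag_nonneg[OF assms(1)] assms(2,3) by auto
  have "(K x y)\<^sup>2 \<le> K x x * K y y"
  proof (cases "K x x = 0")
    case True
    have "0 \<le> t * t * K y y + 2 * t * K x y" for t
      using *[of 1 t] True by (simp add: algebra_simps)
    then have "K x y = 0" by (rule linear_coeff_eq_zero)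
    then show ?thesis using True by simp
  next
    case False
    with x0 have pos: "0 < K x x" by simp
    \<comment> \<open>The combination \<open>K x x\<close> times \<open>y\<close> minus
      \<open>K x y\<close> times \<open>x\<close> is the component of \<open>y\<close> orthogonal to
      \<open>x\<close>, scaled so that no quotient occurs.\<close>
    have "0 \<le> K x x * (K x x * K y y - (K x y)\<^sup>2)"
      using *[of "- K x y" "K x x"] by (simp add: algebra_simps power2_eq_square)
    then show ?thesis using pos by (simp add: zero_le_mult_iff)
  qed
  then have "sqrt ((K x y)\<^sup>2) \<le> sqrt (K x x * K y y)"
    by (rule real_sqrt_le_mono)
  then show ?thesis by (simp add: real_sqrt_mult)
qed

lemma psd_cong:
  assumes "psd X K" "\<And>x y. x \<in> X \<Longrightarrow> y \<in> X \<Longrightarrow> K x y = L x y"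
  shows "psd X L"
proof -
  have "0 \<le> (\<Sum>a<N. \<Sum>b<N. c a * c b * L (u a) (u b))" if "\<forall>a<N. u a \<in> X" for N :: nat and u c
    using psd_nonneg[OF assms(1), of N u c] that assms(2) by simp
  with assms show ?thesis by (auto simp: psd_def)
qed

lemma psd_add:
  assumes "psd X K" "psd X L"
  shows "psd X (\<lambda>x y. K x y + L x y)"
  using assms by (auto simp: psd_def distrib_left sum.distrib)

lemma psd_scale:
  assumes "psd X K" "0 \<le> r"
  shows "psd X (\<lambda>x y. r * K x y)"
proof -
  have "(\<Sum>a<N. \<Sum>b<N. c a * c b * (r * K (u a) (u b))) =
        r * (\<Sum>a<N. \<Sum>b<N. c a * c b * K (u a) (u b))" for N :: nat and u c
    by (simp add: sum_distrib_left algebra_simps)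
  with assms show ?thesis by (auto simp: psd_def)
qed

lemma psd_one: "psd X (\<lambda>_ _. 1)"
proof -
  have "(\<Sum>a<N. \<Sum>b<N. c a * c b * 1) = (\<Sum>a<N. c a)\<^sup>2" for N :: nat and c :: "nat \<Rightarrow> real"
    by (simp add: sum_product power2_eq_square)
  then show ?thesis by (auto simp: psd_def)
qed

lemma psd_zero: "psd X (\<lambda>_ _. 0)"
  by (simp add: psd_def)

text \<open>The map \<open>f\<close> is arbitrary and not assumed linear, which admits maps defined
  by a choice of representative.\<close>

lemma psd_pullback:
  assumes "psd X K" "\<And>y. y \<in> Y \<Longrightarrow> f y \<in> X"
  shows "psd Y (\<lambda>x y. K (f x) (f y))"
  using assms by (auto simp: psd_def)

lemma psd_subset: "psd X K \<Longrightarrow> Y \<subseteq> X \<Longrightarrow> psd Y K"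
  using psd_pullback[of X K Y id] by auto

text \<open>Cholesky decomposition: the last index is eliminated by passing to the Schur complement.\<close>

lemma psd_matrix_gram:
  fixes A :: "nat \<Rightarrow> nat \<Rightarrow> real"
  assumes "psd {..<N} A"
  shows "\<exists>(m::nat) f. \<forall>a<N. \<forall>b<N. A a b = (\<Sum>k<m. f k a * f k b)"
  using assms
proof (induction N arbitrary: A)
  case 0
  then show ?case by simp
next
  case (Suc N)
  let ?d = "A N N"
  have sym: "A a b = A b a" if "a \<le> N" "b \<le> N" for a b
    using psd_sym[OF Suc.prems] that by simp
  have d0: "0 \<le> ?d"
    using psd_diag_nonneg[OF Suc.prems, of N] by simp
  \<comment> \<open>A vanishing pivot forces its whole column to vanish, by Cauchy-Schwarz. With
    \<open>x / 0 = 0\<close>, the Schur complement and the factor below then stay correct for pivot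
    0.\<close>
  have zero: "A a N = 0" if "a < N" "?d = 0" for a
    using psd_Cauchy_Schwarz[OF Suc.prems, of a N] that by simp
  define B where "B a b = A a b - A a N * A b N / ?d" for a b
  have "psd {..<N} B"
    unfolding psd_def
  proof (intro conjI ballI allI impI)
    fix x y assume "x \<in> {..<N}" "y \<in> {..<N}"
    then show "B x y = B y x"
      using sym[of x y] by (simp add: B_def)
  next
    fix M and v :: "nat \<Rightarrow> nat" and c assume v: "\<forall>a<M. v a \<in> {..<N}"
    define s where "s = (\<Sum>a<M. c a * A (v a) N)"
    define v' where "v' a = (if a < M then v a else N)" for a
    \<comment> \<open>This coefficient at the extra index \<open>N\<close> minimises the quadratic
      form. The minimum lies \<open>s * s / ?d\<close> below the value without \<open>N\<close>,
      which is exactly what the Schur complement subtracts.\<close>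
    define c' where "c' a = (if a < M then c a else - s / ?d)" for a
    have "0 \<le> (\<Sum>a<Suc M. \<Sum>b<Suc M. c' a * c' b * A (v' a) (v' b))"
      using v by (intro psd_nonneg[OF Suc.prems]) (auto simp: v'_def less_Suc_eq)
    also have "\<dots> = (\<Sum>a<M. \<Sum>b<M. c a * c b * A (v a) (v b))
        + (\<Sum>a<M. c a * (- s / ?d) * A (v a) N) + (\<Sum>b<M. (- s / ?d) * c b * A N (v b))
        + (- s / ?d) * (- s / ?d) * ?d"
      by (simp add: c'_def v'_def sum.distrib sum_negf sum_subtractf)
    also have "(\<Sum>b<M. (- s / ?d) * c b * A N (v b)) = (- s / ?d) * s"
      unfolding s_def sum_distrib_left using v sym by (intro sum.cong) auto
    also have "(\<Sum>a<M. c a * (- s / ?d) * A (v a) N) = (- s / ?d) * s"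
      unfolding s_def sum_distrib_left by (intro sum.cong) auto
    also have "(\<Sum>a<M. \<Sum>b<M. c a * c b * A (v a) (v b)) + (- s / ?d) * s + (- s / ?d) * s
        + (- s / ?d) * (- s / ?d) * ?d =
        (\<Sum>a<M. \<Sum>b<M. c a * c b * A (v a) (v b)) - s * s / ?d"
      by (cases "?d = 0") (auto simp: field_simps)
    also have "s * s / ?d = (\<Sum>a<M. \<Sum>b<M. c a * c b * (A (v a) N * A (v b) N / ?d))"
      unfolding s_def sum_product sum_divide_distrib by (intro sum.cong) (auto simp: field_simps)
    also have "(\<Sum>a<M. \<Sum>b<M. c a * c b * A (v a) (v b)) - \<dots> =
        (\<Sum>a<M. \<Sum>b<M. c a * c b * B (v a) (v b))"
      by (simp add: B_def algebra_simps sum_subtractf)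
    finally show "0 \<le> (\<Sum>a<M. \<Sum>b<M. c a * c b * B (v a) (v b))" .
  qed
  from Suc.IH[OF this] obtain m :: nat and f where f: "\<forall>a<N. \<forall>b<N. B a b = (\<Sum>k<m. f k a * f k b)"
    by blast
  \<comment> \<open>The new row of the factor is the pivot column divided by the root of the pivot;
    the rows obtained from the Schur complement are continued by 0 at \<open>N\<close>.\<close>
  define g where
    "g k a = (if k < m then (if a < N then f k a else 0) else A a N / sqrt ?d)" for k a
  have "A a b = (\<Sum>k<Suc m. g k a * g k b)" if ab: "a < Suc N" "b < Suc N" for a b
  proof -
    have split: "(\<Sum>k<Suc m. g k a * g k b) =
        (\<Sum>k<m. g k a * g k b) + A a N * A b N / ?d"
      using d0 by (simp add: g_def)
    consider "a < N" "b < N" | "a = N" "b \<le> N" | "b = N" "a \<le> N"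
      using ab by linarith
    then show ?thesis
    proof cases
      case 1
      then have "(\<Sum>k<m. g k a * g k b) = B a b" using f by (simp add: g_def)
      then show ?thesis unfolding split by (simp add: B_def)
    next
      case 2
      then show ?thesis
        unfolding split using zero[of b] sym[of N b]
        by (cases "b = N"; cases "?d = 0") (auto simp: g_def)
    next
      case 3
      then show ?thesis
        unfolding split using zero[of a]
        by (cases "a = N"; cases "?d = 0") (auto simp: g_def)
    qed
  qed
  then show ?case by blast
qed

text \<open>The Schur product theorem: by the Gram factorisation of \<open>K\<close> at the given
  points, the quadratic form of the product splits into a sum over \<open>k\<close> of quadratic
  forms of \<open>L\<close> with coefficients \<open>c a * f k a\<close>.\<close>

lemma psd_mult:
  assumes K: "psd X K" and L: "psd X L"
  shows "psd X (\<lambda>x y. K x y * L x y)"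
  unfolding psd_def
proof (intro conjI ballI allI impI)
  fix x y assume "x \<in> X" "y \<in> X"
  then show "K x y * L x y = K y x * L y x"
    using psd_sym[OF K] psd_sym[OF L] by simp
next
  fix N :: nat and u c assume u: "\<forall>a<N. u a \<in> X"
  have "psd {..<N} (\<lambda>a b. K (u a) (u b))"
    using u by (intro psd_pullback[OF K, of _ u]) simp
  then obtain m f where f: "\<forall>a<N. \<forall>b<N. K (u a) (u b) = (\<Sum>k<(m::nat). f k a * f k b)"
    using psd_matrix_gram by blast
  have "(\<Sum>a<N. \<Sum>b<N. c a * c b * (K (u a) (u b) * L (u a) (u b))) =
        (\<Sum>a<N. \<Sum>b<N. \<Sum>k<m. (c a * f k a) * (c b * f k b) * L (u a) (u b))"
    using f by (intro sum.cong refl) (simp add: sum_distrib_left sum_distrib_right algebra_simps)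
  also have "\<dots> = (\<Sum>a<N. \<Sum>k<m. \<Sum>b<N. (c a * f k a) * (c b * f k b) * L (u a) (u b))"
    by (intro sum.cong refl sum.swap)
  also have "\<dots> = (\<Sum>k<m. \<Sum>a<N. \<Sum>b<N. (c a * f k a) * (c b * f k b) * L (u a) (u b))"
    by (rule sum.swap)
  also have "\<dots> \<ge> 0"
    using u by (intro sum_nonneg psd_nonneg[OF L]) auto
  finally show "0 \<le> (\<Sum>a<N. \<Sum>b<N. c a * c b * (K (u a) (u b) * L (u a) (u b)))" .
qed

text \<open>Values at indices from \<open>n\<close> on are unconstrained, in accordance with
  \<open>formal_tensors\<close>.\<close>

definition tensor_carrier :: "nat \<Rightarrow> (nat \<Rightarrow> 'a set) \<Rightarrow> (nat \<Rightarrow> 'a) set" where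
  "tensor_carrier n X = {u. \<forall>j<n. u j \<in> X j}"

lemma psd_prod:
  assumes "\<And>j. j < n \<Longrightarrow> psd (X j) (K j)"
  shows "psd (tensor_carrier n X) (\<lambda>u v. \<Prod>j<n. K j (u j) (v j))"
  using assms
proof (induction n)
  case 0
  then show ?case by (simp add: psd_one)
next
  case (Suc n)
  have "psd (tensor_carrier (Suc n) X) (\<lambda>u v. \<Prod>j<n. K j (u j) (v j))"
    using Suc by (intro psd_subset[OF Suc.IH]) (auto simp: tensor_carrier_def)
  moreover have "psd (tensor_carrier (Suc n) X) (\<lambda>u v. K n (u n) (v n))"
    using Suc by (intro psd_pullback[of "X n" "K n" _ "\<lambda>u. u n"]) (auto simp: tensor_carrier_def)
  ultimately have "psd (tensor_carrier (Suc n) X)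
      (\<lambda>u v. (\<Prod>j<n. K j (u j) (v j)) * K n (u n) (v n))"
    by (rule psd_mult)
  then show ?case by simp
qed

text \<open>The induction step is the telescoping \<open>a b - a' b' = (a - a') b + a' (b - b')\<close>.\<close>

lemma psd_prod_diff:
  assumes "\<And>j. j < n \<Longrightarrow> psd (X j) (K j)" "\<And>j. j < n \<Longrightarrow> psd (X j) (L j)"
    and "\<And>j. j < n \<Longrightarrow> psd (X j) (\<lambda>x y. K j x y - L j x y)"
  shows "psd (tensor_carrier n X) (\<lambda>u v. (\<Prod>j<n. K j (u j) (v j)) - (\<Prod>j<n. L j (u j) (v j)))"
  using assms
proof (induction n)
  case 0
  then show ?case by (simp add: psd_zero)
next
  case (Suc n)
  let ?Y = "tensor_carrier (Suc n) X"
  have sub: "?Y \<subseteq> tensor_carrier n X" by (auto simp: tensor_carrier_def)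
  have 1: "psd ?Y (\<lambda>u v. (\<Prod>j<n. K j (u j) (v j)) - (\<Prod>j<n. L j (u j) (v j)))"
    using Suc by (intro psd_subset[OF Suc.IH sub]) auto
  have 2: "psd ?Y (\<lambda>u v. K n (u n) (v n))"
    using Suc by (intro psd_pullback[of "X n" "K n" _ "\<lambda>u. u n"]) (auto simp: tensor_carrier_def)
  have 3: "psd ?Y (\<lambda>u v. \<Prod>j<n. L j (u j) (v j))"
    using Suc by (intro psd_subset[OF psd_prod sub]) auto
  have 4: "psd ?Y (\<lambda>u v. K n (u n) (v n) - L n (u n) (v n))"
    using Suc by (intro psd_pullback[of "X n" "\<lambda>x y. K n x y - L n x y" _ "\<lambda>u. u n"])
      (auto simp: tensor_carrier_def)
  show ?case
    by (rule psd_cong[OF psd_add[OF psd_mult[OF 1 2] psd_mult[OF 3 4]]])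
      (simp add: algebra_simps)
qed

definition psd_space :: "'a ipspace \<Rightarrow> bool" where
  "psd_space V \<longleftrightarrow> psd (vecs V) (ip V)"

text \<open>
  For a linear map between inner product spaces, this is boundedness with operator norm at most
  \<open>sqrt C\<close>. Stated for Gram matrices, it needs no vector space structure on the carrier, and it also
  covers maps that are linear only up to vectors of norm 0.
\<close>

definition bounded_op :: "'a ipspace \<Rightarrow> 'b ipspace \<Rightarrow> ('a \<Rightarrow> 'b) \<Rightarrow> bool" where
  "bounded_op V W F \<longleftrightarrow>
     (\<forall>x\<in>vecs V. F x \<in> vecs W) \<and>
     (\<exists>C\<ge>0. psd (vecs V) (\<lambda>x y. C * ip V x y - ip W (F x) (F y)))"

text \<open>The kernel of the composition is \<open>D\<close> times the kernel of \<open>F\<close>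
  plus the pullback along \<open>F\<close> of the kernel of \<open>G\<close>, so the constants
  multiply.\<close>

lemma bounded_op_comp:
  assumes "bounded_op V W F" "bounded_op W X G"
  shows "bounded_op V X (\<lambda>x. G (F x))"
proof -
  from assms(1) obtain C where C: "C \<ge> 0" "psd (vecs V) (\<lambda>x y. C * ip V x y - ip W (F x) (F y))"
    and F: "\<And>x. x \<in> vecs V \<Longrightarrow> F x \<in> vecs W" by (auto simp: bounded_op_def)
  from assms(2) obtain D where D: "D \<ge> 0" "psd (vecs W) (\<lambda>x y. D * ip W x y - ip X (G x) (G y))"
    and G: "\<And>x. x \<in> vecs W \<Longrightarrow> G x \<in> vecs X" by (auto simp: bounded_op_def)
  have "psd (vecs V) (\<lambda>x y. (D * C) * ip V x y - ip X (G (F x)) (G (F y)))"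
    by (rule psd_cong[OF psd_add[OF psd_scale[OF C(2) D(1)]
            psd_pullback[OF D(2), of "vecs V" F]]])
      (auto simp: F algebra_simps)
  moreover have "0 \<le> D * C" using C D by simp
  ultimately show ?thesis using F G unfolding bounded_op_def by blast
qed

lemma bounded_op_id: "bounded_op V V id"
  by (auto simp: bounded_op_def psd_zero intro!: exI[of _ 1])

section \<open>Algebraic tensors as formal linear combinations\<close>

definition formal_scale :: "real \<Rightarrow> 'a formal_tensor \<Rightarrow> 'a formal_tensor" where
  "formal_scale r w = map (\<lambda>(c, u). (r * c, u)) w"

definition formal_map :: "(nat \<Rightarrow> 'a \<Rightarrow> 'b) \<Rightarrow> 'a formal_tensor \<Rightarrow> 'b formal_tensor" where
  "formal_map F w = map (\<lambda>(c, u). (c, \<lambda>j. F j (u j))) w"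

lemma formal_diff_eq: "formal_diff w w' = w @ formal_scale (- 1) w'"
  by (simp add: formal_diff_def formal_scale_def)

lemma formal_map_simps:
  "formal_map F (w @ w') = formal_map F w @ formal_map F w'"
  "formal_map F (formal_scale r w) = formal_scale r (formal_map F w)"
  "formal_map F (formal_diff w w') = formal_diff (formal_map F w) (formal_map F w')"
  "formal_map G (formal_map F w) = formal_map (\<lambda>j x. G j (F j x)) w"
  by (induction w) (auto simp: formal_map_def formal_scale_def formal_diff_def)

lemma formal_tensors_simps:
  "w @ w' \<in> formal_tensors n V \<longleftrightarrow> w \<in> formal_tensors n V \<and> w' \<in> formal_tensors n V"
  "w \<in> formal_tensors n V \<Longrightarrow> formal_scale r w \<in> formal_tensors n V"
  "w \<in> formal_tensors n V \<Longrightarrow> w' \<in> formal_tensors n V \<Longrightarrow> formal_diff w w' \<in> formal_tensors n V"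
  "\<forall>j<n. v j \<in> vecs (V j) \<Longrightarrow> [(1, v)] \<in> formal_tensors n V"
  "[] \<in> formal_tensors n V"
  by (auto simp: formal_tensors_def formal_scale_def formal_diff_def)

lemma formal_tensors_nth:
  assumes "w \<in> formal_tensors n V" "a < length w"
  shows "snd (w ! a) \<in> tensor_carrier n (\<lambda>j. vecs (V j))"
  using assms nth_mem[OF assms(2)] unfolding formal_tensors_def tensor_carrier_def case_prod_beta
  by blast

lemma formal_map_formal_tensors:
  assumes "w \<in> formal_tensors n V" "\<And>j x. j < n \<Longrightarrow> x \<in> vecs (V j) \<Longrightarrow> F j x \<in> vecs (W j)"
  shows "formal_map F w \<in> formal_tensors n W"
  using assms by (fastforce simp: formal_tensors_def formal_map_def)

text \<open>Indexed by position, \<open>formal_ip n V w w\<close> is a quadratic form of the product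
  kernel at the components of \<open>w\<close>, which is the shape that \<open>psd\<close> speaks
  about.\<close>

lemma formal_ip_eq_sum_nth:
  "formal_ip n V w w' = (\<Sum>a<length w. \<Sum>b<length w'.
     fst (w ! a) * fst (w' ! b) * (\<Prod>j<n. ip (V j) (snd (w ! a) j) (snd (w' ! b) j)))"
  by (simp add: formal_ip_def sum_list_sum_nth atLeast0LessThan case_prod_beta)

lemma formal_ip_bilinear:
  "formal_ip n V (w @ w') x = formal_ip n V w x + formal_ip n V w' x"
  "formal_ip n V x (w @ w') = formal_ip n V x w + formal_ip n V x w'"
  "formal_ip n V (formal_scale r w) x = r * formal_ip n V w x"
  "formal_ip n V x (formal_scale r w) = r * formal_ip n V x w"
  "formal_ip n V [] x = 0"
proof -
  show "formal_ip n V x (w @ w') = formal_ip n V x w + formal_ip n V x w'"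
    by (induction x) (auto simp: formal_ip_def)
  show "formal_ip n V (formal_scale r w) x = r * formal_ip n V w x"
    by (simp add: formal_ip_eq_sum_nth formal_scale_def case_prod_beta sum_distrib_left mult.assoc)
  show "formal_ip n V x (formal_scale r w) = r * formal_ip n V x w"
    by (simp add: formal_ip_eq_sum_nth formal_scale_def case_prod_beta sum_distrib_left mult_ac)
qed (simp_all add: formal_ip_def)

lemma formal_ip_diff:
  "formal_ip n V (formal_diff w w') x = formal_ip n V w x - formal_ip n V w' x"
  "formal_ip n V x (formal_diff w w') = formal_ip n V x w - formal_ip n V x w'"
  by (simp_all add: formal_diff_eq formal_ip_bilinear)

text \<open>Linear combinations of formal tensors are formed by concatenating scaled lists. A
  quadratic form of \<open>formal_ip\<close> is therefore \<open>formal_ip n V x x\<close> for a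
  single \<open>x\<close>, which is nonnegative by the product of the kernels of the
  factors.\<close>

lemma psd_formal_ip:
  assumes "\<forall>j<n. psd_space (V j)"
  shows "psd (formal_tensors n V) (formal_ip n V)"
proof -
  let ?K = "\<lambda>u v. \<Prod>j<n. ip (V j) (u j) (v j)"
  have K: "psd (tensor_carrier n (\<lambda>j. vecs (V j))) ?K"
    using assms by (intro psd_prod) (simp add: psd_space_def)
  have mem: "snd (w ! a) \<in> tensor_carrier n (\<lambda>j. vecs (V j))"
    if "w \<in> formal_tensors n V" "a < length w" for w a
    using that by (rule formal_tensors_nth)
  have nonneg: "0 \<le> formal_ip n V w w" if "w \<in> formal_tensors n V" for w
    unfolding formal_ip_eq_sum_nth using mem[OF that] by (intro psd_nonneg[OF K])
  have sym: "formal_ip n V w w' = formal_ip n V w' w"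
    if "w \<in> formal_tensors n V" "w' \<in> formal_tensors n V" for w w'
  proof -
    have "formal_ip n V w w' = (\<Sum>b<length w'. \<Sum>a<length w.
        fst (w ! a) * fst (w' ! b) * ?K (snd (w ! a)) (snd (w' ! b)))"
      unfolding formal_ip_eq_sum_nth by (rule sum.swap)
    also have "\<dots> = formal_ip n V w' w"
      unfolding formal_ip_eq_sum_nth
      by (intro sum.cong refl) (simp add: psd_sym[OF K mem[OF that(1)] mem[OF that(2)]])
    finally show ?thesis .
  qed
  have "0 \<le> (\<Sum>a<N. \<Sum>b<N. c a * c b * formal_ip n V (u a) (u b))"
    if u: "\<forall>a<N. u a \<in> formal_tensors n V" for N :: nat and u c
  proof -
    define x where "x M = concat (map (\<lambda>a. formal_scale (c a) (u a)) [0..<M])" for M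
    have x1: "formal_ip n V (x M) y = (\<Sum>a<M. c a * formal_ip n V (u a) y)" for M y
      by (induction M) (auto simp: x_def formal_ip_bilinear)
    have x2: "formal_ip n V y (x M) = (\<Sum>a<M. c a * formal_ip n V y (u a))" for M y
      by (induction M) (auto simp: x_def formal_ip_bilinear formal_ip_eq_sum_nth[of _ _ _ "[]"])
    have "x M \<in> formal_tensors n V" if "M \<le> N" for M
      using that u by (induction M) (auto simp: x_def formal_tensors_simps)
    then have "0 \<le> formal_ip n V (x N) (x N)" by (intro nonneg) simp
    also have "formal_ip n V (x N) (x N) = (\<Sum>a<N. c a * (\<Sum>b<N. c b * formal_ip n V (u a) (u b)))"
      by (subst x1) (simp only: x2)
    finally show ?thesis
      by (simp add: sum_distrib_left mult.assoc)
  qed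
  with sym show ?thesis by (auto simp: psd_def)
qed

text \<open>The difference of the product kernels of \<open>C j * ip (V j)\<close> and of the pulled
  back \<open>ip (W j)\<close> is positive semidefinite. Evaluated at the components of one
  \<open>w\<close>, this bounds the image of the whole sum, with the product of the constants of the
  factors.\<close>

lemma formal_ip_formal_map_le:
  assumes V: "\<forall>j<n. psd_space (V j)" and W: "\<forall>j<n. psd_space (W j)"
    and F: "\<forall>j<n. bounded_op (V j) (W j) (F j)"
  shows "\<exists>C\<ge>0. \<forall>w\<in>formal_tensors n V.
           formal_ip n W (formal_map F w) (formal_map F w) \<le> C * formal_ip n V w w"
proof -
  have "\<forall>j\<in>{..<n}. \<exists>C. C \<ge> 0 \<and>
      psd (vecs (V j)) (\<lambda>x y. C * ip (V j) x y - ip (W j) (F j x) (F j y))"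
    using F unfolding bounded_op_def by blast
  from bchoice[OF this] have "\<exists>C. \<forall>j<n. C j \<ge> 0 \<and>
      psd (vecs (V j)) (\<lambda>x y. C j * ip (V j) x y - ip (W j) (F j x) (F j y))"
    by (simp add: Ball_def)
  then obtain C where C: "\<And>j. j < n \<Longrightarrow> C j \<ge> 0"
    "\<And>j. j < n \<Longrightarrow> psd (vecs (V j)) (\<lambda>x y. C j * ip (V j) x y - ip (W j) (F j x) (F j y))"
    by blast
  let ?K = "\<lambda>u v. \<Prod>j<n. ip (V j) (u j) (v j)"
  let ?L = "\<lambda>u v. \<Prod>j<n. ip (W j) (F j (u j)) (F j (v j))"
  have psd: "psd (tensor_carrier n (\<lambda>j. vecs (V j)))
      (\<lambda>u v. (\<Prod>j<n. C j * ip (V j) (u j) (v j)) - ?L u v)"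
  proof (rule psd_prod_diff)
    fix j assume j: "j < n"
    show "psd (vecs (V j)) (\<lambda>x y. C j * ip (V j) x y)"
      using V C j by (intro psd_scale[of _ "ip (V j)"]) (auto simp: psd_space_def)
    show "psd (vecs (V j)) (\<lambda>x y. ip (W j) (F j x) (F j y))"
      using W F j by (intro psd_pullback[of "vecs (W j)" "ip (W j)" _ "F j"]) (auto simp: psd_space_def bounded_op_def)
  qed (use C in auto)
  have "formal_ip n W (formal_map F w) (formal_map F w) \<le> (\<Prod>j<n. C j) * formal_ip n V w w"
    if w: "w \<in> formal_tensors n V" for w
  proof -
    have len: "length (formal_map F w) = length w" by (simp add: formal_map_def)
    have nth: "formal_map F w ! a = (fst (w ! a), \<lambda>j. F j (snd (w ! a) j))" if "a < length w" for a
      using that by (simp add: formal_map_def case_prod_beta)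
    have "0 \<le> (\<Sum>a<length w. \<Sum>b<length w. fst (w ! a) * fst (w ! b) *
        ((\<Prod>j<n. C j * ip (V j) (snd (w ! a) j) (snd (w ! b) j)) - ?L (snd (w ! a)) (snd (w ! b))))"
    proof (rule psd_nonneg[OF psd])
      fix a assume "a < length w"
      then show "snd (w ! a) \<in> tensor_carrier n (\<lambda>j. vecs (V j))"
        by (rule formal_tensors_nth[OF w])
    qed
    also have "\<dots> = (\<Prod>j<n. C j) * formal_ip n V w w
        - formal_ip n W (formal_map F w) (formal_map F w)"
      unfolding formal_ip_eq_sum_nth len sum_distrib_left sum_subtractf[symmetric]
      by (intro sum.cong refl) (simp add: nth prod.distrib algebra_simps)
    finally show ?thesis by simp
  qed
  with C(1) show ?thesis
    by (intro exI[of _ "\<Prod>j<n. C j"]) (auto intro!: prod_nonneg)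
qed

definition formal_norm :: "nat \<Rightarrow> (nat \<Rightarrow> 'a ipspace) \<Rightarrow> 'a formal_tensor \<Rightarrow> real" where
  "formal_norm n V w = sqrt (formal_ip n V w w)"

lemma formal_norm_map_le:
  assumes "\<forall>j<n. psd_space (V j)" "\<forall>j<n. psd_space (W j)"
    and "\<forall>j<n. bounded_op (V j) (W j) (F j)"
  shows "\<exists>C>0. \<forall>w\<in>formal_tensors n V. formal_norm n W (formal_map F w) \<le> C * formal_norm n V w"
proof -
  obtain C where C: "C \<ge> 0" "\<And>w. w \<in> formal_tensors n V \<Longrightarrow>
      formal_ip n W (formal_map F w) (formal_map F w) \<le> C * formal_ip n V w w"
    using formal_ip_formal_map_le[OF assms] by blast
  \<comment> \<open>\<open>C\<close> may be 0; the summand 1 makes the constant strictly positive,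
    so that an epsilon can be divided by it.\<close>
  have "formal_norm n W (formal_map F w) \<le> (sqrt C + 1) * formal_norm n V w"
    if w: "w \<in> formal_tensors n V" for w
  proof -
    have "formal_norm n W (formal_map F w) \<le> sqrt C * formal_norm n V w"
      using real_sqrt_le_mono[OF C(2)[OF w]] by (simp add: formal_norm_def real_sqrt_mult)
    also have "\<dots> \<le> (sqrt C + 1) * formal_norm n V w"
      using psd_diag_nonneg[OF psd_formal_ip[OF assms(1)] w]
      by (intro mult_right_mono) (auto simp: formal_norm_def)
    finally show ?thesis .
  qed
  moreover have "sqrt C + 1 > 0" using C(1) by (simp add: add_nonneg_pos)
  ultimately show ?thesis by blast
qed

lemma formal_norm_nonneg:
  assumes "\<forall>j<n. psd_space (V j)" "w \<in> formal_tensors n V"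
  shows "0 \<le> formal_norm n V w"
  using psd_diag_nonneg[OF psd_formal_ip[OF assms(1)] assms(2)] by (simp add: formal_norm_def)

lemma formal_ip_self:
  assumes "\<forall>j<n. psd_space (V j)" "w \<in> formal_tensors n V"
  shows "formal_ip n V w w = (formal_norm n V w)\<^sup>2"
  using psd_diag_nonneg[OF psd_formal_ip[OF assms(1)] assms(2)] by (simp add: formal_norm_def)

lemma formal_Cauchy_Schwarz:
  assumes "\<forall>j<n. psd_space (V j)" "w \<in> formal_tensors n V" "w' \<in> formal_tensors n V"
  shows "\<bar>formal_ip n V w w'\<bar> \<le> formal_norm n V w * formal_norm n V w'"
  using psd_Cauchy_Schwarz[OF psd_formal_ip[OF assms(1)] assms(2,3)]
  by (simp add: formal_norm_def)

lemma formal_norm_append_le: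
  assumes V: "\<forall>j<n. psd_space (V j)" and w: "w \<in> formal_tensors n V" "w' \<in> formal_tensors n V"
  shows "formal_norm n V (w @ w') \<le> formal_norm n V w + formal_norm n V w'"
proof (rule power2_le_imp_le)
  have "(formal_norm n V (w @ w'))\<^sup>2 = formal_ip n V (w @ w') (w @ w')"
    using w by (simp add: formal_ip_self[OF V] formal_tensors_simps)
  also have "\<dots> = formal_ip n V w w + 2 * formal_ip n V w w' + formal_ip n V w' w'"
    using psd_sym[OF psd_formal_ip[OF V] w] by (simp add: formal_ip_bilinear)
  also have "\<dots> \<le> (formal_norm n V w)\<^sup>2 + 2 * (formal_norm n V w * formal_norm n V w')
      + (formal_norm n V w')\<^sup>2"
    using formal_Cauchy_Schwarz[OF V w] by (simp add: formal_ip_self[OF V] w)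
  finally show "(formal_norm n V (w @ w'))\<^sup>2 \<le> (formal_norm n V w + formal_norm n V w')\<^sup>2"
    by (simp add: power2_sum)
qed (use formal_norm_nonneg[OF V] w in auto)

lemma formal_norm_scale: "formal_norm n V (formal_scale r w) = \<bar>r\<bar> * formal_norm n V w"
  by (simp add: formal_norm_def formal_ip_bilinear real_sqrt_mult flip: mult.assoc)

text \<open>Different lists may denote the same algebraic tensor, so rearrangements are justified
  through inner products instead of equality of lists.\<close>

lemma formal_norm_cong:
  assumes "\<And>x. formal_ip n V w x = formal_ip n V w' x" "\<And>x. formal_ip n V x w = formal_ip n V x w'"
  shows "formal_norm n V w = formal_norm n V w'"
  by (simp add: formal_norm_def assms)

lemma formal_Cauchy_iff:
  "formal_Cauchy n V w \<longleftrightarrow>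
     (\<forall>e>0. \<exists>N. \<forall>p\<ge>N. \<forall>q\<ge>N. formal_norm n V (formal_diff (w p) (w q)) < e)"
  by (simp add: formal_Cauchy_def formal_norm_def)

lemma formal_Cauchy_append:
  assumes V: "\<forall>j<n. psd_space (V j)"
    and w: "\<And>m. w m \<in> formal_tensors n V" "\<And>m. w' m \<in> formal_tensors n V"
    and "formal_Cauchy n V w" "formal_Cauchy n V w'"
  shows "formal_Cauchy n V (\<lambda>m. w m @ w' m)"
  unfolding formal_Cauchy_iff
proof (intro allI impI)
  fix e :: real assume "e > 0"
  then have "e / 2 > 0" by simp
  from assms(4)[unfolded formal_Cauchy_iff, rule_format, OF this] obtain N1 where
    N1: "\<And>p q. p \<ge> N1 \<Longrightarrow> q \<ge> N1 \<Longrightarrow> formal_norm n V (formal_diff (w p) (w q)) < e / 2" by blast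
  from assms(5)[unfolded formal_Cauchy_iff, rule_format, OF \<open>e / 2 > 0\<close>] obtain N2 where
    N2: "\<And>p q. p \<ge> N2 \<Longrightarrow> q \<ge> N2 \<Longrightarrow> formal_norm n V (formal_diff (w' p) (w' q)) < e / 2" by blast
  have "formal_norm n V (formal_diff (w p @ w' p) (w q @ w' q)) < e"
    if "p \<ge> max N1 N2" "q \<ge> max N1 N2" for p q
  proof -
    have "formal_norm n V (formal_diff (w p @ w' p) (w q @ w' q)) =
        formal_norm n V (formal_diff (w p) (w q) @ formal_diff (w' p) (w' q))"
      by (rule formal_norm_cong) (simp_all add: formal_ip_diff formal_ip_bilinear)
    also have "\<dots> \<le> formal_norm n V (formal_diff (w p) (w q)) + formal_norm n V (formal_diff (w' p) (w' q))"
      by (intro formal_norm_append_le V formal_tensors_simps w)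
    also have "\<dots> < e / 2 + e / 2"
      using that by (intro add_strict_mono N1 N2) auto
    finally show ?thesis by simp
  qed
  then show "\<exists>N. \<forall>p\<ge>N. \<forall>q\<ge>N. formal_norm n V (formal_diff (w p @ w' p) (w q @ w' q)) < e"
    by blast
qed

lemma formal_Cauchy_scale:
  assumes "formal_Cauchy n V w"
  shows "formal_Cauchy n V (\<lambda>m. formal_scale r (w m))"
  unfolding formal_Cauchy_iff
proof (intro allI impI)
  fix e :: real assume "e > 0"
  \<comment> \<open>The summand 1 covers the case \<open>r = 0\<close>.\<close>
  then have "e / (\<bar>r\<bar> + 1) > 0" by simp
  from assms[unfolded formal_Cauchy_iff, rule_format, OF this] obtain N where
    N: "\<And>p q. p \<ge> N \<Longrightarrow> q \<ge> N \<Longrightarrow> formal_norm n V (formal_diff (w p) (w q)) < e / (\<bar>r\<bar> + 1)" by blast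
  have "formal_norm n V (formal_diff (formal_scale r (w p)) (formal_scale r (w q))) < e"
    if "p \<ge> N" "q \<ge> N" for p q
  proof -
    have "formal_norm n V (formal_diff (formal_scale r (w p)) (formal_scale r (w q))) =
        formal_norm n V (formal_scale r (formal_diff (w p) (w q)))"
      by (rule formal_norm_cong)
        (simp_all add: formal_ip_diff formal_ip_bilinear algebra_simps)
    also have "\<dots> = \<bar>r\<bar> * formal_norm n V (formal_diff (w p) (w q))"
      by (rule formal_norm_scale)
    also have "\<dots> \<le> \<bar>r\<bar> * (e / (\<bar>r\<bar> + 1))"
      using N[OF that] by (intro mult_left_mono) auto
    also have "\<dots> < e" using \<open>e > 0\<close> by (simp add: field_simps)
    finally show ?thesis .
  qed
  then show "\<exists>N. \<forall>p\<ge>N. \<forall>q\<ge>N.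
      formal_norm n V (formal_diff (formal_scale r (w p)) (formal_scale r (w q))) < e"
    by blast
qed

section \<open>Limits of algebraic tensors in the completion\<close>

lemma tensor_form_in:
  "\<forall>j<n. v j \<in> vecs (V j) \<Longrightarrow> tensor_form n V w v = formal_ip n V w [(1, v)]"
  unfolding tensor_form_def by (rule if_P)

lemma tensor_form_out: "\<not> (\<forall>j<n. v j \<in> vecs (V j)) \<Longrightarrow> tensor_form n V w v = 0"
  unfolding tensor_form_def by (rule if_not_P)

lemma tensor_form_simps:
  "tensor_form n V (w @ w') v = tensor_form n V w v + tensor_form n V w' v"
  "tensor_form n V (formal_scale r w) v = r * tensor_form n V w v"
  "tensor_form n V (formal_diff w w') v = tensor_form n V w v - tensor_form n V w' v"
proof -
  have "tensor_form n V (w @ w') v = tensor_form n V w v + tensor_form n V w' v \<and>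
      tensor_form n V (formal_scale r w) v = r * tensor_form n V w v \<and>
      tensor_form n V (formal_diff w w') v = tensor_form n V w v - tensor_form n V w' v"
  proof (cases "\<forall>j<n. v j \<in> vecs (V j)")
    case True
    show ?thesis
      unfolding tensor_form_in[OF True] formal_ip_bilinear formal_ip_diff by simp
  next
    case False
    show ?thesis unfolding tensor_form_out[OF False] by simp
  qed
  then show "tensor_form n V (w @ w') v = tensor_form n V w v + tensor_form n V w' v"
    "tensor_form n V (formal_scale r w) v = r * tensor_form n V w v"
    "tensor_form n V (formal_diff w w') v = tensor_form n V w v - tensor_form n V w' v"
    by blast+
qed

lemma tensor_lim_append:
  assumes "\<forall>j<n. psd_space (V j)" "tensor_lim n V w \<Phi>" "tensor_lim n V w' \<Psi>"
  shows "tensor_lim n V (\<lambda>m. w m @ w' m) (\<lambda>v. \<Phi> v + \<Psi> v)"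
  using assms formal_Cauchy_append[of n V w w']
  by (auto simp: tensor_lim_def formal_tensors_simps tensor_form_simps intro!: tendsto_add)

lemma tensor_lim_scale:
  assumes "tensor_lim n V w \<Phi>"
  shows "tensor_lim n V (\<lambda>m. formal_scale r (w m)) (\<lambda>v. r * \<Phi> v)"
  using assms formal_Cauchy_scale[of n V w r]
  by (auto simp: tensor_lim_def formal_tensors_simps tensor_form_simps intro!: tendsto_mult)

lemma tensor_lim_zero: "tensor_lim n V (\<lambda>_. []) (\<lambda>_. 0)"
  by (auto simp: tensor_lim_def formal_tensors_simps formal_Cauchy_def formal_diff_def
      formal_ip_bilinear tensor_form_def)

lemma tensor_form_abs_le:
  assumes "\<forall>j<n. psd_space (V j)" "w \<in> formal_tensors n V" "\<forall>j<n. v j \<in> vecs (V j)"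
  shows "\<bar>tensor_form n V w v\<bar> \<le> formal_norm n V w * formal_norm n V [(1, v)]"
  using formal_Cauchy_Schwarz[OF assms(1,2) formal_tensors_simps(4)[of n v V]] assms(3)
  by (simp add: tensor_form_def)

text \<open>Pairing with a fixed elementary tensor is bounded by Cauchy-Schwarz, so the values at
  each \<open>v\<close> form a Cauchy sequence of reals. Completeness of the reals thus already
  yields the limits in the completion.\<close>

lemma formal_Cauchy_imp_tensor_lim:
  assumes V: "\<forall>j<n. psd_space (V j)"
    and w: "\<And>m. w m \<in> formal_tensors n V" and "formal_Cauchy n V w"
  shows "\<exists>\<Phi>. tensor_lim n V w \<Phi>"
proof -
  have "convergent (\<lambda>m. tensor_form n V (w m) v)" for v
  proof (cases "\<forall>j<n. v j \<in> vecs (V j)")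
    case True
    let ?B = "formal_norm n V [(1, v)]"
    have B: "0 \<le> ?B" by (intro formal_norm_nonneg V formal_tensors_simps True)
    have "Cauchy (\<lambda>m. tensor_form n V (w m) v)"
    proof (rule CauchyI)
      fix e :: real assume "e > 0"
      then have "e / (?B + 1) > 0" using B by simp
      from assms(3)[unfolded formal_Cauchy_iff, rule_format, OF this] obtain N where
        N: "\<And>p q. p \<ge> N \<Longrightarrow> q \<ge> N \<Longrightarrow> formal_norm n V (formal_diff (w p) (w q)) < e / (?B + 1)"
        by blast
      have "norm (tensor_form n V (w p) v - tensor_form n V (w q) v) < e" if "p \<ge> N" "q \<ge> N" for p q
      proof -
        have "\<bar>tensor_form n V (formal_diff (w p) (w q)) v\<bar>
            \<le> formal_norm n V (formal_diff (w p) (w q)) * ?B"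
          by (intro tensor_form_abs_le V formal_tensors_simps w True)
        also have "\<dots> \<le> e / (?B + 1) * ?B"
          using N[OF that] B by (intro mult_right_mono) auto
        also have "\<dots> < e" using \<open>e > 0\<close> B by (simp add: field_simps add_pos_nonneg)
        finally show ?thesis by (simp add: tensor_form_simps)
      qed
      then show "\<exists>N. \<forall>p\<ge>N. \<forall>q\<ge>N.
          norm (tensor_form n V (w p) v - tensor_form n V (w q) v) < e" by blast
    qed
    then show ?thesis by (simp add: Cauchy_convergent_iff)
  next
    case False
    show ?thesis unfolding tensor_form_out[OF False] by (rule convergent_const)
  qed
  then have "\<forall>v. \<exists>l. (\<lambda>m. tensor_form n V (w m) v) \<longlonglongrightarrow> l"
    by (simp add: convergent_def)
  then obtain \<Phi> where "\<forall>v. (\<lambda>m. tensor_form n V (w m) v) \<longlonglongrightarrow> \<Phi> v" by metis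
  with assms show ?thesis by (auto simp: tensor_lim_def)
qed

text \<open>
  The elementary tensors span the algebraic tensors, so \<open>\<langle>w p, w N\<rangle> \<longlonglongrightarrow> 0\<close> for fixed \<open>N\<close>, and the
  Cauchy property makes \<open>\<langle>w p, w p - w N\<rangle>\<close> small.
\<close>

lemma tensor_lim_zero_imp_norm:
  assumes V: "\<forall>j<n. psd_space (V j)" and lim: "tensor_lim n V w (\<lambda>_. 0)"
  shows "(\<lambda>m. formal_norm n V (w m)) \<longlonglongrightarrow> 0"
proof -
  have w: "\<And>m. w m \<in> formal_tensors n V" and C: "formal_Cauchy n V w"
    and form: "\<And>v. (\<lambda>m. tensor_form n V (w m) v) \<longlonglongrightarrow> 0"
    using lim by (auto simp: tensor_lim_def)
  have weak: "(\<lambda>m. formal_ip n V (w m) x) \<longlonglongrightarrow> 0" if "x \<in> formal_tensors n V" for x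
    using that
  proof (induction x)
    case Nil
    then show ?case by (simp add: formal_ip_eq_sum_nth)
  next
    case (Cons a x)
    obtain c u where a: "a = (c, u)" by force
    have u: "\<forall>j<n. u j \<in> vecs (V j)" and x: "x \<in> formal_tensors n V"
      using Cons.prems by (auto simp: a formal_tensors_def)
    have "a # x = formal_scale c [(1, u)] @ x" by (simp add: a formal_scale_def)
    then have "formal_ip n V (w m) (a # x) = c * tensor_form n V (w m) u + formal_ip n V (w m) x" for m
      by (simp only: formal_ip_bilinear tensor_form_in[OF u])
    moreover have "(\<lambda>m. c * tensor_form n V (w m) u + formal_ip n V (w m) x) \<longlonglongrightarrow> c * 0 + 0"
      by (intro tendsto_intros form Cons.IH x)
    ultimately show ?case by simp
  qed
  have norm0: "0 \<le> formal_norm n V x" if "x \<in> formal_tensors n V" for x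
    using that by (intro formal_norm_nonneg V)
  have "(\<lambda>m. formal_ip n V (w m) (w m)) \<longlonglongrightarrow> 0"
  proof (rule LIMSEQ_I)
    fix e :: real assume e: "e > 0"
    from C[unfolded formal_Cauchy_iff, rule_format, of 1] obtain N0 where
      N0: "\<And>p q. p \<ge> N0 \<Longrightarrow> q \<ge> N0 \<Longrightarrow> formal_norm n V (formal_diff (w p) (w q)) < 1" by auto
    \<comment> \<open>A Cauchy sequence is bounded in norm: from \<open>N0\<close> on it stays
      within 1 of its member at \<open>N0\<close>.\<close>
    define B where "B = formal_norm n V (w N0) + 1"
    have B: "B > 0" using norm0[OF w[of N0]] by (simp add: B_def)
    have bound: "formal_norm n V (w p) \<le> B" if "p \<ge> N0" for p
    proof -
      have "formal_norm n V (w p) = formal_norm n V (formal_diff (w p) (w N0) @ w N0)"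
        by (rule formal_norm_cong) (simp_all add: formal_ip_diff formal_ip_bilinear)
      also have "\<dots> \<le> formal_norm n V (formal_diff (w p) (w N0)) + formal_norm n V (w N0)"
        by (intro formal_norm_append_le V formal_tensors_simps w)
      also have "\<dots> \<le> B" using N0[OF that, of N0] by (simp add: B_def)
      finally show ?thesis .
    qed
    have "e / (2 * B) > 0" using e B by simp
    from C[unfolded formal_Cauchy_iff, rule_format, OF this] obtain N1 where
      N1: "\<And>p q. p \<ge> N1 \<Longrightarrow> q \<ge> N1 \<Longrightarrow> formal_norm n V (formal_diff (w p) (w q)) < e / (2 * B)"
      by blast
    from LIMSEQ_D[OF weak[OF w[of N1]], of "e / 2"] e obtain N2 where
      N2: "\<And>p. p \<ge> N2 \<Longrightarrow> \<bar>formal_ip n V (w p) (w N1)\<bar> < e / 2" by auto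
    have "norm (formal_ip n V (w p) (w p) - 0) < e" if "p \<ge> max N0 (max N1 N2)" for p
    proof -
      have "formal_ip n V (w p) (w p) =
          formal_ip n V (w p) (formal_diff (w p) (w N1)) + formal_ip n V (w p) (w N1)"
        by (simp add: formal_ip_diff)
      moreover have "\<bar>formal_ip n V (w p) (formal_diff (w p) (w N1))\<bar>
          \<le> formal_norm n V (w p) * formal_norm n V (formal_diff (w p) (w N1))"
        by (intro formal_Cauchy_Schwarz V w formal_tensors_simps)
      moreover have "\<dots> \<le> B * (e / (2 * B))"
        using that N1[of p N1] bound[of p] B
        by (intro mult_mono norm0 w formal_tensors_simps) auto
      moreover have "B * (e / (2 * B)) = e / 2" using B by simp
      moreover have "\<bar>formal_ip n V (w p) (w N1)\<bar> < e / 2" using that N2 by simp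
      ultimately show ?thesis by simp
    qed
    then show "\<exists>N. \<forall>p\<ge>N. norm (formal_ip n V (w p) (w p) - 0) < e" by blast
  qed
  then show ?thesis
    unfolding formal_norm_def using tendsto_real_sqrt by fastforce
qed

section \<open>Tensor products of bounded operators\<close>

lemma tensor_lim_formal_map:
  assumes V: "\<forall>j<n. psd_space (V j)" and W: "\<forall>j<n. psd_space (W j)"
    and F: "\<forall>j<n. bounded_op (V j) (W j) (F j)"
    and lim: "tensor_lim n V w \<Phi>"
  shows "\<exists>\<Psi>. tensor_lim n W (\<lambda>m. formal_map F (w m)) \<Psi>"
proof (rule formal_Cauchy_imp_tensor_lim[OF W])
  have w: "\<And>m. w m \<in> formal_tensors n V" and C: "formal_Cauchy n V w"
    using lim by (auto simp: tensor_lim_def)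
  show "formal_map F (w m) \<in> formal_tensors n W" for m
    using w F by (intro formal_map_formal_tensors[of _ n V]) (auto simp: bounded_op_def)
  obtain B where B: "B > 0"
    "\<And>w. w \<in> formal_tensors n V \<Longrightarrow> formal_norm n W (formal_map F w) \<le> B * formal_norm n V w"
    using formal_norm_map_le[OF V W F] by blast
  show "formal_Cauchy n W (\<lambda>m. formal_map F (w m))"
    unfolding formal_Cauchy_iff
  proof (intro allI impI)
    fix e :: real assume "e > 0"
    then have "e / B > 0" using B by simp
    from C[unfolded formal_Cauchy_iff, rule_format, OF this] obtain N where
      N: "\<And>p q. p \<ge> N \<Longrightarrow> q \<ge> N \<Longrightarrow> formal_norm n V (formal_diff (w p) (w q)) < e / B" by blast
    have "formal_norm n W (formal_diff (formal_map F (w p)) (formal_map F (w q))) < e"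
      if "p \<ge> N" "q \<ge> N" for p q
    proof -
      have "formal_norm n W (formal_map F (formal_diff (w p) (w q)))
          \<le> B * formal_norm n V (formal_diff (w p) (w q))"
        by (intro B(2) formal_tensors_simps w)
      also have "\<dots> < B * (e / B)"
        using N[OF that] B(1) by (intro mult_strict_left_mono) auto
      finally show ?thesis using B(1) by (simp add: formal_map_simps)
    qed
    then show "\<exists>N. \<forall>p\<ge>N. \<forall>q\<ge>N.
        formal_norm n W (formal_diff (formal_map F (w p)) (formal_map F (w q))) < e" by blast
  qed
qed

text \<open>Equality of the limiting forms is only weak information, and no adjoint of
  \<open>F\<close> is at hand to transport it. The difference of the two sequences, however, also
  tends to 0 in norm, and this passes through \<open>formal_map\<close> by the bound on
  \<open>F\<close>.\<close>

lemma tensor_lim_formal_map_unique: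
  assumes V: "\<forall>j<n. psd_space (V j)" and W: "\<forall>j<n. psd_space (W j)"
    and F: "\<forall>j<n. bounded_op (V j) (W j) (F j)"
    and lim: "tensor_lim n V w \<Phi>" "tensor_lim n V w' \<Phi>"
    and limF: "tensor_lim n W (\<lambda>m. formal_map F (w m)) \<Psi>"
      "tensor_lim n W (\<lambda>m. formal_map F (w' m)) \<Psi>'"
  shows "\<Psi> = \<Psi>'"
proof
  fix v
  let ?x = "\<lambda>m. formal_diff (w m) (w' m)"
  have w: "\<And>m. w m \<in> formal_tensors n V" "\<And>m. w' m \<in> formal_tensors n V"
    using lim by (auto simp: tensor_lim_def)
  obtain B where B: "B > 0"
    "\<And>w. w \<in> formal_tensors n V \<Longrightarrow> formal_norm n W (formal_map F w) \<le> B * formal_norm n V w"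
    using formal_norm_map_le[OF V W F] by blast
  have "tensor_lim n V ?x (\<lambda>_. 0)"
    using tensor_lim_append[OF V lim(1) tensor_lim_scale[OF lim(2), of "- 1"]]
    by (simp add: formal_diff_eq)
  from tensor_lim_zero_imp_norm[OF V this]
  have norm: "(\<lambda>m. formal_norm n V (?x m)) \<longlonglongrightarrow> 0" by blast
  have "(\<lambda>m. tensor_form n W (formal_map F (?x m)) v) \<longlonglongrightarrow> 0"
  proof (cases "\<forall>j<n. v j \<in> vecs (W j)")
    case True
    let ?D = "formal_norm n W [(1, v)]"
    have D: "0 \<le> ?D" by (intro formal_norm_nonneg W formal_tensors_simps True)
    show ?thesis
    proof (rule tendsto_rabs_zero_cancel, rule tendsto_sandwich[OF _ _ tendsto_const])
      show "\<forall>\<^sub>F m in sequentially. \<bar>tensor_form n W (formal_map F (?x m)) v\<bar>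
          \<le> B * formal_norm n V (?x m) * ?D"
      proof (intro always_eventually allI)
        fix m
        have x: "?x m \<in> formal_tensors n V" by (intro formal_tensors_simps w)
        have "\<bar>tensor_form n W (formal_map F (?x m)) v\<bar> \<le> formal_norm n W (formal_map F (?x m)) * ?D"
          using F by (intro tensor_form_abs_le W True formal_map_formal_tensors[OF x])
            (auto simp: bounded_op_def)
        also have "\<dots> \<le> B * formal_norm n V (?x m) * ?D"
          by (intro mult_right_mono B D x)
        finally show "\<bar>tensor_form n W (formal_map F (?x m)) v\<bar> \<le> B * formal_norm n V (?x m) * ?D" .
      qed
      show "(\<lambda>m. B * formal_norm n V (?x m) * ?D) \<longlonglongrightarrow> 0"
        using tendsto_mult[OF tendsto_mult[OF tendsto_const norm] tendsto_const, of B ?D] by simp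
    qed auto
  next
    case False
    show ?thesis unfolding tensor_form_out[OF False] by (rule tendsto_const)
  qed
  moreover have "(\<lambda>m. tensor_form n W (formal_map F (?x m)) v) \<longlonglongrightarrow> \<Psi> v - \<Psi>' v"
    using limF by (auto simp: tensor_lim_def formal_map_simps tensor_form_simps intro!: tendsto_diff)
  ultimately show "\<Psi> v = \<Psi>' v"
    using LIMSEQ_unique by fastforce
qed

text \<open>Existence and uniqueness of the limit resolve the definite description in
  \<open>tensor_op\<close>. From here on its value is read off from any approximating
  sequence.\<close>

lemma tensor_lim_tensor_op:
  assumes V: "\<forall>j<n. psd_space (V j)" and W: "\<forall>j<n. psd_space (W j)"
    and F: "\<forall>j<n. bounded_op (V j) (W j) (F j)"
    and lim: "tensor_lim n V w \<Phi>"
  shows "tensor_lim n W (\<lambda>m. formal_map F (w m)) (tensor_op n V W F \<Phi>)"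
proof -
  from tensor_lim_formal_map[OF assms] obtain \<Psi>
    where \<Psi>: "tensor_lim n W (\<lambda>m. formal_map F (w m)) \<Psi>" by blast
  have "tensor_op n V W F \<Phi> = \<Psi>"
    unfolding tensor_op_def formal_map_def[symmetric]
  proof (rule the_equality)
    fix \<Psi>' assume "\<exists>w. tensor_lim n V w \<Phi> \<and> tensor_lim n W (\<lambda>m. formal_map F (w m)) \<Psi>'"
    then show "\<Psi>' = \<Psi>"
      using tensor_lim_formal_map_unique[OF V W F] lim \<Psi> by blast
  qed (use lim \<Psi> in blast)
  with \<Psi> show ?thesis by simp
qed

lemma tensor_lim_unique: "tensor_lim n V w \<Phi> \<Longrightarrow> tensor_lim n V w \<Psi> \<Longrightarrow> \<Phi> = \<Psi>"
  by (rule ext) (metis LIMSEQ_unique tensor_lim_def)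

lemma tensor_op_hilbert_tensor:
  assumes "\<forall>j<n. psd_space (V j)" "\<forall>j<n. psd_space (W j)"
    and "\<forall>j<n. bounded_op (V j) (W j) (F j)"
    and "\<Phi> \<in> hilbert_tensor n V"
  shows "tensor_op n V W F \<Phi> \<in> hilbert_tensor n W"
proof -
  from assms(4) obtain w where "tensor_lim n V w \<Phi>" by (auto simp: hilbert_tensor_def)
  from tensor_lim_tensor_op[OF assms(1-3) this] show ?thesis by (auto simp: hilbert_tensor_def)
qed

lemma hilbert_tensor_sum:
  assumes "\<forall>j<n. psd_space (V j)" "\<And>x. x \<in> A \<Longrightarrow> \<Phi> x \<in> hilbert_tensor n V"
  shows "(\<lambda>v. \<Sum>x\<in>A. r x * \<Phi> x v) \<in> hilbert_tensor n V"
  using assms(2)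
proof (induction A rule: infinite_finite_induct)
  case (insert a A)
  then obtain w w' where "tensor_lim n V w (\<Phi> a)" "tensor_lim n V w' (\<lambda>v. \<Sum>x\<in>A. r x * \<Phi> x v)"
    by (force simp: hilbert_tensor_def)
  from tensor_lim_append[OF assms(1) tensor_lim_scale[OF this(1), of "r a"] this(2)] insert.hyps
  show ?case by (auto simp: hilbert_tensor_def)
qed (auto simp: hilbert_tensor_def intro!: tensor_lim_zero)

text \<open>Scaling and concatenation of approximating sequences commute with
  \<open>formal_map\<close>. The purpose is to move operators past the signed sum that makes up an
  exterior derivative.\<close>

lemma tensor_op_sum:
  assumes V: "\<forall>j<n. psd_space (V j)" and W: "\<forall>j<n. psd_space (W j)"
    and F: "\<forall>j<n. bounded_op (V j) (W j) (F j)"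
    and \<Phi>: "\<And>x. x \<in> A \<Longrightarrow> \<Phi> x \<in> hilbert_tensor n V"
  shows "tensor_op n V W F (\<lambda>v. \<Sum>x\<in>A. r x * \<Phi> x v) = (\<lambda>v. \<Sum>x\<in>A. r x * tensor_op n V W F (\<Phi> x) v)"
proof -
  have zero: "tensor_op n V W F (\<lambda>_. 0) = (\<lambda>_. 0)"
    using tensor_lim_unique[OF tensor_lim_tensor_op[OF V W F tensor_lim_zero], of "\<lambda>_. 0"]
    by (simp add: formal_map_def tensor_lim_zero)
  show ?thesis
    using \<Phi>
  proof (induction A rule: infinite_finite_induct)
    case (insert a A)
    from insert.prems have "(\<lambda>v. \<Sum>x\<in>A. r x * \<Phi> x v) \<in> hilbert_tensor n V"
      by (intro hilbert_tensor_sum V) auto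
    with insert.prems obtain w w' where
      w: "tensor_lim n V w (\<Phi> a)" "tensor_lim n V w' (\<lambda>v. \<Sum>x\<in>A. r x * \<Phi> x v)"
      by (force simp: hilbert_tensor_def)
    have 1: "tensor_lim n W (\<lambda>m. formal_map F (formal_scale (r a) (w m) @ w' m))
        (tensor_op n V W F (\<lambda>v. r a * \<Phi> a v + (\<Sum>x\<in>A. r x * \<Phi> x v)))"
      by (intro tensor_lim_tensor_op[OF V W F] tensor_lim_append tensor_lim_scale V w)
    have 2: "tensor_lim n W (\<lambda>m. formal_map F (formal_scale (r a) (w m) @ w' m))
        (\<lambda>v. r a * tensor_op n V W F (\<Phi> a) v + tensor_op n V W F (\<lambda>v. \<Sum>x\<in>A. r x * \<Phi> x v) v)"
      unfolding formal_map_simps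
      by (intro tensor_lim_append tensor_lim_scale tensor_lim_tensor_op[OF V W F] W w)
    show ?case
      using tensor_lim_unique[OF 1 2] insert by simp
  qed (simp_all add: zero)
qed

text \<open>One approximating sequence of \<Phi> computes both sides, since mapping twice is mapping
  once with the composites.\<close>

lemma tensor_op_comp:
  assumes V: "\<forall>j<n. psd_space (V j)" and W: "\<forall>j<n. psd_space (W j)"
    and X: "\<forall>j<n. psd_space (X j)"
    and F: "\<forall>j<n. bounded_op (V j) (W j) (F j)"
    and G: "\<forall>j<n. bounded_op (W j) (X j) (G j)"
    and "\<Phi> \<in> hilbert_tensor n V"
  shows "tensor_op n W X G (tensor_op n V W F \<Phi>) = tensor_op n V X (\<lambda>j x. G j (F j x)) \<Phi>"
proof -
  from assms(6) obtain w where w: "tensor_lim n V w \<Phi>" by (auto simp: hilbert_tensor_def)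
  have "tensor_lim n X (\<lambda>m. formal_map (\<lambda>j x. G j (F j x)) (w m))
      (tensor_op n W X G (tensor_op n V W F \<Phi>))"
    using tensor_lim_tensor_op[OF W X G tensor_lim_tensor_op[OF V W F w]]
    by (simp add: formal_map_simps)
  moreover have "tensor_lim n X (\<lambda>m. formal_map (\<lambda>j x. G j (F j x)) (w m))
      (tensor_op n V X (\<lambda>j x. G j (F j x)) \<Phi>)"
  proof (intro tensor_lim_tensor_op V X w allI impI)
    fix j assume "j < n"
    with F G show "bounded_op (V j) (X j) (\<lambda>x. G j (F j x))"
      using bounded_op_comp[of "V j" "W j" "F j" "X j" "G j"] by blast
  qed
  ultimately show ?thesis by (rule tensor_lim_unique)
qed

text \<open>The two mapped lists need not be equal, because their components may differ at indices
  from \<open>n\<close> on; \<open>formal_ip\<close> only looks at indices below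
  \<open>n\<close>.\<close>

lemma formal_ip_formal_map_cong:
  fixes F G :: "nat \<Rightarrow> 'a \<Rightarrow> 'b"
  assumes "w \<in> formal_tensors n V" "\<And>j x. j < n \<Longrightarrow> x \<in> vecs (V j) \<Longrightarrow> F j x = G j x"
  shows "formal_ip n W (formal_map F w) y = formal_ip n W (formal_map G w) y"
proof -
  have len: "length (formal_map H w) = length w" for H :: "nat \<Rightarrow> 'a \<Rightarrow> 'b" by (simp add: formal_map_def)
  have nth: "formal_map H w ! a = (fst (w ! a), \<lambda>j. H j (snd (w ! a) j))"
    if "a < length w" for a and H :: "nat \<Rightarrow> 'a \<Rightarrow> 'b"
    using that by (simp add: formal_map_def case_prod_beta)
  have eq: "F j (snd (w ! a) j) = G j (snd (w ! a) j)" if "a < length w" "j < n" for a j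
    using assms that formal_tensors_nth[of w n V a] by (simp add: tensor_carrier_def)
  show ?thesis
    by (simp add: formal_ip_eq_sum_nth len nth eq)
qed

lemma tensor_op_cong:
  assumes V: "\<forall>j<n. psd_space (V j)" and W: "\<forall>j<n. psd_space (W j)"
    and F: "\<forall>j<n. bounded_op (V j) (W j) (F j)"
    and G: "\<forall>j<n. bounded_op (V j) (W j) (G j)"
    and eq: "\<And>j x. j < n \<Longrightarrow> x \<in> vecs (V j) \<Longrightarrow> F j x = G j x"
    and "\<Phi> \<in> hilbert_tensor n V"
  shows "tensor_op n V W F \<Phi> = tensor_op n V W G \<Phi>"
proof
  fix v
  from assms(6) obtain w where w: "tensor_lim n V w \<Phi>" by (auto simp: hilbert_tensor_def)
  then have mem: "\<And>m. w m \<in> formal_tensors n V" by (auto simp: tensor_lim_def)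
  have eq': "tensor_form n W (formal_map F (w m)) v = tensor_form n W (formal_map G (w m)) v" for m
    unfolding tensor_form_def by (simp only: formal_ip_formal_map_cong[of "w m" n V F G, OF mem eq])
  have "(\<lambda>m. tensor_form n W (formal_map F (w m)) v) \<longlonglongrightarrow> tensor_op n V W F \<Phi> v"
    using tensor_lim_tensor_op[OF V W F w] by (simp add: tensor_lim_def)
  moreover have "(\<lambda>m. tensor_form n W (formal_map G (w m)) v) \<longlonglongrightarrow> tensor_op n V W G \<Phi> v"
    using tensor_lim_tensor_op[OF V W G w] by (simp add: tensor_lim_def)
  ultimately show "tensor_op n V W F \<Phi> v = tensor_op n V W G \<Phi> v"
    unfolding eq' by (rule LIMSEQ_unique)
qed

section \<open>Smooth cutoff functions\<close>

text \<open>This is the differentiability clause of \<open>test_fun\<close>, separated from the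
  condition on the support.\<close>

definition smooth :: "(real \<Rightarrow> real) \<Rightarrow> bool" where
  "smooth f \<longleftrightarrow> (\<forall>m x. (deriv ^^ m) f field_differentiable at x)"

text \<open>A family of differentiable functions closed under \<open>deriv\<close> contains all
  iterated derivatives of its members. This replaces explicit formulas for higher derivatives in the
  closure properties below.\<close>

lemma smooth_coinduct:
  assumes "f \<in> S" "\<And>g. g \<in> S \<Longrightarrow> deriv g \<in> S" "\<And>g x. g \<in> S \<Longrightarrow> g field_differentiable at x"
  shows "smooth f"
proof -
  have "(deriv ^^ m) f \<in> S" for m
    by (induction m) (auto intro: assms)
  then show ?thesis by (simp add: smooth_def assms(3))
qed

lemma smooth_deriv: "smooth f \<Longrightarrow> smooth (deriv f)"
  unfolding smooth_def by (metis funpow_Suc_right comp_apply)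

lemma smooth_DERIV: "smooth f \<Longrightarrow> (f has_real_derivative deriv f x) (at x)"
  unfolding smooth_def DERIV_deriv_iff_field_differentiable by (metis funpow_0)

lemma smooth_continuous_on: "smooth f \<Longrightarrow> continuous_on A f"
  by (meson smooth_DERIV DERIV_isCont continuous_at_imp_continuous_on)

lemma smoothI_DERIV:
  assumes "\<And>x. (f has_real_derivative g x) (at x)" "smooth g"
  shows "smooth f"
  unfolding smooth_def
proof (intro allI)
  fix m x
  have "deriv f = g" using assms(1) by (auto intro: DERIV_imp_deriv)
  moreover have "f field_differentiable at x"
    using assms(1) field_differentiable_def by blast
  ultimately show "(deriv ^^ m) f field_differentiable at x"
    using assms(2) by (cases m) (auto simp: smooth_def funpow_Suc_right simp del: funpow.simps(2))
qed

lemma smooth_add: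
  assumes "smooth f" "smooth g"
  shows "smooth (\<lambda>x. f x + g x)"
proof (rule smooth_coinduct)
  let ?S = "{\<lambda>x. f x + g x |f g. smooth f \<and> smooth g}"
  show "(\<lambda>x. f x + g x) \<in> ?S" using assms by blast
  fix h assume "h \<in> ?S"
  then obtain f g where h: "h = (\<lambda>x. f x + g x)" "smooth f" "smooth g" by blast
  then have D: "(h has_real_derivative deriv f x + deriv g x) (at x)" for x
    by (auto intro!: DERIV_add smooth_DERIV)
  then have "deriv h = (\<lambda>x. deriv f x + deriv g x)" by (auto intro: DERIV_imp_deriv)
  with h show "deriv h \<in> ?S" using smooth_deriv by blast
  show "h field_differentiable at x" for x using D field_differentiable_def by blast
qed

lemma smooth_affine:
  assumes "smooth f"
  shows "smooth (\<lambda>x. c * f (a * x + b))"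
proof (rule smooth_coinduct)
  \<comment> \<open>Each differentiation contributes a factor \<open>a\<close>, so the leading
    coefficient has to vary within the family.\<close>
  let ?S = "{\<lambda>x. c * f (a * x + b) |c f. smooth f}"
  show "(\<lambda>x. c * f (a * x + b)) \<in> ?S" using assms by blast
  fix h assume "h \<in> ?S"
  then obtain c f where h: "h = (\<lambda>x. c * f (a * x + b))" "smooth f" by blast
  have D: "(h has_real_derivative (c * a) * deriv f (a * x + b)) (at x)" for x
  proof -
    have "((\<lambda>x. f (a * x + b)) has_real_derivative deriv f (a * x + b) * a) (at x)"
      by (rule DERIV_chain2[OF smooth_DERIV[OF h(2)]]) (auto intro!: derivative_eq_intros)
    from DERIV_cmult[OF this, of c] show ?thesis unfolding h(1) by (simp add: mult_ac)
  qed
  then have "deriv h = (\<lambda>x. (c * a) * deriv f (a * x + b))" by (auto intro: DERIV_imp_deriv)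
  with h show "deriv h \<in> ?S" using smooth_deriv by blast
  show "h field_differentiable at x" for x using D field_differentiable_def by blast
qed

lemma smooth_scale: "smooth f \<Longrightarrow> smooth (\<lambda>x. c * f x)"
  using smooth_affine[of f c 1 0] by simp

lemma smooth_diff: "smooth f \<Longrightarrow> smooth g \<Longrightarrow> smooth (\<lambda>x. f x - g x)"
  using smooth_add[OF _ smooth_scale, of f g "- 1"] by simp

text \<open>Products of smooth functions alone are not closed under differentiation by the product
  rule; their finite sums are.\<close>

inductive_set product_sums :: "(real \<Rightarrow> real) set" where
  "smooth f \<Longrightarrow> smooth g \<Longrightarrow> (\<lambda>x. f x * g x) \<in> product_sums"
| "f \<in> product_sums \<Longrightarrow> g \<in> product_sums \<Longrightarrow> (\<lambda>x. f x + g x) \<in> product_sums"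

lemma smooth_mult:
  assumes "smooth f" "smooth g"
  shows "smooth (\<lambda>x. f x * g x)"
proof (rule smooth_coinduct)
  show "(\<lambda>x. f x * g x) \<in> product_sums" using assms by (rule product_sums.intros)
  have "deriv h \<in> product_sums \<and> (\<forall>x. h field_differentiable at x)" if "h \<in> product_sums" for h
    using that
  proof induction
    case (1 f g)
    have D: "((\<lambda>x. f x * g x) has_real_derivative deriv f x * g x + f x * deriv g x) (at x)" for x
      using 1 by (auto intro!: derivative_eq_intros smooth_DERIV)
    then have "deriv (\<lambda>x. f x * g x) = (\<lambda>x. deriv f x * g x + f x * deriv g x)"
      by (auto intro: DERIV_imp_deriv)
    moreover have "(\<lambda>x. deriv f x * g x + f x * deriv g x) \<in> product_sums"
      using 1 by (intro product_sums.intros smooth_deriv)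
    ultimately show ?case using D field_differentiable_def by (metis (no_types, lifting))
  next
    case (2 f g)
    then have D: "((\<lambda>x. f x + g x) has_real_derivative deriv f x + deriv g x) (at x)" for x
      by (auto intro!: DERIV_add simp: DERIV_deriv_iff_field_differentiable)
    then have "deriv (\<lambda>x. f x + g x) = (\<lambda>x. deriv f x + deriv g x)"
      by (auto intro: DERIV_imp_deriv)
    moreover have "(\<lambda>x. deriv f x + deriv g x) \<in> product_sums"
      using 2 by (intro product_sums.intros) auto
    ultimately show ?case using D field_differentiable_def by (metis (no_types, lifting))
  qed
  then show "\<And>h. h \<in> product_sums \<Longrightarrow> deriv h \<in> product_sums"
    "\<And>h x. h \<in> product_sums \<Longrightarrow> h field_differentiable at x" by blast+
qed

lemma smooth_poly: "smooth (poly p)"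
proof (rule smooth_coinduct)
  show "poly p \<in> range poly" by simp
  fix h :: "real \<Rightarrow> real" assume "h \<in> range poly"
  then obtain q where h: "h = poly q" by blast
  then have D: "(h has_real_derivative poly (pderiv q) x) (at x)" for x
    by (simp add: poly_DERIV)
  then have "deriv h = poly (pderiv q)" by (auto intro: DERIV_imp_deriv)
  then show "deriv h \<in> range poly" by simp
  show "h field_differentiable at x" for x using D field_differentiable_def by blast
qed

text \<open>The polynomial factor makes this family closed under differentiation.\<close>

definition flat :: "real \<Rightarrow> real poly \<Rightarrow> real \<Rightarrow> real" where
  "flat c p x = (if 0 < x then poly p (1 / x) * exp (- c / x) else 0)"

text \<open>Monomial by monomial, the substitution of \<open>c * y\<close> reduces this to the decay
  of \<open>y ^ i / exp y\<close>.\<close>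

lemma poly_times_exp_tendsto_0:
  assumes "(0::real) < c"
  shows "((\<lambda>y. poly p y * exp (- c * y)) \<longlongrightarrow> 0) at_top"
proof -
  have "((\<lambda>y. y ^ i * exp (- c * y)) \<longlongrightarrow> 0) at_top" for i
  proof -
    have "filterlim (\<lambda>y. c * y) at_top at_top"
      using assms by (intro filterlim_tendsto_pos_mult_at_top[OF tendsto_const _ filterlim_ident])
    from filterlim_compose[OF tendsto_power_div_exp_0[of i] this]
    have "((\<lambda>y. (1 / c ^ i) * ((c * y) ^ i / exp (c * y))) \<longlongrightarrow> (1 / c ^ i) * 0) at_top"
      by (intro tendsto_mult tendsto_const)
    moreover have "(1 / c ^ i) * ((c * y) ^ i / exp (c * y)) = y ^ i * exp (- c * y)" for y
      using assms by (simp add: power_mult_distrib exp_minus field_simps)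
    ultimately show ?thesis by simp
  qed
  then have "((\<lambda>y. \<Sum>i\<le>degree p. coeff p i * (y ^ i * exp (- c * y))) \<longlongrightarrow>
      (\<Sum>i\<le>degree p. coeff p i * 0)) at_top"
    by (intro tendsto_sum tendsto_mult tendsto_const)
  then show ?thesis
    by (simp add: poly_altdef sum_distrib_right mult.assoc)
qed

lemma flat_tendsto_0:
  assumes "0 < c"
  shows "(flat c p \<longlongrightarrow> 0) (at_right 0)"
proof -
  have "((\<lambda>x. poly p (inverse x) * exp (- c * inverse x)) \<longlongrightarrow> 0) (at_right 0)"
    by (rule filterlim_compose[OF poly_times_exp_tendsto_0[OF assms] filterlim_inverse_at_top_right])
  then show ?thesis
    by (rule Lim_transform_eventually)
      (auto simp: eventually_at_right_field flat_def field_simps intro!: exI[of _ 1])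
qed

text \<open>Differentiating \<open>p (1 / x) * exp (- c / x)\<close> gives
  \<open>(c * p - p') (1 / x) / x\<^sup>2\<close> times the exponential, and the factor
  \<open>1 / x\<^sup>2\<close> is \<open>[:0, 0, 1:]\<close> evaluated at
  \<open>1 / x\<close>.\<close>

lemma DERIV_flat:
  assumes c: "0 < c"
  shows "(flat c p has_real_derivative flat c ([:0, 0, 1:] * (smult c p - pderiv p)) x) (at x)"
proof -
  let ?q = "[:0, 0, 1:] * (smult c p - pderiv p)"
  consider "x < 0" | "x = 0" | "0 < x" by linarith
  then show ?thesis
  proof cases
    case 1
    have "((\<lambda>_. 0) has_real_derivative 0) (at x)" by simp
    then have "(flat c p has_real_derivative 0) (at x)"
      by (rule has_field_derivative_transform_within_open[of _ _ _ "{..<0}"])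
        (use 1 in \<open>auto simp: flat_def\<close>)
    with 1 show ?thesis by (simp add: flat_def)
  next
    case 2
    have "((\<lambda>h. (flat c p (0 + h) - flat c p 0) / h) \<longlongrightarrow> 0) (at 0)"
    proof (rule filterlim_split_at)
      show "((\<lambda>h. (flat c p (0 + h) - flat c p 0) / h) \<longlongrightarrow> 0) (at_left 0)"
        by (rule Lim_transform_eventually[OF tendsto_const])
          (auto simp: eventually_at_left_field flat_def intro!: exI[of _ "- 1"])
      \<comment> \<open>To the right of 0, dividing by \<open>h\<close> multiplies the polynomial in
        \<open>1 / h\<close> by its variable, so the difference quotient is again a member of the
        family, for \<open>pCons 0 p\<close>.\<close>
      show "((\<lambda>h. (flat c p (0 + h) - flat c p 0) / h) \<longlongrightarrow> 0) (at_right 0)"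
        by (rule Lim_transform_eventually[OF flat_tendsto_0[OF c, of "pCons 0 p"]])
          (auto simp: eventually_at_right_field flat_def field_simps intro!: exI[of _ 1])
    qed
    with 2 show ?thesis by (simp add: DERIV_def flat_def)
  next
    case 3
    have "((\<lambda>x. poly p (1 / x) * exp (- c / x)) has_real_derivative
        poly ?q (1 / x) * exp (- c / x)) (at x)"
      using 3 by (auto intro!: derivative_eq_intros DERIV_chain2[OF poly_DERIV]
          simp: field_simps power2_eq_square)
    then have "(flat c p has_real_derivative poly ?q (1 / x) * exp (- c / x)) (at x)"
      by (rule has_field_derivative_transform_within_open[of _ _ _ "{0<..}"])
        (use 3 in \<open>auto simp: flat_def\<close>)
    with 3 show ?thesis by (simp add: flat_def)
  qed
qed

lemma smooth_flat:
  assumes "0 < c"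
  shows "smooth (flat c p)"
proof (rule smooth_coinduct)
  show "flat c p \<in> range (flat c)" by simp
  fix h assume "h \<in> range (flat c)"
  then obtain q where h: "h = flat c q" by blast
  show "deriv h \<in> range (flat c)"
    using DERIV_imp_deriv[OF DERIV_flat[OF assms]] unfolding h by (metis (no_types) ext rangeI)
  show "h field_differentiable at x" for x
    using DERIV_flat[OF assms] field_differentiable_def unfolding h by blast
qed

text \<open>The parameter \<open>c\<close> serves two purposes: \<open>c = 1 / 2\<close> on the
  interval from -1 to 1 gives \<open>bump\<close>, and as \<open>c\<close> tends to 0 the function
  tends to the indicator of the open interval.\<close>

definition cutoff :: "real \<Rightarrow> real \<Rightarrow> real \<Rightarrow> real \<Rightarrow> real" where
  "cutoff c a b x = flat c 1 (x - a) * flat c 1 (b - x)"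

lemma cutoff_eq:
  "cutoff c a b x = (if a < x \<and> x < b then exp (- c / (x - a)) * exp (- c / (b - x)) else 0)"
  by (simp add: cutoff_def flat_def)

lemma smooth_cutoff:
  assumes "0 < c"
  shows "smooth (cutoff c a b)"
proof -
  have "smooth (\<lambda>x. flat c 1 (x - a))" "smooth (\<lambda>x. flat c 1 (b - x))"
    using smooth_affine[OF smooth_flat[OF assms], of 1 1 1 "- a"]
      smooth_affine[OF smooth_flat[OF assms], of 1 1 "- 1" b] by simp_all
  then show ?thesis
    unfolding cutoff_def[abs_def] by (rule smooth_mult)
qed

lemma cutoff_bounds: "0 < c \<Longrightarrow> 0 \<le> cutoff c a b x \<and> cutoff c a b x \<le> 1"
  by (auto simp: cutoff_eq intro!: mult_le_one)

section \<open>Density of the polynomials in the square integrable functions\<close>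

lemma I_rho_sets [simp]: "I_rho \<rho> \<in> sets lebesgue"
  by (simp add: I_rho_def)

lemma finite_measure_I_rho: "finite_measure (lebesgue_on (I_rho \<rho>))"
  by (intro finite_measure_lebesgue_on) (simp add: I_rho_def)

section \<open>Inner products of square integrable functions\<close>

lemma L2_fun_continuous:
  assumes "continuous_on (I_rho \<rho>) f"
  shows "f \<in> L2_fun \<rho>"
proof -
  have "continuous_on (I_rho \<rho>) (\<lambda>x. (f x)\<^sup>2)" using assms by (intro continuous_intros)
  then show ?thesis
    using assms continuous_imp_measurable_on_sets_lebesgue[of "I_rho \<rho>" f]
    by (auto simp: L2_fun_def I_rho_def intro: continuous_imp_integrable_real)
qed

lemma L2_integrable_mult:
  assumes "u \<in> L2_fun \<rho>" "v \<in> L2_fun \<rho>"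
  shows "integrable (lebesgue_on (I_rho \<rho>)) (\<lambda>x. u x * v x)"
proof (rule Bochner_Integration.integrable_bound)
  show "integrable (lebesgue_on (I_rho \<rho>)) (\<lambda>x. (u x)\<^sup>2 + (v x)\<^sup>2)"
    using assms by (auto simp: L2_fun_def)
  show "(\<lambda>x. u x * v x) \<in> borel_measurable (lebesgue_on (I_rho \<rho>))"
    using assms by (auto simp: L2_fun_def)
  have "\<bar>a * b\<bar> \<le> a\<^sup>2 + b\<^sup>2" for a b :: real
  proof -
    have "2 * (\<bar>a\<bar> * \<bar>b\<bar>) \<le> a\<^sup>2 + b\<^sup>2"
      using sum_squares_bound[of "\<bar>a\<bar>" "\<bar>b\<bar>"] by simp
    moreover have "0 \<le> \<bar>a\<bar> * \<bar>b\<bar>" by simp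
    ultimately show ?thesis unfolding abs_mult by linarith
  qed
  then show "AE x in lebesgue_on (I_rho \<rho>). norm (u x * v x) \<le> norm ((u x)\<^sup>2 + (v x)\<^sup>2)"
    by (intro AE_I2) (simp add: abs_of_nonneg)
qed

lemma L2_fun_scale:
  assumes "u \<in> L2_fun \<rho>"
  shows "(\<lambda>x. c * u x) \<in> L2_fun \<rho>"
  using assms by (auto simp: L2_fun_def power_mult_distrib)

lemma L2_fun_add:
  assumes "u \<in> L2_fun \<rho>" "v \<in> L2_fun \<rho>"
  shows "(\<lambda>x. u x + v x) \<in> L2_fun \<rho>"
proof -
  have "integrable (lebesgue_on (I_rho \<rho>)) (\<lambda>x. (u x)\<^sup>2 + (v x)\<^sup>2 + 2 * (u x * v x))"
    using assms L2_integrable_mult[OF assms]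
    by (intro Bochner_Integration.integrable_add integrable_mult_right) (auto simp: L2_fun_def)
  then have "integrable (lebesgue_on (I_rho \<rho>)) (\<lambda>x. (u x + v x)\<^sup>2)"
    by (simp add: power2_sum mult.assoc)
  with assms show ?thesis by (auto simp: L2_fun_def)
qed

lemma L2_fun_diff:
  assumes "u \<in> L2_fun \<rho>" "v \<in> L2_fun \<rho>"
  shows "(\<lambda>x. u x - v x) \<in> L2_fun \<rho>"
  using L2_fun_add[OF assms(1) L2_fun_scale[OF assms(2), of "- 1"]] by simp

lemma L2_fun_sum:
  assumes "\<And>i. i \<in> A \<Longrightarrow> u i \<in> L2_fun \<rho>"
  shows "(\<lambda>x. \<Sum>i\<in>A. u i x) \<in> L2_fun \<rho>"
  using assms
  by (induction A rule: infinite_finite_induct)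
    (auto intro: L2_fun_add L2_fun_continuous)

lemma L2_ip_commute: "L2_ip \<rho> u v = L2_ip \<rho> v u"
  by (simp add: L2_ip_def mult.commute)

lemma L2_ip_scale_left: "L2_ip \<rho> (\<lambda>x. c * u x) v = c * L2_ip \<rho> u v"
  by (simp add: L2_ip_def mult.assoc)

lemma L2_ip_add_left:
  assumes "u \<in> L2_fun \<rho>" "v \<in> L2_fun \<rho>" "w \<in> L2_fun \<rho>"
  shows "L2_ip \<rho> (\<lambda>x. u x + v x) w = L2_ip \<rho> u w + L2_ip \<rho> v w"
  using L2_integrable_mult[OF assms(1,3)] L2_integrable_mult[OF assms(2,3)]
  by (simp add: L2_ip_def distrib_right)

lemma L2_ip_diff_left:
  assumes "u \<in> L2_fun \<rho>" "v \<in> L2_fun \<rho>" "w \<in> L2_fun \<rho>"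
  shows "L2_ip \<rho> (\<lambda>x. u x - v x) w = L2_ip \<rho> u w - L2_ip \<rho> v w"
  using L2_integrable_mult[OF assms(1,3)] L2_integrable_mult[OF assms(2,3)]
  by (simp add: L2_ip_def left_diff_distrib)

lemma L2_ip_sum_left:
  assumes "\<And>i. i \<in> A \<Longrightarrow> u i \<in> L2_fun \<rho>" "w \<in> L2_fun \<rho>"
  shows "L2_ip \<rho> (\<lambda>x. \<Sum>i\<in>A. u i x) w = (\<Sum>i\<in>A. L2_ip \<rho> (u i) w)"
  using assms(1)
proof (induction A rule: infinite_finite_induct)
  case (insert i A)
  then show ?case
    using L2_ip_add_left[of "u i" \<rho> "\<lambda>x. \<Sum>i\<in>A. u i x" w] L2_fun_sum[of A u \<rho>] assms(2) by simp
qed (simp_all add: L2_ip_def)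

lemma L2_ip_nonneg: "0 \<le> L2_ip \<rho> u u"
  by (simp add: L2_ip_def)

text \<open>On a combination \<open>U\<close> of the given vectors, the first form takes the value
  \<open>L2_ip \<rho> g g * L2_ip \<rho> U U - (L2_ip \<rho> U g)\<^sup>2\<close>. It thus states
  the Cauchy-Schwarz inequality as a kernel: the functional represented by \<open>g\<close> is
  bounded. The second claim is proved before it because it supplies that inequality.\<close>

lemma psd_L2_linear_form:
  assumes "g \<in> L2_fun \<rho>"
  shows "psd (L2_fun \<rho>) (\<lambda>u v. L2_ip \<rho> g g * L2_ip \<rho> u v - L2_ip \<rho> u g * L2_ip \<rho> v g)"
    and "psd (L2_fun \<rho>) (L2_ip \<rho>)"
proof -
  have eq: "(\<Sum>a<N. \<Sum>b<N. c a * c b * L2_ip \<rho> (u a) (u b)) =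
      L2_ip \<rho> (\<lambda>x. \<Sum>a<N. c a * u a x) (\<lambda>x. \<Sum>a<N. c a * u a x)"
    if "\<forall>a<N. u a \<in> L2_fun \<rho>" for N :: nat and u c
  proof -
    let ?U = "\<lambda>x. \<Sum>a<N. c a * u a x"
    have mem: "(\<lambda>x. c a * u a x) \<in> L2_fun \<rho>" if "a < N" for a
      using \<open>\<forall>a<N. u a \<in> L2_fun \<rho>\<close> that by (intro L2_fun_scale) auto
    have U: "?U \<in> L2_fun \<rho>" by (intro L2_fun_sum mem) simp
    have "L2_ip \<rho> ?U w = (\<Sum>a<N. c a * L2_ip \<rho> (u a) w)" if "w \<in> L2_fun \<rho>" for w
      using L2_ip_sum_left[of "{..<N}" "\<lambda>a x. c a * u a x" \<rho> w] mem that
      by (simp add: L2_ip_scale_left)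
    note lin = this
    have "L2_ip \<rho> ?U ?U = (\<Sum>a<N. c a * L2_ip \<rho> ?U (u a))"
      using lin[OF U] by (simp add: L2_ip_commute)
    also have "\<dots> = (\<Sum>a<N. c a * (\<Sum>b<N. c b * L2_ip \<rho> (u b) (u a)))"
      using lin that by simp
    also have "\<dots> = (\<Sum>a<N. \<Sum>b<N. c a * c b * L2_ip \<rho> (u a) (u b))"
      by (simp add: sum_distrib_left mult.assoc L2_ip_commute)
    finally show ?thesis by simp
  qed
  show psd: "psd (L2_fun \<rho>) (L2_ip \<rho>)"
    unfolding psd_def using eq L2_ip_nonneg L2_ip_commute by simp
  have "0 \<le> (\<Sum>a<N. \<Sum>b<N. c a * c b * (L2_ip \<rho> g g * L2_ip \<rho> (u a) (u b)
      - L2_ip \<rho> (u a) g * L2_ip \<rho> (u b) g))"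
    if u: "\<forall>a<N. u a \<in> L2_fun \<rho>" for N :: nat and u c
  proof -
    let ?U = "\<lambda>x. \<Sum>a<N. c a * u a x"
    have mem: "(\<lambda>x. c a * u a x) \<in> L2_fun \<rho>" if "a < N" for a
      using u that by (intro L2_fun_scale) auto
    have U: "?U \<in> L2_fun \<rho>" by (intro L2_fun_sum mem) simp
    have Ug: "L2_ip \<rho> ?U g = (\<Sum>a<N. c a * L2_ip \<rho> (u a) g)"
      using L2_ip_sum_left[of "{..<N}" "\<lambda>a x. c a * u a x" \<rho> g] mem assms
      by (simp add: L2_ip_scale_left)
    have "\<bar>L2_ip \<rho> ?U g\<bar> ^ 2 \<le> (sqrt (L2_ip \<rho> ?U ?U) * sqrt (L2_ip \<rho> g g)) ^ 2"
      by (intro power_mono psd_Cauchy_Schwarz[OF psd U assms]) simp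
    then have "(L2_ip \<rho> ?U g)\<^sup>2 \<le> L2_ip \<rho> ?U ?U * L2_ip \<rho> g g"
      by (simp add: power_mult_distrib L2_ip_nonneg)
    moreover have "(L2_ip \<rho> ?U g)\<^sup>2 =
        (\<Sum>a<N. \<Sum>b<N. c a * c b * (L2_ip \<rho> (u a) g * L2_ip \<rho> (u b) g))"
      unfolding Ug power2_eq_square sum_product by (simp add: mult_ac)
    moreover have "L2_ip \<rho> ?U ?U * L2_ip \<rho> g g =
        (\<Sum>a<N. \<Sum>b<N. c a * c b * (L2_ip \<rho> g g * L2_ip \<rho> (u a) (u b)))"
      unfolding eq[OF u, symmetric] by (simp add: sum_distrib_left mult_ac)
    ultimately show ?thesis
      by (simp add: right_diff_distrib sum_subtractf)
  qed
  then show "psd (L2_fun \<rho>) (\<lambda>u v. L2_ip \<rho> g g * L2_ip \<rho> u v - L2_ip \<rho> u g * L2_ip \<rho> v g)"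
    unfolding psd_def by (auto simp: L2_ip_commute)
qed

lemma psd_L2: "psd (L2_fun \<rho>) (L2_ip \<rho>)"
  using psd_L2_linear_form(2)[of "\<lambda>_. 0"] by (simp add: L2_fun_continuous)

lemma L2_Cauchy_Schwarz:
  assumes "u \<in> L2_fun \<rho>" "v \<in> L2_fun \<rho>"
  shows "\<bar>L2_ip \<rho> u v\<bar> \<le> sqrt (L2_ip \<rho> u u) * sqrt (L2_ip \<rho> v v)"
  using psd_Cauchy_Schwarz[OF psd_L2 assms] .

lemma L2_ip_tendsto:
  assumes "\<And>m. f m \<in> L2_fun \<rho>" "u \<in> L2_fun \<rho>" "g \<in> L2_fun \<rho>"
    and lim: "(\<lambda>m. sqrt (L2_ip \<rho> (\<lambda>x. f m x - u x) (\<lambda>x. f m x - u x))) \<longlonglongrightarrow> 0"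
  shows "(\<lambda>m. L2_ip \<rho> (f m) g) \<longlonglongrightarrow> L2_ip \<rho> u g"
proof (rule LIM_zero_cancel, rule tendsto_rabs_zero_cancel, rule tendsto_sandwich[OF _ _ tendsto_const])
  let ?d = "\<lambda>m. sqrt (L2_ip \<rho> (\<lambda>x. f m x - u x) (\<lambda>x. f m x - u x))"
  show "\<forall>\<^sub>F m in sequentially. \<bar>L2_ip \<rho> (f m) g - L2_ip \<rho> u g\<bar> \<le> ?d m * sqrt (L2_ip \<rho> g g)"
    using assms L2_Cauchy_Schwarz[OF L2_fun_diff, of _ \<rho> u g]
    by (intro always_eventually allI) (simp add: L2_ip_diff_left)
  show "(\<lambda>m. ?d m * sqrt (L2_ip \<rho> g g)) \<longlonglongrightarrow> 0"
    using tendsto_mult[OF lim tendsto_const] by simp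
qed simp

text \<open>Working with squared distances, at the price of a factor 2, avoids square roots when
  several approximation errors are added.\<close>

lemma L2_dist_triangle:
  assumes "u \<in> L2_fun \<rho>" "v \<in> L2_fun \<rho>" "w \<in> L2_fun \<rho>"
  shows "L2_ip \<rho> (\<lambda>x. u x - w x) (\<lambda>x. u x - w x) \<le>
    2 * L2_ip \<rho> (\<lambda>x. u x - v x) (\<lambda>x. u x - v x) + 2 * L2_ip \<rho> (\<lambda>x. v x - w x) (\<lambda>x. v x - w x)"
proof -
  have int: "integrable (lebesgue_on (I_rho \<rho>)) (\<lambda>x. (f x - g x) * (f x - g x))"
    if "f \<in> L2_fun \<rho>" "g \<in> L2_fun \<rho>" for f g
    using that by (intro L2_integrable_mult L2_fun_diff)
  have "L2_ip \<rho> (\<lambda>x. u x - w x) (\<lambda>x. u x - w x) \<le>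
    (LINT x|lebesgue_on (I_rho \<rho>). 2 * ((u x - v x) * (u x - v x)) + 2 * ((v x - w x) * (v x - w x)))"
    unfolding L2_ip_def
  proof (rule integral_mono)
    fix x
    have "0 \<le> ((u x - v x) - (v x - w x))\<^sup>2" by simp
    then show "(u x - w x) * (u x - w x) \<le>
        2 * ((u x - v x) * (u x - v x)) + 2 * ((v x - w x) * (v x - w x))"
      by (simp add: power2_eq_square algebra_simps)
  qed (use assms int in auto)
  also have "\<dots> = 2 * L2_ip \<rho> (\<lambda>x. u x - v x) (\<lambda>x. u x - v x)
      + 2 * L2_ip \<rho> (\<lambda>x. v x - w x) (\<lambda>x. v x - w x)"
    using assms int by (simp add: L2_ip_def)
  finally show ?thesis .
qed

section \<open>Approximation by bounded, continuous and polynomial functions\<close>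

lemma L2_ip_self_tendsto_0:
  assumes "\<And>m. f m \<in> borel_measurable (lebesgue_on (I_rho \<rho>))"
    and "AE x in lebesgue_on (I_rho \<rho>). (\<lambda>m. f m x) \<longlonglongrightarrow> 0"
    and "\<And>m x. x \<in> I_rho \<rho> \<Longrightarrow> \<bar>f m x\<bar> \<le> w x" "w \<in> L2_fun \<rho>"
  shows "(\<lambda>m. L2_ip \<rho> (f m) (f m)) \<longlonglongrightarrow> 0"
proof -
  have "(\<lambda>m. L2_ip \<rho> (f m) (f m)) \<longlonglongrightarrow> (LINT x|lebesgue_on (I_rho \<rho>). 0)"
    unfolding L2_ip_def
  proof (rule integral_dominated_convergence)
    show "AE x in lebesgue_on (I_rho \<rho>). (\<lambda>m. f m x * f m x) \<longlonglongrightarrow> 0"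
      using assms(2)
    proof eventually_elim
      case (elim x)
      from tendsto_mult[OF elim elim] show ?case by simp
    qed
    show "integrable (lebesgue_on (I_rho \<rho>)) (\<lambda>x. (w x)\<^sup>2)"
      using assms(4) by (simp add: L2_fun_def)
    show "AE x in lebesgue_on (I_rho \<rho>). norm (f m x * f m x) \<le> (w x)\<^sup>2" for m
    proof (rule AE_I2)
      fix x assume "x \<in> space (lebesgue_on (I_rho \<rho>))"
      then have "\<bar>f m x\<bar> \<le> w x" using assms(3) by (simp add: space_restrict_space)
      then have "\<bar>f m x\<bar>\<^sup>2 \<le> (w x)\<^sup>2" by (intro power_mono) auto
      then show "norm (f m x * f m x) \<le> (w x)\<^sup>2" by (simp add: power2_eq_square)
    qed
  qed (use assms(1) in auto)
  then show ?thesis by simp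
qed

lemma L2_fun_bounded:
  assumes "u \<in> borel_measurable (lebesgue_on (I_rho \<rho>))" "\<And>x. x \<in> I_rho \<rho> \<Longrightarrow> \<bar>u x\<bar> \<le> B"
  shows "u \<in> L2_fun \<rho>"
proof -
  interpret finite_measure "lebesgue_on (I_rho \<rho>)" by (rule finite_measure_I_rho)
  have "integrable (lebesgue_on (I_rho \<rho>)) (\<lambda>x. (u x)\<^sup>2)"
  proof (rule integrable_const_bound[of _ "B\<^sup>2"])
    show "AE x in lebesgue_on (I_rho \<rho>). norm ((u x)\<^sup>2) \<le> B\<^sup>2"
    proof (rule AE_I2)
      fix x assume "x \<in> space (lebesgue_on (I_rho \<rho>))"
      then have "\<bar>u x\<bar>\<^sup>2 \<le> B\<^sup>2"
        using assms(2)[of x] by (intro power_mono) (auto simp: space_restrict_space)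
      then show "norm ((u x)\<^sup>2) \<le> B\<^sup>2" by simp
    qed
  qed (use assms in auto)
  with assms show ?thesis by (simp add: L2_fun_def)
qed

definition clamp_abs :: "real \<Rightarrow> real \<Rightarrow> real" where
  "clamp_abs B y = max (- B) (min B y)"

lemma clamp_abs_bounds:
  assumes "0 \<le> B"
  shows "\<bar>clamp_abs B y\<bar> \<le> B" "\<bar>clamp_abs B y - y\<bar> \<le> \<bar>y\<bar>"
    and "\<bar>y\<bar> \<le> B \<Longrightarrow> clamp_abs B y = y"
  using assms by (auto simp: clamp_abs_def)

lemma L2_dense_bounded:
  assumes u: "u \<in> L2_fun \<rho>" and e: "0 < e"
  shows "\<exists>B>0. \<exists>t \<in> borel_measurable (lebesgue_on (I_rho \<rho>)). (\<forall>x. \<bar>t x\<bar> \<le> B) \<and>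
    L2_ip \<rho> (\<lambda>x. t x - u x) (\<lambda>x. t x - u x) < e"
proof -
  \<comment> \<open>Truncation at level \<open>Suc m\<close>: at each point the error is eventually
    0, and it is dominated by \<open>\<bar>u x\<bar>\<close>.\<close>
  let ?t = "\<lambda>m x. clamp_abs (real (Suc m)) (u x)"
  have meas: "?t m \<in> borel_measurable (lebesgue_on (I_rho \<rho>))" for m
    using u unfolding clamp_abs_def
    by (intro borel_measurable_max borel_measurable_min borel_measurable_const) (simp add: L2_fun_def)
  have "(\<lambda>m. L2_ip \<rho> (\<lambda>x. ?t m x - u x) (\<lambda>x. ?t m x - u x)) \<longlonglongrightarrow> 0"
  proof (rule L2_ip_self_tendsto_0)
    show "(\<lambda>x. ?t m x - u x) \<in> borel_measurable (lebesgue_on (I_rho \<rho>))" for m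
      using u meas by (auto simp: L2_fun_def)
    show "(\<lambda>x. \<bar>u x\<bar>) \<in> L2_fun \<rho>" using u by (auto simp: L2_fun_def)
    show "AE x in lebesgue_on (I_rho \<rho>). (\<lambda>m. ?t m x - u x) \<longlonglongrightarrow> 0"
    proof (rule AE_I2, rule tendsto_eventually)
      fix x
      obtain N where "\<bar>u x\<bar> \<le> real N" using real_arch_simple by blast
      then have "?t m x - u x = 0" if "m \<ge> N" for m
        using that by (subst clamp_abs_bounds(3)) auto
      then show "\<forall>\<^sub>F m in sequentially. ?t m x - u x = 0"
        by (auto simp: eventually_sequentially)
    qed
  qed (auto intro: clamp_abs_bounds)
  from LIMSEQ_D[OF this e] obtain m where
    "norm (L2_ip \<rho> (\<lambda>x. ?t m x - u x) (\<lambda>x. ?t m x - u x) - 0) < e" by blast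
  then have "L2_ip \<rho> (\<lambda>x. ?t m x - u x) (\<lambda>x. ?t m x - u x) < e" by simp
  moreover have "\<forall>x. \<bar>?t m x\<bar> \<le> real (Suc m)" by (auto intro: clamp_abs_bounds)
  ultimately show ?thesis
    using meas[of m] by (intro exI[of _ "real (Suc m)"]) (auto intro!: bexI[of _ "?t m"])
qed

lemma L2_bounded_dense_continuous:
  assumes t: "t \<in> borel_measurable (lebesgue_on (I_rho \<rho>))" "\<And>x. \<bar>t x\<bar> \<le> B" and e: "0 < e"
  shows "\<exists>h. continuous_on UNIV h \<and> L2_ip \<rho> (\<lambda>x. h x - t x) (\<lambda>x. h x - t x) < e"
proof -
  have B: "0 \<le> B" using t(2)[of 0] by linarith
  have "t measurable_on (I_rho \<rho>)"
    using t(1) by (simp add: measurable_on_iff_borel_measurable)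
  then obtain N g where N: "negligible N" and g: "\<And>m. continuous_on UNIV (g m)"
    and lim: "\<And>x. x \<notin> N \<Longrightarrow> (\<lambda>m. g m x) \<longlonglongrightarrow> (if x \<in> I_rho \<rho> then t x else 0)"
    unfolding measurable_on_def by blast
  \<comment> \<open>Clamping leaves \<open>t\<close> unchanged and provides the dominating constant
    \<open>2 * B\<close>; the continuous functions \<open>g m\<close> themselves come without a
    common bound.\<close>
  let ?h = "\<lambda>m x. clamp_abs B (g m x)"
  have cont: "continuous_on A (?h m)" for m A
    unfolding clamp_abs_def by (intro continuous_intros continuous_on_subset[OF g]) simp
  have AE: "AE x in lebesgue_on (I_rho \<rho>). x \<notin> N"
  proof -
    have "AE x in lebesgue. x \<notin> N"
      using N by (intro AE_not_in) (simp add: negligible_iff_null_sets)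
    then show ?thesis
      by (subst AE_restrict_space_iff) auto
  qed
  have "(\<lambda>m. L2_ip \<rho> (\<lambda>x. ?h m x - t x) (\<lambda>x. ?h m x - t x)) \<longlonglongrightarrow> 0"
  proof (rule L2_ip_self_tendsto_0)
    show "(\<lambda>x. ?h m x - t x) \<in> borel_measurable (lebesgue_on (I_rho \<rho>))" for m
      using t(1) cont continuous_imp_measurable_on_sets_lebesgue[OF cont I_rho_sets]
      by (intro borel_measurable_diff) auto
    show "\<bar>?h m x - t x\<bar> \<le> 2 * B" for m x
      using t(2)[of x] clamp_abs_bounds(1)[OF B, of "g m x"] by linarith
    show "(\<lambda>x. 2 * B) \<in> L2_fun \<rho>" by (intro L2_fun_continuous) simp
    show "AE x in lebesgue_on (I_rho \<rho>). (\<lambda>m. ?h m x - t x) \<longlonglongrightarrow> 0"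
      using AE AE_space
    proof eventually_elim
      case (elim x)
      then have "(\<lambda>m. g m x) \<longlonglongrightarrow> t x" using lim[of x] by (simp add: space_restrict_space)
      then have "(\<lambda>m. ?h m x) \<longlonglongrightarrow> clamp_abs B (t x)"
        unfolding clamp_abs_def by (intro tendsto_intros)
      then show ?case
        using t(2)[of x] B by (simp add: clamp_abs_bounds LIM_zero_iff)
    qed
  qed
  from LIMSEQ_D[OF this e] obtain m where
    "norm (L2_ip \<rho> (\<lambda>x. ?h m x - t x) (\<lambda>x. ?h m x - t x) - 0) < e" by blast
  then show ?thesis using cont[of UNIV m] by auto
qed

lemma L2_continuous_dense_poly:
  assumes \<rho>: "0 < \<rho>" and h: "continuous_on (I_rho \<rho>) h" and e: "0 < e"
  shows "\<exists>p. L2_ip \<rho> (\<lambda>x. poly p x - h x) (\<lambda>x. poly p x - h x) < e"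
proof -
  \<comment> \<open>The interval has length \<open>1 + 2 * \<rho>\<close>, so a uniform error
    \<open>d\<close> costs at most \<open>(1 + 2 * \<rho>) * d\<^sup>2 = e / 2\<close>.\<close>
  define d where "d = sqrt (e / (2 + 4 * \<rho>))"
  have d: "d > 0" using e \<rho> by (simp add: d_def)
  have compact: "compact (I_rho \<rho>)" by (simp add: I_rho_def)
  from Stone_Weierstrass_real_polynomial_function[OF compact h d] obtain g where
    g: "real_polynomial_function g" "\<And>x. x \<in> I_rho \<rho> \<Longrightarrow> \<bar>h x - g x\<bar> < d" by blast
  from g(1) obtain a N where "g = (\<lambda>x. \<Sum>i\<le>N. a i * x ^ i)"
    by (auto simp: real_polynomial_function_iff_sum)
  then have gp: "g = poly (\<Sum>i\<le>N. monom (a i) i)"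
    by (auto simp: poly_sum poly_monom)
  let ?p = "\<Sum>i\<le>N. monom (a i) i"
  interpret finite_measure "lebesgue_on (I_rho \<rho>)" by (rule finite_measure_I_rho)
  have "L2_ip \<rho> (\<lambda>x. poly ?p x - h x) (\<lambda>x. poly ?p x - h x)
      \<le> (LINT x|lebesgue_on (I_rho \<rho>). d\<^sup>2)"
    unfolding L2_ip_def
  proof (rule integral_mono)
    show "integrable (lebesgue_on (I_rho \<rho>)) (\<lambda>x. (poly ?p x - h x) * (poly ?p x - h x))"
      by (intro L2_integrable_mult L2_fun_continuous continuous_intros h)
    fix x assume "x \<in> space (lebesgue_on (I_rho \<rho>))"
    then have "\<bar>poly ?p x - h x\<bar> \<le> d"
      using g(2)[of x] unfolding gp by (simp add: space_restrict_space abs_minus_commute)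
    then have "\<bar>poly ?p x - h x\<bar>\<^sup>2 \<le> d\<^sup>2" by (intro power_mono) auto
    then show "(poly ?p x - h x) * (poly ?p x - h x) \<le> d\<^sup>2" by (simp add: power2_eq_square)
  qed simp
  also have "\<dots> = (1 + 2 * \<rho>) * d\<^sup>2"
    using \<rho> by (simp add: measure_restrict_space I_rho_def)
  also have "\<dots> < e"
    using e \<rho> by (simp add: d_def field_simps add_pos_pos)
  finally show ?thesis by blast
qed

lemma L2_dense_poly:
  assumes \<rho>: "0 < \<rho>" and u: "u \<in> L2_fun \<rho>" and e: "0 < e"
  shows "\<exists>p. L2_ip \<rho> (\<lambda>x. poly p x - u x) (\<lambda>x. poly p x - u x) < e"
proof -
  \<comment> \<open>Two applications of the doubled triangle inequality weight the three errors with
    2, 4 and 4, which add up to 10.\<close>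
  have e': "e / 10 > 0" using e by simp
  obtain t B where t: "t \<in> borel_measurable (lebesgue_on (I_rho \<rho>))" "\<And>x. \<bar>t x\<bar> \<le> B"
    "L2_ip \<rho> (\<lambda>x. t x - u x) (\<lambda>x. t x - u x) < e / 10"
    using L2_dense_bounded[OF u e'] by blast
  obtain h where h: "continuous_on UNIV h" "L2_ip \<rho> (\<lambda>x. h x - t x) (\<lambda>x. h x - t x) < e / 10"
    using L2_bounded_dense_continuous[OF t(1,2) e'] by blast
  have h': "continuous_on (I_rho \<rho>) h" using h(1) continuous_on_subset by blast
  obtain p where p: "L2_ip \<rho> (\<lambda>x. poly p x - h x) (\<lambda>x. poly p x - h x) < e / 10"
    using L2_continuous_dense_poly[OF \<rho> h' e'] by blast
  have mem: "poly p \<in> L2_fun \<rho>" "h \<in> L2_fun \<rho>" "t \<in> L2_fun \<rho>"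
    using h' by (auto intro!: L2_fun_continuous L2_fun_bounded[OF t(1,2)] continuous_intros)
  show ?thesis
    using L2_dist_triangle[OF mem(1,2) u] L2_dist_triangle[OF mem(2,3) u] p h(2) t(3) e by (intro exI[of _ p]) linarith
qed

lemma L2_dense_poly_seq:
  assumes \<rho>: "0 < \<rho>" and u: "u \<in> L2_fun \<rho>"
  shows "\<exists>p. (\<lambda>m. sqrt (L2_ip \<rho> (\<lambda>x. poly (p m) x - u x) (\<lambda>x. poly (p m) x - u x))) \<longlonglongrightarrow> 0"
proof -
  have "\<forall>m. \<exists>p. L2_ip \<rho> (\<lambda>x. poly p x - u x) (\<lambda>x. poly p x - u x) < 1 / real (Suc m)"
    using L2_dense_poly[OF \<rho> u] by simp
  then obtain p where
    p: "\<And>m. L2_ip \<rho> (\<lambda>x. poly (p m) x - u x) (\<lambda>x. poly (p m) x - u x) < 1 / real (Suc m)"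
    by metis
  have "(\<lambda>m. L2_ip \<rho> (\<lambda>x. poly (p m) x - u x) (\<lambda>x. poly (p m) x - u x)) \<longlonglongrightarrow> 0"
    by (rule tendsto_sandwich[OF _ _ tendsto_const LIMSEQ_Suc[OF lim_1_over_n]])
      (use p in \<open>auto intro!: always_eventually simp: L2_ip_nonneg less_imp_le\<close>)
  from tendsto_real_sqrt[OF this] show ?thesis by auto
qed

section \<open>Weak derivatives\<close>

text \<open>Only \<open>g\<close> vanishes at the ends, and derivatives are taken within the closed
  interval. Thus \<open>f\<close> may be a polynomial, a smooth 0-form or the antiderivative of a
  1-form, with a test function or a kernel of a degree of freedom as \<open>g\<close>.\<close>

lemma L2_ip_by_parts:
  assumes \<rho>: "0 < \<rho>"
    and f: "\<And>x. x \<in> I_rho \<rho> \<Longrightarrow> (f has_real_derivative f' x) (at x within I_rho \<rho>)"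
    and g: "\<And>x. x \<in> I_rho \<rho> \<Longrightarrow> (g has_real_derivative g' x) (at x within I_rho \<rho>)"
    and cont: "continuous_on (I_rho \<rho>) f'" "continuous_on (I_rho \<rho>) g'"
    and ends: "g (- \<rho>) = 0" "g (1 + \<rho>) = 0"
  shows "L2_ip \<rho> f g' = - L2_ip \<rho> f' g"
proof -
  have fg: "continuous_on (I_rho \<rho>) f" "continuous_on (I_rho \<rho>) g"
    using f g by (auto intro: DERIV_continuous_on)
  have "((\<lambda>x. f x * g' x + f' x * g x) has_integral f (1 + \<rho>) * g (1 + \<rho>) - f (- \<rho>) * g (- \<rho>))
      (I_rho \<rho>)"
    unfolding I_rho_def
  proof (rule fundamental_theorem_of_calculus)
    fix x assume "x \<in> {- \<rho>..1 + \<rho>}"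
    then have x: "x \<in> I_rho \<rho>" by (simp add: I_rho_def)
    have "((\<lambda>x. f x * g x) has_real_derivative f x * g' x + f' x * g x) (at x within I_rho \<rho>)"
      by (rule derivative_eq_intros f[OF x] g[OF x] refl)+ simp
    then show "((\<lambda>x. f x * g x) has_vector_derivative f x * g' x + f' x * g x)
        (at x within {- \<rho>..1 + \<rho>})"
      by (simp add: has_real_derivative_iff_has_vector_derivative I_rho_def)
  qed (use \<rho> in simp)
  then have "integral (I_rho \<rho>) (\<lambda>x. f x * g' x + f' x * g x) = 0"
    using ends by (simp add: integral_unique)
  moreover have int: "integrable (lebesgue_on (I_rho \<rho>)) (\<lambda>x. f x * g' x)"
    "integrable (lebesgue_on (I_rho \<rho>)) (\<lambda>x. f' x * g x)"
    by (intro L2_integrable_mult L2_fun_continuous fg cont)+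
  ultimately have "(LINT x|lebesgue_on (I_rho \<rho>). f x * g' x + f' x * g x) = 0"
    by (subst lebesgue_integral_eq_integral) auto
  then show ?thesis using int by (simp add: L2_ip_def)
qed

lemma test_fun_smooth: "test_fun \<rho> \<phi> \<Longrightarrow> smooth \<phi>"
  by (simp add: test_fun_def smooth_def)

lemma test_fun_ends:
  assumes "test_fun \<rho> \<phi>"
  shows "\<phi> (- \<rho>) = 0" "\<phi> (1 + \<rho>) = 0"
proof -
  obtain K where K: "K \<subseteq> interior (I_rho \<rho>)" "\<And>x. x \<notin> K \<Longrightarrow> \<phi> x = 0"
    using assms unfolding test_fun_def by blast
  have "- \<rho> \<notin> K" "1 + \<rho> \<notin> K"
    using K(1) by (auto simp: I_rho_def)
  then show "\<phi> (- \<rho>) = 0" "\<phi> (1 + \<rho>) = 0" using K(2) by auto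
qed

lemma is_weak_deriv_poly:
  assumes "0 < \<rho>"
  shows "is_weak_deriv \<rho> (poly p) (poly (pderiv p))"
  unfolding is_weak_deriv_def
proof (intro conjI allI impI)
  show "poly (pderiv p) \<in> L2_fun \<rho>" by (intro L2_fun_continuous continuous_intros)
  fix \<phi> assume \<phi>: "test_fun \<rho> \<phi>"
  note s = test_fun_smooth[OF \<phi>]
  show "L2_ip \<rho> (poly p) (deriv \<phi>) = - L2_ip \<rho> (poly (pderiv p)) \<phi>"
    by (intro L2_ip_by_parts assms has_field_derivative_at_within[OF poly_DERIV]
        has_field_derivative_at_within[OF smooth_DERIV[OF s]] test_fun_ends[OF \<phi>]
        smooth_continuous_on[OF smooth_deriv[OF s]] continuous_intros)
qed

lemma L2_ip_dominated:
  assumes u: "u \<in> L2_fun \<rho>" and \<phi>: "\<And>m. continuous_on (I_rho \<rho>) (\<phi> m)" "continuous_on (I_rho \<rho>) \<psi>"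
    and lim: "AE x in lebesgue_on (I_rho \<rho>). (\<lambda>m. \<phi> m x) \<longlonglongrightarrow> \<psi> x"
    and B: "\<And>m x. x \<in> I_rho \<rho> \<Longrightarrow> \<bar>\<phi> m x\<bar> \<le> B"
  shows "(\<lambda>m. L2_ip \<rho> u (\<phi> m)) \<longlonglongrightarrow> L2_ip \<rho> u \<psi>"
  unfolding L2_ip_def
proof (rule integral_dominated_convergence)
  have "integrable (lebesgue_on (I_rho \<rho>)) (\<lambda>x. u x * B)"
    by (intro L2_integrable_mult u L2_fun_continuous continuous_intros)
  then show "integrable (lebesgue_on (I_rho \<rho>)) (\<lambda>x. norm (u x * B))" by (rule integrable_norm)
  show "(\<lambda>x. u x * \<phi> m x) \<in> borel_measurable (lebesgue_on (I_rho \<rho>))" for m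
    by (intro borel_measurable_integrable L2_integrable_mult u L2_fun_continuous \<phi>)
  show "(\<lambda>x. u x * \<psi> x) \<in> borel_measurable (lebesgue_on (I_rho \<rho>))"
    by (intro borel_measurable_integrable L2_integrable_mult u L2_fun_continuous \<phi>)
  show "AE x in lebesgue_on (I_rho \<rho>). (\<lambda>m. u x * \<phi> m x) \<longlonglongrightarrow> u x * \<psi> x"
    using lim by eventually_elim (intro tendsto_intros)
  show "AE x in lebesgue_on (I_rho \<rho>). norm (u x * \<phi> m x) \<le> norm (u x * B)" for m
  proof (rule AE_I2)
    fix x assume "x \<in> space (lebesgue_on (I_rho \<rho>))"
    then have "\<bar>\<phi> m x\<bar> \<le> \<bar>B\<bar>" using B[of x m] by (simp add: space_restrict_space)
    then show "norm (u x * \<phi> m x) \<le> norm (u x * B)" by (simp add: abs_mult mult_left_mono)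
  qed
qed

lemma interior_I_rho: "interior (I_rho \<rho>) = {- \<rho><..<1 + \<rho>}"
  by (simp add: I_rho_def)

lemma AE_interior_I_rho: "AE x in lebesgue_on (I_rho \<rho>). x \<in> interior (I_rho \<rho>)"
proof -
  have "AE x in lebesgue. x \<notin> {- \<rho>, 1 + \<rho>}"
    by (intro AE_not_in) (auto simp flip: negligible_iff_null_sets)
  then have "AE x in lebesgue. x \<in> I_rho \<rho> \<longrightarrow> x \<in> interior (I_rho \<rho>)"
    by eventually_elim (auto simp: I_rho_def)
  then show ?thesis
    by (subst AE_restrict_space_iff) auto
qed

lemma test_fun_poly_cutoff:
  assumes "- \<rho> < a" "b < 1 + \<rho>" "0 < c"
  shows "test_fun \<rho> (\<lambda>x. poly p x * cutoff c a b x)"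
  unfolding test_fun_def
proof (intro conjI)
  have "smooth (\<lambda>x. poly p x * cutoff c a b x)"
    by (intro smooth_mult smooth_poly smooth_cutoff assms)
  then show "\<forall>m x. (deriv ^^ m) (\<lambda>x. poly p x * cutoff c a b x) field_differentiable at x"
    by (simp add: smooth_def)
  \<comment> \<open>The interval \<open>{a..b}\<close> may be empty, as it can be for the first
    members of the sequence of cutoffs used below; the function is then 0.\<close>
  show "\<exists>K. compact K \<and> K \<subseteq> interior (I_rho \<rho>) \<and> (\<forall>x. x \<notin> K \<longrightarrow> poly p x * cutoff c a b x = 0)"
    using assms by (intro exI[of _ "{a..b}"]) (auto simp: interior_I_rho cutoff_eq)
qed

text \<open>
  The products of a polynomial with the cutoffs approximate the polynomial, and the polynomials are
  dense.
\<close>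

lemma orthogonal_test_fun_imp_null:
  assumes \<rho>: "0 < \<rho>" and h: "h \<in> L2_fun \<rho>"
    and orth: "\<And>\<phi>. test_fun \<rho> \<phi> \<Longrightarrow> L2_ip \<rho> h \<phi> = 0"
  shows "L2_ip \<rho> h h = 0"
proof -
  have poly0: "L2_ip \<rho> h (poly p) = 0" for p
  proof -
    let ?e = "\<lambda>m. 1 / real (Suc m)"
    \<comment> \<open>Exponent and margin both tend to 0: the support exhausts the open interval,
      while the cutoff tends to 1 at every interior point.\<close>
    let ?\<phi> = "\<lambda>m x. poly p x * cutoff (?e m) (- \<rho> + ?e m) (1 + \<rho> - ?e m) x"
    have e0: "?e \<longlonglongrightarrow> 0" using LIMSEQ_Suc[OF lim_1_over_n] by simp
    have test: "test_fun \<rho> (?\<phi> m)" for m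
      by (rule test_fun_poly_cutoff) auto
    have "compact (poly p ` I_rho \<rho>)"
      by (intro compact_continuous_image continuous_intros) (simp add: I_rho_def)
    from compact_imp_bounded[OF this] obtain B where "\<forall>y\<in>poly p ` I_rho \<rho>. norm y \<le> B"
      unfolding bounded_iff by blast
    then have B: "\<And>x. x \<in> I_rho \<rho> \<Longrightarrow> \<bar>poly p x\<bar> \<le> B" by simp
    have "(\<lambda>m. L2_ip \<rho> h (?\<phi> m)) \<longlonglongrightarrow> L2_ip \<rho> h (poly p)"
    proof (rule L2_ip_dominated[OF h])
      show "continuous_on (I_rho \<rho>) (?\<phi> m)" for m
        by (intro smooth_continuous_on test_fun_smooth[OF test])
      show "\<bar>?\<phi> m x\<bar> \<le> B" if "x \<in> I_rho \<rho>" for m x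
      proof -
        have c: "\<bar>cutoff (?e m) (- \<rho> + ?e m) (1 + \<rho> - ?e m) x\<bar> \<le> 1"
          using cutoff_bounds[of "?e m" "- \<rho> + ?e m" "1 + \<rho> - ?e m" x] by (simp add: abs_of_nonneg)
        have "\<bar>?\<phi> m x\<bar> \<le> \<bar>poly p x\<bar> * 1"
          unfolding abs_mult by (intro mult_left_mono c) simp
        with B[OF that] show ?thesis by simp
      qed
      show "AE x in lebesgue_on (I_rho \<rho>). (\<lambda>m. ?\<phi> m x) \<longlonglongrightarrow> poly p x"
        using AE_interior_I_rho
      proof eventually_elim
        case (elim x)
        then have x: "- \<rho> < x" "x < 1 + \<rho>" by (auto simp: interior_I_rho)
        have a: "(\<lambda>m. - \<rho> + ?e m) \<longlonglongrightarrow> - \<rho> + 0" and b: "(\<lambda>m. 1 + \<rho> - ?e m) \<longlonglongrightarrow> 1 + \<rho> - 0"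
          by (intro tendsto_intros e0)+
        have "\<forall>\<^sub>F m in sequentially. - \<rho> + ?e m < x" "\<forall>\<^sub>F m in sequentially. x < 1 + \<rho> - ?e m"
          using order_tendstoD(2)[OF a] order_tendstoD(1)[OF b] x by auto
        then have ev: "\<forall>\<^sub>F m in sequentially. exp (- ?e m / (x - (- \<rho> + ?e m))) * exp (- ?e m / (1 + \<rho> - ?e m - x))
            = cutoff (?e m) (- \<rho> + ?e m) (1 + \<rho> - ?e m) x"
          by eventually_elim (simp add: cutoff_eq)
        have "(\<lambda>m. exp (- ?e m / (x - (- \<rho> + ?e m))) * exp (- ?e m / (1 + \<rho> - ?e m - x)))
            \<longlonglongrightarrow> exp (- 0 / (x - (- \<rho> + 0))) * exp (- 0 / (1 + \<rho> - 0 - x))"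
          using x by (intro tendsto_intros e0) auto
        from Lim_transform_eventually[OF this ev]
        have "(\<lambda>m. cutoff (?e m) (- \<rho> + ?e m) (1 + \<rho> - ?e m) x) \<longlonglongrightarrow> 1" by simp
        from tendsto_mult[OF tendsto_const this, of "poly p x"] show ?case by simp
      qed
    qed (intro continuous_intros)
    moreover have "(\<lambda>m. L2_ip \<rho> h (?\<phi> m)) = (\<lambda>_. 0)" by (rule ext) (rule orth[OF test])
    ultimately have "(\<lambda>_::nat. 0) \<longlonglongrightarrow> L2_ip \<rho> h (poly p)" by (simp only:)
    then show ?thesis unfolding LIMSEQ_const_iff by (rule sym)
  qed
  obtain p where p: "(\<lambda>m. sqrt (L2_ip \<rho> (\<lambda>x. poly (p m) x - h x) (\<lambda>x. poly (p m) x - h x))) \<longlonglongrightarrow> 0"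
    using L2_dense_poly_seq[OF \<rho> h] by blast
  have "(\<lambda>m. L2_ip \<rho> (poly (p m)) h) \<longlonglongrightarrow> L2_ip \<rho> h h"
    by (intro L2_ip_tendsto h p L2_fun_continuous continuous_intros)
  moreover have "L2_ip \<rho> (poly (p m)) h = 0" for m
    using poly0[of "p m"] by (simp add: L2_ip_commute)
  ultimately show ?thesis by (simp add: LIMSEQ_const_iff)
qed

lemma is_weak_deriv_weak_deriv: "is_weak_deriv \<rho> u g \<Longrightarrow> is_weak_deriv \<rho> u (weak_deriv \<rho> u)"
  unfolding weak_deriv_def by (metis someI)

text \<open>The difference of two weak derivatives is orthogonal to all test functions, hence of
  norm 0. Functions are not identified almost everywhere, so uniqueness takes the form of equal
  inner products.\<close>

lemma weak_deriv_unique: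
  assumes \<rho>: "0 < \<rho>" and g: "is_weak_deriv \<rho> u g" and v: "v \<in> L2_fun \<rho>"
  shows "L2_ip \<rho> (weak_deriv \<rho> u) v = L2_ip \<rho> g v"
proof -
  let ?w = "weak_deriv \<rho> u"
  have w: "is_weak_deriv \<rho> u ?w" using is_weak_deriv_weak_deriv[OF g] .
  have mem: "?w \<in> L2_fun \<rho>" "g \<in> L2_fun \<rho>" using w g by (auto simp: is_weak_deriv_def)
  have d: "(\<lambda>x. ?w x - g x) \<in> L2_fun \<rho>" by (intro L2_fun_diff mem)
  have "L2_ip \<rho> (\<lambda>x. ?w x - g x) (\<lambda>x. ?w x - g x) = 0"
  proof (rule orthogonal_test_fun_imp_null[OF \<rho> d])
    fix \<phi> assume \<phi>: "test_fun \<rho> \<phi>"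
    have "\<phi> \<in> L2_fun \<rho>" by (intro L2_fun_continuous smooth_continuous_on test_fun_smooth[OF \<phi>])
    then have "L2_ip \<rho> (\<lambda>x. ?w x - g x) \<phi> = L2_ip \<rho> ?w \<phi> - L2_ip \<rho> g \<phi>"
      by (intro L2_ip_diff_left mem)
    also have "\<dots> = 0"
      using w g \<phi> by (simp add: is_weak_deriv_def)
    finally show "L2_ip \<rho> (\<lambda>x. ?w x - g x) \<phi> = 0" .
  qed
  then have "L2_ip \<rho> (\<lambda>x. ?w x - g x) v = 0"
    using L2_Cauchy_Schwarz[OF d v] by simp
  then show ?thesis by (simp add: L2_ip_diff_left mem v)
qed

text \<open>
  Dilating \<open>\<psi>\<close> about the midpoint of the interval yields test functions, even if the support of \<open>\<psi>\<close>
  touches the boundary.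
\<close>

lemma weak_deriv_smooth:
  assumes \<rho>: "0 < \<rho>" and u: "u \<in> L2_fun \<rho>" and g: "is_weak_deriv \<rho> u g"
    and \<psi>: "smooth \<psi>" and zero: "\<And>x. x \<notin> I_rho \<rho> \<Longrightarrow> \<psi> x = 0"
  shows "L2_ip \<rho> u (deriv \<psi>) = - L2_ip \<rho> g \<psi>"
proof -
  define s where "s m = 1 + 1 / real (Suc m)" for m
  \<comment> \<open>The affine map fixes the midpoint \<open>1 / 2\<close> and stretches by
    \<open>s m\<close>, which decreases to 1; the support of \<open>\<phi> m\<close> is that of
    \<psi>, shrunk about the midpoint by the factor \<open>1 / s m\<close>.\<close>
  define \<phi> where "\<phi> m x = \<psi> (s m * x + (1 - s m) / 2)" for m x
  have s: "1 < s m" "s m \<le> 2" for m by (auto simp: s_def)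
  have s_lim: "s \<longlonglongrightarrow> 1"
    unfolding s_def using tendsto_add[OF tendsto_const LIMSEQ_Suc[OF lim_1_over_n]] by simp
  have smooth: "smooth (\<phi> m)" for m
    using smooth_affine[OF \<psi>, of 1 "s m" "(1 - s m) / 2"] by (simp add: \<phi>_def[abs_def])
  have test: "test_fun \<rho> (\<phi> m)" for m
    unfolding test_fun_def
  proof (intro conjI)
    show "\<forall>k x. (deriv ^^ k) (\<phi> m) field_differentiable at x"
      using smooth by (simp add: smooth_def)
    let ?r = "(1 / 2 + \<rho>) / s m"
    have "(1 / 2 + \<rho>) * 1 < (1 / 2 + \<rho>) * s m"
      using s[of m] \<rho> by (intro mult_strict_left_mono) auto
    then have r: "?r < 1 / 2 + \<rho>" using s[of m] by (simp add: pos_divide_less_eq)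
    have "\<phi> m x = 0" if x: "x \<notin> {1 / 2 - ?r..1 / 2 + ?r}" for x
      unfolding \<phi>_def
    proof (rule zero)
      from x have "?r < \<bar>x - 1 / 2\<bar>" by auto
      then have "1 / 2 + \<rho> < s m * \<bar>x - 1 / 2\<bar>"
        using s[of m] by (simp add: pos_divide_less_eq mult.commute)
      also have "\<dots> = \<bar>s m * x + (1 - s m) / 2 - 1 / 2\<bar>"
        using s[of m] by (simp add: abs_mult_pos' algebra_simps diff_divide_distrib)
      finally show "s m * x + (1 - s m) / 2 \<notin> I_rho \<rho>"
        by (auto simp: I_rho_def abs_if split: if_splits)
    qed
    then show "\<exists>K. compact K \<and> K \<subseteq> interior (I_rho \<rho>) \<and> (\<forall>x. x \<notin> K \<longrightarrow> \<phi> m x = 0)"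
      using r by (intro exI[of _ "{1 / 2 - ?r..1 / 2 + ?r}"]) (auto simp: interior_I_rho)
  qed
  have deriv: "deriv (\<phi> m) x = s m * deriv \<psi> (s m * x + (1 - s m) / 2)" for m x
  proof (rule DERIV_imp_deriv)
    have "(\<phi> m has_real_derivative deriv \<psi> (s m * x + (1 - s m) / 2) * s m) (at x)"
      unfolding \<phi>_def[abs_def]
      by (rule DERIV_chain2[OF smooth_DERIV[OF \<psi>]]) (auto intro!: derivative_eq_intros)
    then show "(\<phi> m has_real_derivative s m * deriv \<psi> (s m * x + (1 - s m) / 2)) (at x)"
      by (simp add: mult.commute)
  qed
  \<comment> \<open>Since \<open>s m \<le> 2\<close>, all stretched arguments stay in one compact
    interval, so the bounds on \<psi> and its derivative are uniform in \<open>m\<close>.\<close>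
  have range: "s m * x + (1 - s m) / 2 \<in> {- 1 - 2 * \<rho>..2 + 2 * \<rho>}" if "x \<in> I_rho \<rho>" for m x
  proof -
    have "\<bar>x - 1 / 2\<bar> \<le> 1 / 2 + \<rho>" using that by (auto simp: I_rho_def)
    then have "s m * \<bar>x - 1 / 2\<bar> \<le> 2 * (1 / 2 + \<rho>)"
      using s[of m] \<rho> by (intro mult_mono) auto
    then have "\<bar>s m * x + (1 - s m) / 2 - 1 / 2\<bar> \<le> 1 + 2 * \<rho>"
      using s[of m] by (simp add: abs_mult_pos' algebra_simps diff_divide_distrib)
    then show ?thesis by auto
  qed
  have bound: "\<exists>B. \<forall>y\<in>{- 1 - 2 * \<rho>..2 + 2 * \<rho>}. \<bar>f y\<bar> \<le> B" if "smooth f" for f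
  proof -
    have "compact (f ` {- 1 - 2 * \<rho>..2 + 2 * \<rho>})"
      by (intro compact_continuous_image smooth_continuous_on that) simp
    from compact_imp_bounded[OF this] show ?thesis by (auto simp: bounded_iff)
  qed
  have lim: "(\<lambda>m. f (s m * x + (1 - s m) / 2)) \<longlonglongrightarrow> f x" if "smooth f" for f x
  proof (rule isCont_tendsto_compose[where g = f])
    show "isCont f x" using smooth_DERIV[OF that] DERIV_isCont by blast
    have "(\<lambda>m. s m * x + (1 - s m) / 2) \<longlonglongrightarrow> 1 * x + (1 - 1) / 2"
      by (intro tendsto_intros s_lim) auto
    then show "(\<lambda>m. s m * x + (1 - s m) / 2) \<longlonglongrightarrow> x" by simp
  qed
  have gL2: "g \<in> L2_fun \<rho>" using g by (simp add: is_weak_deriv_def)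
  obtain B where B: "\<And>y. y \<in> {- 1 - 2 * \<rho>..2 + 2 * \<rho>} \<Longrightarrow> \<bar>\<psi> y\<bar> \<le> B"
    using bound[OF \<psi>] by blast
  have "(\<lambda>m. L2_ip \<rho> g (\<phi> m)) \<longlonglongrightarrow> L2_ip \<rho> g \<psi>"
  proof (rule L2_ip_dominated[OF gL2])
    show "\<bar>\<phi> m x\<bar> \<le> B" if "x \<in> I_rho \<rho>" for m x
      unfolding \<phi>_def by (intro B range that)
    show "AE x in lebesgue_on (I_rho \<rho>). (\<lambda>m. \<phi> m x) \<longlonglongrightarrow> \<psi> x"
      unfolding \<phi>_def by (intro AE_I2 lim \<psi>)
  qed (intro smooth_continuous_on smooth \<psi>)+
  then have 1: "(\<lambda>m. - L2_ip \<rho> g (\<phi> m)) \<longlonglongrightarrow> - L2_ip \<rho> g \<psi>" by (rule tendsto_minus)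
  obtain B' where B': "\<And>y. y \<in> {- 1 - 2 * \<rho>..2 + 2 * \<rho>} \<Longrightarrow> \<bar>deriv \<psi> y\<bar> \<le> B'"
    using bound[OF smooth_deriv[OF \<psi>]] by blast
  have 2: "(\<lambda>m. L2_ip \<rho> u (deriv (\<phi> m))) \<longlonglongrightarrow> L2_ip \<rho> u (deriv \<psi>)"
  proof (rule L2_ip_dominated[OF u])
    show "\<bar>deriv (\<phi> m) x\<bar> \<le> 2 * B'" if "x \<in> I_rho \<rho>" for m x
      unfolding deriv abs_mult using s[of m] B'[OF range[OF that]] by (intro mult_mono) auto
    show "AE x in lebesgue_on (I_rho \<rho>). (\<lambda>m. deriv (\<phi> m) x) \<longlonglongrightarrow> deriv \<psi> x"
    proof (rule AE_I2)
      fix x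
      from tendsto_mult[OF s_lim lim[OF smooth_deriv[OF \<psi>]]]
      show "(\<lambda>m. deriv (\<phi> m) x) \<longlonglongrightarrow> deriv \<psi> x" unfolding deriv by simp
    qed
  qed (intro smooth_continuous_on smooth_deriv smooth \<psi>)+
  have "L2_ip \<rho> u (deriv (\<phi> m)) = - L2_ip \<rho> g (\<phi> m)" for m
    using g test by (simp add: is_weak_deriv_def)
  with 1 2 show ?thesis using LIMSEQ_unique by simp
qed

section \<open>The degrees of freedom\<close>

text \<open>Partial fractions: \<open>1 / (x\<^sup>2 - 1) = - (1/2) / (x + 1) - (1/2) / (1 - x)\<close>.\<close>

lemma bump_eq_cutoff: "bump = cutoff (1 / 2) (- 1) 1"
proof
  fix x :: real
  have "- (1 / 2) / (x + 1) + - (1 / 2) / (1 - x) = 1 / (x\<^sup>2 - 1)" if "- 1 < x" "x < 1"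
  proof -
    have "x + 1 \<noteq> 0" "1 - x \<noteq> 0" using that by auto
    moreover have "x\<^sup>2 - 1 = - ((x + 1) * (1 - x))" by (simp add: power2_eq_square algebra_simps)
    ultimately show ?thesis by (simp only:) (simp add: divide_simps algebra_simps)
  qed
  then show "bump x = cutoff (1 / 2) (- 1) 1 x"
    by (auto simp: bump_def cutoff_eq abs_less_iff simp flip: exp_add)
qed

section \<open>The mollifiers\<close>

lemma smooth_bump: "smooth bump"
  by (simp add: bump_eq_cutoff smooth_cutoff)

lemma bump_integrable: "integrable lebesgue bump"
proof -
  have "set_integrable lebesgue {- 1..1} bump"
    by (intro absolutely_integrable_continuous_real smooth_continuous_on smooth_bump)
  moreover have "(\<lambda>x. indicator {- 1..1} x *\<^sub>R bump x) = bump"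
    by (rule ext) (auto simp: bump_def indicator_def)
  ultimately show ?thesis by (simp add: set_integrable_def)
qed

lemma bump_integral_pos: "0 < (LINT y|lebesgue. bump y)"
proof -
  \<comment> \<open>For \<open>\<bar>y\<bar> \<le> 1 / 2\<close> the exponent is at least
    \<open>1 / (1 / 4 - 1) = - 4 / 3\<close>, and this subinterval has length 1. Positivity makes
    the quotient that normalises \<open>eta\<close> a genuine one.\<close>
  have "(LINT y|lebesgue. exp (- 4 / 3) * indicat_real {- 1 / 2..1 / 2 :: real} y) \<le> (LINT y|lebesgue. bump y)"
  proof (rule integral_mono)
    show "integrable lebesgue (\<lambda>y. exp (- 4 / 3) * indicat_real {- 1 / 2..1 / 2 :: real} y)"
      by (intro integrable_mult_right integrable_real_indicator) (auto simp: emeasure_lborel_Icc_eq)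
    fix y :: real
    show "exp (- 4 / 3) * indicat_real {- 1 / 2..1 / 2 :: real} y \<le> bump y"
    proof (cases "y \<in> {- 1 / 2..1 / 2}")
      case True
      then have "\<bar>y\<bar> \<le> 1 / 2" by auto
      then have "\<bar>y\<bar>\<^sup>2 \<le> (1 / 2)\<^sup>2" by (intro power_mono) auto
      then have "y\<^sup>2 \<le> 1 / 4" by (simp add: power2_eq_square)
      then have "- 4 / 3 \<le> 1 / (y\<^sup>2 - 1)" by (simp add: field_simps)
      with True show ?thesis by (auto simp: bump_def)
    qed (simp add: bump_def)
  qed (rule bump_integrable)
  moreover have "(LINT y|lebesgue. exp (- 4 / 3) * indicat_real {- 1 / 2..1 / 2 :: real} y) = exp (- 4 / 3)"
    by simp
  ultimately show ?thesis by (metis exp_gt_zero less_le_trans)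
qed

text \<open>The values \<open>t = 0\<close> and \<open>t = 1\<close> cover \<open>eta_l\<close> and
  \<open>eta_r\<close>. The affine substitution takes place in \<open>lborel\<close>, whose integral
  agrees with that of \<open>lebesgue\<close> on Borel functions.\<close>

lemma eta_scaled_integral:
  assumes "0 < \<rho>"
  shows "(LINT x|lebesgue. 1 / \<rho> * eta ((x - t) / \<rho>)) = 1"
proof -
  have bump_meas: "bump \<in> borel_measurable borel"
    by (intro borel_measurable_continuous_onI smooth_continuous_on smooth_bump)
  then have meas: "(\<lambda>x. bump ((x - t) / \<rho>)) \<in> borel_measurable borel"
    by measurable
  have "(LINT x|lebesgue. bump ((x - t) / \<rho>)) = (LINT x|lborel. bump ((x - t) / \<rho>))"
    using meas by (intro integral_completion) simp
  also have "\<dots> = \<rho> * (LINT x|lborel. bump ((t + \<rho> * x - t) / \<rho>))"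
    using assms by (subst lborel_integral_real_affine[of \<rho> _ t]) auto
  also have "\<dots> = \<rho> * (LINT x|lborel. bump x)"
    using assms by simp
  also have "(LINT x|lborel. bump x) = (LINT x|lebesgue. bump x)"
    using bump_meas by (intro integral_completion[symmetric]) simp
  finally show ?thesis
    using assms bump_integral_pos by (simp add: eta_def)
qed

lemma eta_zero: "1 \<le> \<bar>x\<bar> \<Longrightarrow> eta x = 0"
  by (simp add: eta_def bump_def)

lemma eta_l_zero: "0 < \<rho> \<Longrightarrow> x \<notin> ball 0 \<rho> \<Longrightarrow> eta_l \<rho> x = 0"
  unfolding eta_l_def by (subst eta_zero) (auto simp: dist_norm)

lemma eta_r_zero: "0 < \<rho> \<Longrightarrow> x \<notin> ball 1 \<rho> \<Longrightarrow> eta_r \<rho> x = 0"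
  unfolding eta_r_def by (subst eta_zero) (auto simp: dist_norm abs_minus_commute)

lemma smooth_eta: "smooth eta"
  unfolding eta_def[abs_def] by (intro smooth_scale smooth_bump)

lemma smooth_eta_l: "smooth (eta_l \<rho>)"
  using smooth_affine[OF smooth_eta, of "1 / \<rho>" "1 / \<rho>" 0]
  by (simp add: eta_l_def[abs_def])

lemma smooth_eta_r: "smooth (eta_r \<rho>)"
  using smooth_affine[OF smooth_eta, of "1 / \<rho>" "1 / \<rho>" "- 1 / \<rho>"]
  by (simp add: eta_r_def[abs_def] diff_divide_distrib)

lemma balls_subset_interior:
  assumes "0 < \<rho>"
  shows "ball 0 \<rho> \<subseteq> interior (I_rho \<rho>)" "ball 1 \<rho> \<subseteq> interior (I_rho \<rho>)"
  using assms by (auto simp: interior_I_rho dist_norm)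

lemma I_rho_integral_eq:
  fixes f :: "real \<Rightarrow> real"
  assumes "\<And>x. x \<notin> I_rho \<rho> \<Longrightarrow> f x = 0"
  shows "(LINT x|lebesgue_on (I_rho \<rho>). f x) = (LINT x|lebesgue. f x)"
proof -
  have "(\<lambda>x. indicator (I_rho \<rho>) x *\<^sub>R f x) = f"
    using assms by (intro ext) (auto simp: indicator_def)
  then show ?thesis by (subst integral_restrict_space) auto
qed

lemma eta_integral_I_rho:
  assumes "0 < \<rho>"
  shows "(LINT x|lebesgue_on (I_rho \<rho>). eta_l \<rho> x) = 1"
    and "(LINT x|lebesgue_on (I_rho \<rho>). eta_r \<rho> x) = 1"
proof -
  have sub: "ball 0 \<rho> \<subseteq> I_rho \<rho>" "ball 1 \<rho> \<subseteq> I_rho \<rho>"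
    using balls_subset_interior[OF assms] interior_subset by blast+
  have "(LINT x|lebesgue_on (I_rho \<rho>). eta_l \<rho> x) = (LINT x|lebesgue. eta_l \<rho> x)"
    using sub by (intro I_rho_integral_eq eta_l_zero assms) blast
  also have "\<dots> = 1"
    using eta_scaled_integral[OF assms, of 0] by (simp add: eta_l_def)
  finally show "(LINT x|lebesgue_on (I_rho \<rho>). eta_l \<rho> x) = 1" .
  have "(LINT x|lebesgue_on (I_rho \<rho>). eta_r \<rho> x) = (LINT x|lebesgue. eta_r \<rho> x)"
    using sub by (intro I_rho_integral_eq eta_r_zero assms) blast
  also have "\<dots> = 1"
    using eta_scaled_integral[OF assms, of 1] by (simp add: eta_r_def)
  finally show "(LINT x|lebesgue_on (I_rho \<rho>). eta_r \<rho> x) = 1" .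
qed

section \<open>Averaged degrees of freedom as inner products\<close>

lemma set_integral_ball_eq:
  fixes f g :: "real \<Rightarrow> real"
  assumes "B \<subseteq> I_rho \<rho>" "\<And>x. x \<in> B \<Longrightarrow> f x = g x" "\<And>x. x \<notin> B \<Longrightarrow> g x = 0"
  shows "(LINT x:B|lebesgue. f x) = (LINT x|lebesgue_on (I_rho \<rho>). g x)"
proof -
  have "(\<lambda>x. indicator B x *\<^sub>R f x) = g" using assms(2,3) by (intro ext) (auto simp: indicator_def)
  moreover have "(LINT x|lebesgue_on (I_rho \<rho>). g x) = (LINT x|lebesgue. g x)"
    using assms by (intro I_rho_integral_eq) blast
  ultimately show ?thesis by (simp add: set_lebesgue_integral_def)
qed

text \<open>If the nodal functional is a sum of a function of the left node and one of the right
  node, the double average splits as well, since the mollifier at the other node has mass 1.\<close>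

lemma mean_dof_eq:
  assumes \<rho>: "0 < \<rho>"
    and pq: "p \<in> L2_fun \<rho>" "q \<in> L2_fun \<rho>"
    and nodal: "\<And>a b. a \<in> ball 0 \<rho> \<Longrightarrow> b \<in> ball 1 \<rho> \<Longrightarrow> nodal_dof k i a b f = p a + q b"
  shows "mean_dof \<rho> k i f = L2_ip \<rho> p (eta_l \<rho>) + L2_ip \<rho> q (eta_r \<rho>)"
proof -
  let ?M = "lebesgue_on (I_rho \<rho>)" and ?Q = "L2_ip \<rho> q (eta_r \<rho>)"
  have eta: "eta_l \<rho> \<in> L2_fun \<rho>" "eta_r \<rho> \<in> L2_fun \<rho>"
    by (intro L2_fun_continuous smooth_continuous_on smooth_eta_l smooth_eta_r)+
  have one: "(\<lambda>_. 1) \<in> L2_fun \<rho>" by (intro L2_fun_continuous continuous_intros)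
  have balls: "ball 0 \<rho> \<subseteq> I_rho \<rho>" "ball 1 \<rho> \<subseteq> I_rho \<rho>"
    using balls_subset_interior[OF \<rho>] interior_subset by blast+
  have int: "integrable ?M (eta_l \<rho>)" "integrable ?M (eta_r \<rho>)"
    using L2_integrable_mult[OF eta(1) one] L2_integrable_mult[OF eta(2) one] by simp_all
  have inner: "(LINT b:ball 1 \<rho>|lebesgue. eta_l \<rho> a * eta_r \<rho> b * nodal_dof k i a b f) =
      eta_l \<rho> a * (p a + ?Q)" if a: "a \<in> ball 0 \<rho>" for a
  proof -
    have "(LINT b:ball 1 \<rho>|lebesgue. eta_l \<rho> a * eta_r \<rho> b * nodal_dof k i a b f) =
        (LINT b|?M. eta_l \<rho> a * (p a * eta_r \<rho> b + q b * eta_r \<rho> b))"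
      using nodal[OF a] eta_r_zero[OF \<rho>]
      by (intro set_integral_ball_eq balls) (simp_all add: algebra_simps)
    also have "\<dots> = eta_l \<rho> a * (p a + ?Q)"
      using int(2) L2_integrable_mult[OF pq(2) eta(2)]
      by (simp add: eta_integral_I_rho[OF \<rho>] L2_ip_def)
    finally show ?thesis .
  qed
  have "mean_dof \<rho> k i f = (LINT a|?M. p a * eta_l \<rho> a + ?Q * eta_l \<rho> a)"
    unfolding mean_dof_def
  proof (intro set_integral_ball_eq balls)
    fix a :: real assume "a \<in> ball 0 \<rho>"
    from inner[OF this]
    show "(LINT b:ball 1 \<rho>|lebesgue. eta_l \<rho> a * eta_r \<rho> b * nodal_dof k i a b f) =
        p a * eta_l \<rho> a + ?Q * eta_l \<rho> a"
      by (simp only: distrib_left mult.commute)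
  qed (simp add: eta_l_zero[OF \<rho>])
  also have "\<dots> = L2_ip \<rho> p (eta_l \<rho>) + ?Q"
    using int(1) L2_integrable_mult[OF pq(1) eta(1)]
    by (simp add: eta_integral_I_rho[OF \<rho>] L2_ip_def)
  finally show ?thesis .
qed

lemma set_integral_FTC:
  assumes F: "\<And>x. x \<in> I_rho \<rho> \<Longrightarrow> (F has_real_derivative f x) (at x within I_rho \<rho>)"
    and f: "continuous_on (I_rho \<rho>) f"
    and ab: "a \<in> I_rho \<rho>" "b \<in> I_rho \<rho>" "a \<le> b"
  shows "(LINT x:{a..b}|lebesgue. f x) = F b - F a"
proof -
  have sub: "{a..b} \<subseteq> I_rho \<rho>" using ab by (auto simp: I_rho_def)
  have "set_integrable lebesgue {a..b} f"
    by (intro absolutely_integrable_continuous_real continuous_on_subset[OF f sub])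
  then have "(LINT x:{a..b}|lebesgue. f x) = integral {a..b} f"
    by (rule set_lebesgue_integral_eq_integral)
  also have "(f has_integral F b - F a) {a..b}"
  proof (rule fundamental_theorem_of_calculus[OF ab(3)])
    fix x assume "x \<in> {a..b}"
    then show "(F has_vector_derivative f x) (at x within {a..b})"
      using DERIV_subset[OF F sub] sub by (auto simp flip: has_real_derivative_iff_has_vector_derivative)
  qed
  then have "integral {a..b} f = F b - F a" by (rule integral_unique)
  finally show ?thesis .
qed

text \<open>The order of the nodes comes from the bound on \<rho>: \<open>a < 1 / 3\<close> and
  \<open>2 / 3 < b\<close>. It makes the integral over \<open>{a..b}\<close> in
  \<open>nodal_dof\<close> the oriented integral from \<open>a\<close> to \<open>b\<close>.\<close>

lemma balls_I_rho:
  assumes "0 < \<rho>" "\<rho> \<le> 1 / 3" "a \<in> ball 0 \<rho>" "b \<in> ball 1 \<rho>"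
  shows "a \<in> I_rho \<rho>" "b \<in> I_rho \<rho>" "a \<le> b" "a \<in> interior (I_rho \<rho>)" "b \<in> interior (I_rho \<rho>)"
  using assms by (auto simp: interior_I_rho I_rho_def dist_norm abs_less_iff)

lemma deriv_eq_interior:
  assumes "(f has_real_derivative f') (at x within I_rho \<rho>)" "x \<in> interior (I_rho \<rho>)"
  shows "deriv f x = f'"
  using assms at_within_interior[OF assms(2)] by (auto intro: DERIV_imp_deriv)

text \<open>The nodal functionals already commute with differentiation before averaging: two are
  point values of the derivative, and the third is the fundamental theorem of calculus.\<close>

lemma mean_dof_0_eq_mean_dof_1:
  assumes \<rho>: "0 < \<rho>" "\<rho> \<le> 1 / 3"
    and f: "\<And>x. x \<in> I_rho \<rho> \<Longrightarrow> (f has_real_derivative f' x) (at x within I_rho \<rho>)"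
      "continuous_on (I_rho \<rho>) f'"
    and i: "i \<in> {1, 2, 3}"
  shows "mean_dof \<rho> 0 i f = mean_dof \<rho> 1 i f'"
proof -
  have "nodal_dof 0 i a b f = nodal_dof 1 i a b f'" if "a \<in> ball 0 \<rho>" "b \<in> ball 1 \<rho>" for a b
    using balls_I_rho[OF \<rho> that] i deriv_eq_interior[OF f(1)] set_integral_FTC[OF f]
    by (auto simp: nodal_dof_def)
  then show ?thesis
    unfolding mean_dof_def
    by (intro set_lebesgue_integral_cong allI impI) auto
qed

text \<open>\<theta> is the difference of the distribution functions of the two mollifiers.
  Normalised at \<open>- \<rho>\<close>, it is 0 to the left of the interval, and it is 0 to the
  right because the two masses cancel.\<close>

lemma antiderivative_eta_diff:
  assumes \<rho>: "0 < \<rho>"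
  shows "\<exists>\<theta>. (\<forall>x. (\<theta> has_real_derivative eta_l \<rho> x - eta_r \<rho> x) (at x)) \<and>
             (\<forall>x. x \<notin> interior (I_rho \<rho>) \<longrightarrow> \<theta> x = 0)"
proof -
  let ?h = "\<lambda>x. eta_l \<rho> x - eta_r \<rho> x"
  have smooth: "smooth ?h" by (intro smooth_diff smooth_eta_l smooth_eta_r)
  have "\<exists>F. \<forall>x::real. - \<infinity> < ereal x \<longrightarrow> ereal x < \<infinity> \<longrightarrow> (F has_vector_derivative ?h x) (at x)"
    by (rule einterval_antiderivative) (use DERIV_isCont[OF smooth_DERIV[OF smooth]] in auto)
  then obtain F where F: "\<And>x. (F has_real_derivative ?h x) (at x)"
    by (auto simp: has_real_derivative_iff_has_vector_derivative)
  let ?\<theta> = "\<lambda>x. F x - F (- \<rho>)"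
  have \<theta>: "(?\<theta> has_real_derivative ?h x) (at x)" for x
    using DERIV_diff[OF F DERIV_const] by simp
  have h0: "?h x = 0" if "x \<notin> interior (I_rho \<rho>)" for x
    using that eta_l_zero[OF \<rho>] eta_r_zero[OF \<rho>] balls_subset_interior[OF \<rho>] by fastforce
  \<comment> \<open>Off the open interval the derivative is 0, so \<open>F\<close> is constant on
    every segment that misses it; \<open>min\<close> and \<open>max\<close> admit both orders of the
    end points.\<close>
  have const: "F x = F y" if "{min x y..max x y} \<inter> {- \<rho><..<1 + \<rho>} = {}" for x y
  proof -
    have "(F has_real_derivative 0) (at z within {min x y..max x y})" if "z \<in> {min x y..max x y}" for z
    proof -
      have "z \<notin> interior (I_rho \<rho>)"
        using that \<open>{min x y..max x y} \<inter> {- \<rho><..<1 + \<rho>} = {}\<close> unfolding interior_I_rho by blast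
      then have "(F has_real_derivative 0) (at z)" using F[of z] h0[of z] by simp
      then show ?thesis by (rule has_field_derivative_at_within)
    qed
    then have "\<exists>c. \<forall>z\<in>{min x y..max x y}. F z = c"
      using has_field_derivative_zero_constant[of "{min x y..max x y}" F] by blast
    then show ?thesis by auto
  qed
  have "(LINT x|lebesgue_on (I_rho \<rho>). ?h x) = F (1 + \<rho>) - F (- \<rho>)"
  proof -
    have "(LINT x|lebesgue_on (I_rho \<rho>). ?h x) = (LINT x:{- \<rho>..1 + \<rho>}|lebesgue. ?h x)"
      by (simp add: integral_restrict_space set_lebesgue_integral_def I_rho_def)
    also have "\<dots> = F (1 + \<rho>) - F (- \<rho>)"
    proof (rule set_integral_FTC[of \<rho>])
      show "(F has_real_derivative ?h x) (at x within I_rho \<rho>)" for x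
        by (rule has_field_derivative_at_within[OF F])
      show "continuous_on (I_rho \<rho>) ?h" by (rule smooth_continuous_on[OF smooth])
    qed (use \<rho> in \<open>auto simp: I_rho_def\<close>)
    finally show ?thesis .
  qed
  moreover have "(LINT x|lebesgue_on (I_rho \<rho>). ?h x) = 0"
  proof -
    have "integrable (lebesgue_on (I_rho \<rho>)) f" if "smooth f" for f
      unfolding I_rho_def by (intro continuous_imp_integrable_real smooth_continuous_on that)
    then show ?thesis
      by (simp add: smooth_eta_l smooth_eta_r eta_integral_I_rho[OF \<rho>])
  qed
  ultimately have ends: "F (1 + \<rho>) = F (- \<rho>)" by simp
  have "?\<theta> x = 0" if "x \<notin> interior (I_rho \<rho>)" for x
  proof -
    from that consider "x \<le> - \<rho>" | "x \<ge> 1 + \<rho>" by (fastforce simp: interior_I_rho)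
    then show ?thesis
    proof cases
      case 1
      then have "{min x (- \<rho>)..max x (- \<rho>)} \<inter> {- \<rho><..<1 + \<rho>} = {}" by auto
      from const[OF this] show ?thesis by simp
    next
      case 2
      then have "{min x (1 + \<rho>)..max x (1 + \<rho>)} \<inter> {- \<rho><..<1 + \<rho>} = {}" by auto
      from const[OF this] ends show ?thesis by simp
    qed
  qed
  with \<theta> show ?thesis by blast
qed

lemma smooth_forms_1: "f \<in> smooth_forms \<rho> 1 \<longleftrightarrow> continuous_on (I_rho \<rho>) f"
  by (simp add: smooth_forms_def)

lemma mean_dof_1_kernel:
  assumes \<rho>: "0 < \<rho>" "\<rho> \<le> 1 / 3" and i: "i \<in> {1, 2, 3}"
  shows "\<exists>\<psi>. smooth \<psi> \<and> (\<forall>x. x \<notin> interior (I_rho \<rho>) \<longrightarrow> \<psi> x = 0) \<and>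
             (\<forall>f \<in> smooth_forms \<rho> 1. mean_dof \<rho> 1 i f = L2_ip \<rho> f \<psi>)"
proof -
  have zero: "(\<lambda>_. 0) \<in> L2_fun \<rho>" by (intro L2_fun_continuous continuous_intros)
  have zero_ip: "L2_ip \<rho> (\<lambda>_. 0) g = 0" for g by (simp add: L2_ip_def)
  consider "i = 1" | "i = 2" | "i = 3" using i by blast
  then show ?thesis
  proof cases
    case 1
    have "mean_dof \<rho> 1 i f = L2_ip \<rho> f (eta_l \<rho>)" if "f \<in> smooth_forms \<rho> 1" for f
    proof -
      have f: "continuous_on (I_rho \<rho>) f" using that by (simp only: smooth_forms_1)
      show ?thesis
        using mean_dof_eq[OF \<rho>(1) L2_fun_continuous[OF f] zero, of 1 i f] 1 by (simp add: nodal_dof_def zero_ip)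
    qed
    then show ?thesis
      using smooth_eta_l eta_l_zero[OF \<rho>(1)] balls_subset_interior[OF \<rho>(1)]
      by (intro exI[of _ "eta_l \<rho>"]) blast
  next
    case 2
    have "mean_dof \<rho> 1 i f = L2_ip \<rho> f (eta_r \<rho>)" if "f \<in> smooth_forms \<rho> 1" for f
    proof -
      have f: "continuous_on (I_rho \<rho>) f" using that by (simp only: smooth_forms_1)
      show ?thesis
        using mean_dof_eq[OF \<rho>(1) zero L2_fun_continuous[OF f], of 1 i f] 2 by (simp add: nodal_dof_def zero_ip)
    qed
    then show ?thesis
      using smooth_eta_r eta_r_zero[OF \<rho>(1)] balls_subset_interior[OF \<rho>(1)]
      by (intro exI[of _ "eta_r \<rho>"]) blast
  next
    case 3
    obtain \<theta> where \<theta>: "\<And>x. (\<theta> has_real_derivative eta_l \<rho> x - eta_r \<rho> x) (at x)"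
      and \<theta>0: "\<And>x. x \<notin> interior (I_rho \<rho>) \<Longrightarrow> \<theta> x = 0"
      using antiderivative_eta_diff[OF \<rho>(1)] by blast
    have smooth_h: "smooth (\<lambda>x. eta_l \<rho> x - eta_r \<rho> x)"
      by (intro smooth_diff smooth_eta_l smooth_eta_r)
    have "mean_dof \<rho> 1 i f = L2_ip \<rho> f \<theta>" if "f \<in> smooth_forms \<rho> 1" for f
    proof -
      have f: "continuous_on (I_rho \<rho>) f" using that by (simp only: smooth_forms_1)
      \<comment> \<open>The antiderivative separates the nodes: the integral between them is
        \<open>V b - V a\<close>. Averaging pairs \<open>V\<close> with
        \<open>eta_r - eta_l\<close>, and integration by parts returns to \<open>f\<close> paired
        with \<theta>.\<close>
      define V where "V x = integral {- \<rho>..x} f" for x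
      have V: "(V has_real_derivative f x) (at x within I_rho \<rho>)" if "x \<in> I_rho \<rho>" for x
        using integral_has_real_derivative[of "- \<rho>" "1 + \<rho>" f x] f that
        by (simp add: V_def[abs_def] I_rho_def)
      have VL2: "V \<in> L2_fun \<rho>" using V by (auto intro: L2_fun_continuous DERIV_continuous_on)
      have eta: "eta_l \<rho> \<in> L2_fun \<rho>" "eta_r \<rho> \<in> L2_fun \<rho>"
        by (intro L2_fun_continuous smooth_continuous_on smooth_eta_l smooth_eta_r)+
      have "nodal_dof 1 i a b f = - 1 * V a + V b" if "a \<in> ball 0 \<rho>" "b \<in> ball 1 \<rho>" for a b
        using set_integral_FTC[OF V f balls_I_rho(1-3)[OF \<rho> that]] 3 by (simp add: nodal_dof_def)
      then have "mean_dof \<rho> 1 i f = L2_ip \<rho> (\<lambda>x. - 1 * V x) (eta_l \<rho>) + L2_ip \<rho> V (eta_r \<rho>)"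
        by (intro mean_dof_eq \<rho> VL2 L2_fun_scale)
      also have "\<dots> = - (L2_ip \<rho> (eta_l \<rho>) V - L2_ip \<rho> (eta_r \<rho>) V)"
        unfolding L2_ip_scale_left by (simp add: L2_ip_commute)
      also have "\<dots> = - L2_ip \<rho> V (\<lambda>x. eta_l \<rho> x - eta_r \<rho> x)"
        unfolding L2_ip_diff_left[OF eta VL2, symmetric] by (simp add: L2_ip_commute)
      also have "\<dots> = L2_ip \<rho> f \<theta>"
        using L2_ip_by_parts[OF \<rho>(1) V has_field_derivative_at_within[OF \<theta>] f
            smooth_continuous_on[OF smooth_h] \<theta>0 \<theta>0]
        by (simp add: interior_I_rho)
      finally show ?thesis .
    qed
    then show ?thesis
      using smoothI_DERIV[OF \<theta> smooth_h] \<theta>0 by (intro exI[of _ \<theta>]) blast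
  qed
qed

section \<open>Extension of the degrees of freedom to square integrable functions\<close>

lemma smooth_forms_L2: "f \<in> smooth_forms \<rho> k \<Longrightarrow> f \<in> L2_fun \<rho>"
  by (auto simp: smooth_forms_def intro: L2_fun_continuous DERIV_continuous_on split: if_splits)

lemma poly_smooth_forms: "poly p \<in> smooth_forms \<rho> k"
proof -
  have "continuous_on (I_rho \<rho>) (poly (pderiv p))" "continuous_on (I_rho \<rho>) (poly p)"
    by (intro continuous_intros)+
  then show ?thesis
    using has_field_derivative_at_within[OF poly_DERIV, of p] unfolding smooth_forms_def by auto
qed

text \<open>Approximation by polynomials provides an admissible sequence, and continuity of the
  pairing with \<open>K\<close> gives all admissible sequences the same limit. Together these
  resolve the definite description.\<close>

lemma L2_dof_eq:
  assumes \<rho>: "0 < \<rho>" and K: "K \<in> L2_fun \<rho>" and u: "u \<in> L2_fun \<rho>"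
    and mean: "\<And>f. f \<in> smooth_forms \<rho> k \<Longrightarrow> mean_dof \<rho> k i f = L2_ip \<rho> f K"
  shows "L2_dof \<rho> k i u = L2_ip \<rho> u K"
proof -
  have lim: "(\<lambda>m. mean_dof \<rho> k i (f m)) \<longlonglongrightarrow> L2_ip \<rho> u K"
    if f: "\<And>m. f m \<in> smooth_forms \<rho> k"
      "(\<lambda>m. sqrt (L2_ip \<rho> (\<lambda>x. f m x - u x) (\<lambda>x. f m x - u x))) \<longlonglongrightarrow> 0" for f
    unfolding mean[OF f(1)] by (intro L2_ip_tendsto K u f smooth_forms_L2[OF f(1)])
  obtain p where p: "(\<lambda>m. sqrt (L2_ip \<rho> (\<lambda>x. poly (p m) x - u x) (\<lambda>x. poly (p m) x - u x))) \<longlonglongrightarrow> 0"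
    using L2_dense_poly_seq[OF \<rho> u] by blast
  show ?thesis
    unfolding L2_dof_def
  proof (rule the_equality)
    show "\<exists>f. (\<forall>m. f m \<in> smooth_forms \<rho> k) \<and>
        (\<lambda>m. sqrt (L2_ip \<rho> (\<lambda>x. f m x - u x) (\<lambda>x. f m x - u x))) \<longlonglongrightarrow> 0 \<and>
        (\<lambda>m. mean_dof \<rho> k i (f m)) \<longlonglongrightarrow> L2_ip \<rho> u K"
      using p lim[of "\<lambda>m. poly (p m)"] by (intro exI[of _ "\<lambda>m. poly (p m)"]) (simp add: poly_smooth_forms)
  next
    fix c assume "\<exists>f. (\<forall>m. f m \<in> smooth_forms \<rho> k) \<and>
        (\<lambda>m. sqrt (L2_ip \<rho> (\<lambda>x. f m x - u x) (\<lambda>x. f m x - u x))) \<longlonglongrightarrow> 0 \<and>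
        (\<lambda>m. mean_dof \<rho> k i (f m)) \<longlonglongrightarrow> c"
    then show "c = L2_ip \<rho> u K" using lim LIMSEQ_unique by blast
  qed
qed

text \<open>The boundary terms of the partial integration vanish because \<psi> is 0 at the end
  points as well. A single \<psi> serves both degrees, so that the two functionals can be matched
  through a weak derivative.\<close>

lemma L2_dof_kernels:
  assumes \<rho>: "0 < \<rho>" "\<rho> \<le> 1 / 3" and i: "i \<in> {1, 2, 3}"
  shows "\<exists>\<psi>. smooth \<psi> \<and> (\<forall>x. x \<notin> interior (I_rho \<rho>) \<longrightarrow> \<psi> x = 0) \<and>
             (\<forall>u \<in> L2_fun \<rho>. L2_dof \<rho> 1 i u = L2_ip \<rho> u \<psi> \<and> L2_dof \<rho> 0 i u = - L2_ip \<rho> u (deriv \<psi>))"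
proof -
  obtain \<psi> where \<psi>: "smooth \<psi>" and zero: "\<And>x. x \<notin> interior (I_rho \<rho>) \<Longrightarrow> \<psi> x = 0"
    and mean: "\<And>f. f \<in> smooth_forms \<rho> 1 \<Longrightarrow> mean_dof \<rho> 1 i f = L2_ip \<rho> f \<psi>"
    using mean_dof_1_kernel[OF \<rho> i] by blast
  have L2: "\<psi> \<in> L2_fun \<rho>" "deriv \<psi> \<in> L2_fun \<rho>"
    by (intro L2_fun_continuous smooth_continuous_on smooth_deriv \<psi>)+
  have neg: "L2_ip \<rho> f (\<lambda>x. - 1 * deriv \<psi> x) = - L2_ip \<rho> f (deriv \<psi>)" for f
    using L2_ip_scale_left[of \<rho> "- 1" "deriv \<psi>" f] by (simp add: L2_ip_commute)
  have mean_0: "mean_dof \<rho> 0 i f = L2_ip \<rho> f (\<lambda>x. - 1 * deriv \<psi> x)" if "f \<in> smooth_forms \<rho> 0" for f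
  proof -
    have "\<exists>f'. continuous_on (I_rho \<rho>) f' \<and>
        (\<forall>x\<in>I_rho \<rho>. (f has_real_derivative f' x) (at x within I_rho \<rho>))"
      using that by (simp add: smooth_forms_def)
    then obtain f' where f': "continuous_on (I_rho \<rho>) f'"
      "\<forall>x\<in>I_rho \<rho>. (f has_real_derivative f' x) (at x within I_rho \<rho>)" by (elim exE conjE)
    note D = bspec[OF f'(2)]
    have "f' \<in> smooth_forms \<rho> 1" using f'(1) by (simp only: smooth_forms_1)
    then have "mean_dof \<rho> 0 i f = L2_ip \<rho> f' \<psi>"
      using mean_dof_0_eq_mean_dof_1[OF \<rho> D f'(1) i] mean by (simp only:)
    also have "\<dots> = - L2_ip \<rho> f (deriv \<psi>)"
      using L2_ip_by_parts[OF \<rho>(1) D has_field_derivative_at_within[OF smooth_DERIV[OF \<psi>]] f'(1)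
          smooth_continuous_on[OF smooth_deriv[OF \<psi>]] zero zero]
      by (simp add: interior_I_rho)
    finally show ?thesis unfolding neg .
  qed
  have "L2_dof \<rho> 0 i u = - L2_ip \<rho> u (deriv \<psi>)" if "u \<in> L2_fun \<rho>" for u
    unfolding neg[symmetric] by (rule L2_dof_eq[OF \<rho>(1) L2_fun_scale[OF L2(2)] that mean_0])
  moreover have "L2_dof \<rho> 1 i u = L2_ip \<rho> u \<psi>" if "u \<in> L2_fun \<rho>" for u
    by (intro L2_dof_eq \<rho> L2 that mean)
  ultimately show ?thesis using \<psi> zero by blast
qed

text \<open>This functional does not enter the commutation; its representation is needed for the
  boundedness of the interpolation on 0-forms.\<close>

lemma L2_dof_0_4_kernel:
  assumes \<rho>: "0 < \<rho>" "\<rho> \<le> 1 / 3"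
  shows "\<exists>K \<in> L2_fun \<rho>. \<forall>u \<in> L2_fun \<rho>. L2_dof \<rho> 0 4 u = L2_ip \<rho> u K"
proof -
  have eta: "eta_l \<rho> \<in> L2_fun \<rho>" "eta_r \<rho> \<in> L2_fun \<rho>"
    by (intro L2_fun_continuous smooth_continuous_on smooth_eta_l smooth_eta_r)+
  have K: "(\<lambda>x. eta_l \<rho> x + eta_r \<rho> x) \<in> L2_fun \<rho>" by (intro L2_fun_add eta)
  have "mean_dof \<rho> 0 4 f = L2_ip \<rho> f (\<lambda>x. eta_l \<rho> x + eta_r \<rho> x)" if "f \<in> smooth_forms \<rho> 0" for f
  proof -
    have f: "f \<in> L2_fun \<rho>" by (rule smooth_forms_L2[OF that])
    have "mean_dof \<rho> 0 4 f = L2_ip \<rho> f (eta_l \<rho>) + L2_ip \<rho> f (eta_r \<rho>)"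
      by (intro mean_dof_eq \<rho> f) (simp add: nodal_dof_def)
    also have "\<dots> = L2_ip \<rho> (\<lambda>x. eta_l \<rho> x + eta_r \<rho> x) f"
      unfolding L2_ip_add_left[OF eta f] by (simp add: L2_ip_commute)
    finally show ?thesis by (simp add: L2_ip_commute)
  qed
  from L2_dof_eq[OF \<rho>(1) K _ this] K show ?thesis by blast
qed

text \<open>The equality is pointwise although \<open>g\<close> is determined only up to a null set:
  both sides are combinations of fixed polynomials, and only the coefficients depend on
  \<open>u\<close> and \<open>g\<close>. The first three basis functions on 0-forms differentiate to
  the basis on 1-forms.\<close>

lemma Pi_1d_weak_deriv:
  assumes \<rho>: "0 < \<rho>" "\<rho> \<le> 1 / 3" and u: "u \<in> L2_fun \<rho>" and g: "is_weak_deriv \<rho> u g"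
  shows "Pi_1d \<rho> 1 g = deriv (Pi_1d \<rho> 0 u)"
proof
  fix x
  have gL2: "g \<in> L2_fun \<rho>" using g by (simp add: is_weak_deriv_def)
  have dof: "L2_dof \<rho> 1 i g = L2_dof \<rho> 0 i u" if i: "i \<in> {1, 2, 3}" for i
  proof -
    obtain \<psi> where \<psi>: "smooth \<psi>" "\<And>x. x \<notin> interior (I_rho \<rho>) \<Longrightarrow> \<psi> x = 0"
      "L2_dof \<rho> 1 i g = L2_ip \<rho> g \<psi>" "L2_dof \<rho> 0 i u = - L2_ip \<rho> u (deriv \<psi>)"
      using L2_dof_kernels[OF \<rho> i] u gL2 by blast
    have "L2_ip \<rho> u (deriv \<psi>) = - L2_ip \<rho> g \<psi>"
      using interior_subset by (intro weak_deriv_smooth[OF \<rho>(1) u g \<psi>(1)] \<psi>(2)) blast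
    with \<psi> show ?thesis by simp
  qed
  let ?l = "\<lambda>i. L2_dof \<rho> 0 i u"
  have sets: "{Suc 0..4} = {1, 2, 3, 4}" "{Suc 0..3} = {1, 2, 3}" by auto
  have "Pi_1d \<rho> 0 u = (\<lambda>x. ?l 1 * (x - 2 * x^2 + x^3) + ?l 2 * (- (x^2) + x^3)
      + ?l 3 * (- 1/2 + 3 * x^2 - 2 * x^3) + ?l 4 * (1/2))"
    by (simp add: Pi_1d_def sets basis_fun_def add.assoc)
  moreover have "((\<lambda>x. ?l 1 * (x - 2 * x^2 + x^3) + ?l 2 * (- (x^2) + x^3)
      + ?l 3 * (- 1/2 + 3 * x^2 - 2 * x^3) + ?l 4 * (1/2)) has_real_derivative
      ?l 1 * (1 - 4 * x + 3 * x^2) + ?l 2 * (- 2 * x + 3 * x^2) + ?l 3 * (6 * x - 6 * x^2)) (at x)"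
    by (auto intro!: derivative_eq_intros simp: algebra_simps power2_eq_square)
  ultimately have "deriv (Pi_1d \<rho> 0 u) x =
      ?l 1 * (1 - 4 * x + 3 * x^2) + ?l 2 * (- 2 * x + 3 * x^2) + ?l 3 * (6 * x - 6 * x^2)"
    by (simp add: DERIV_imp_deriv)
  then show "Pi_1d \<rho> 1 g x = deriv (Pi_1d \<rho> 0 u) x"
    using dof by (simp add: Pi_1d_def sets basis_fun_def add.assoc)
qed

section \<open>The commuting diagram\<close>

lemma is_weak_deriv_L2: "is_weak_deriv \<rho> u g \<Longrightarrow> g \<in> L2_fun \<rho>"
  by (simp add: is_weak_deriv_def)

lemma vecs_H_forms_0: "vecs (H_forms \<rho> 0) = {u \<in> L2_fun \<rho>. \<exists>g. is_weak_deriv \<rho> u g}"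
  by (simp add: H_forms_def)

lemma vecs_H_forms_subset: "vecs (H_forms \<rho> k) \<subseteq> L2_fun \<rho>"
  by (auto simp: H_forms_def L2_forms_def)

lemma weak_deriv_L2: "u \<in> vecs (H_forms \<rho> 0) \<Longrightarrow> weak_deriv \<rho> u \<in> L2_fun \<rho>"
  unfolding vecs_H_forms_0 using is_weak_deriv_weak_deriv is_weak_deriv_L2 by blast

lemma psd_weak_deriv:
  "psd (vecs (H_forms \<rho> 0)) (\<lambda>u v. L2_ip \<rho> (weak_deriv \<rho> u) (weak_deriv \<rho> v))"
  by (rule psd_pullback[OF psd_L2 weak_deriv_L2])

lemma psd_space_L2: "psd_space (L2_forms \<rho> k)"
  by (simp add: psd_space_def L2_forms_def psd_L2)

lemma psd_space_H: "psd_space (H_forms \<rho> k)"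
proof (cases "k = 0")
  case True
  have "psd (vecs (H_forms \<rho> 0)) (\<lambda>u v. L2_ip \<rho> u v + L2_ip \<rho> (weak_deriv \<rho> u) (weak_deriv \<rho> v))"
    by (rule psd_add[OF psd_subset[OF psd_L2 vecs_H_forms_subset] psd_weak_deriv])
  with True show ?thesis by (simp add: psd_space_def H_forms_def)
next
  case False
  then show ?thesis using psd_space_L2[of \<rho> k] by (simp add: H_forms_def)
qed

lemma poly_L2: "poly p \<in> L2_fun \<rho>"
  by (intro L2_fun_continuous continuous_intros)

lemma vecs_P_forms_subset:
  assumes "0 < \<rho>"
  shows "vecs (P_forms \<rho> k) \<subseteq> vecs (H_forms \<rho> k)"
  using is_weak_deriv_poly[OF assms] poly_L2 by (auto simp: P_forms_def H_forms_def L2_forms_def)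

lemma psd_space_P: "0 < \<rho> \<Longrightarrow> psd_space (P_forms \<rho> k)"
  using psd_subset[OF psd_space_H[unfolded psd_space_def] vecs_P_forms_subset, of \<rho> k]
  by (simp add: psd_space_def P_forms_def)

text \<open>The inherited inner product involves the arbitrary representatives chosen by
  \<open>weak_deriv\<close>; inside inner products they may be exchanged for the classical
  derivatives.\<close>

lemma ip_P_forms_0:
  assumes "0 < \<rho>"
  shows "ip (P_forms \<rho> 0) (poly p) (poly q) =
           L2_ip \<rho> (poly p) (poly q) + L2_ip \<rho> (poly (pderiv p)) (poly (pderiv q))"
proof -
  have w: "weak_deriv \<rho> (poly p) \<in> L2_fun \<rho>" for p
    by (rule is_weak_deriv_L2[OF is_weak_deriv_weak_deriv[OF is_weak_deriv_poly[OF assms]]])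
  have "L2_ip \<rho> (weak_deriv \<rho> (poly p)) (weak_deriv \<rho> (poly q)) =
      L2_ip \<rho> (poly (pderiv p)) (weak_deriv \<rho> (poly q))"
    by (rule weak_deriv_unique[OF assms is_weak_deriv_poly[OF assms] w])
  also have "\<dots> = L2_ip \<rho> (weak_deriv \<rho> (poly q)) (poly (pderiv p))"
    by (rule L2_ip_commute)
  also have "\<dots> = L2_ip \<rho> (poly (pderiv q)) (poly (pderiv p))"
    by (rule weak_deriv_unique[OF assms is_weak_deriv_poly[OF assms] poly_L2])
  finally show ?thesis
    by (simp add: P_forms_def H_forms_def L2_ip_commute)
qed

section \<open>Boundedness of the one-dimensional operators\<close>

lemma bounded_op_H_L2: "bounded_op (H_forms \<rho> k) (L2_forms \<rho> k) id"
proof (cases "k = 0")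
  case True
  have "psd (vecs (H_forms \<rho> 0)) (\<lambda>u v. 1 * ip (H_forms \<rho> 0) u v - L2_ip \<rho> u v)"
    by (rule psd_cong[OF psd_weak_deriv]) (simp add: H_forms_def)
  then show ?thesis
    unfolding bounded_op_def True using vecs_H_forms_subset[of \<rho> 0]
    by (auto simp: L2_forms_def intro!: exI[of _ 1])
next
  case False
  then show ?thesis using bounded_op_id[of "L2_forms \<rho> k"] by (simp add: H_forms_def)
qed

text \<open>For the graph inner product the constant 1 suffices, and the remaining kernel is the
  \<open>L2_ip\<close> part.\<close>

lemma bounded_op_weak_deriv: "bounded_op (H_forms \<rho> 0) (H_forms \<rho> 1) (weak_deriv \<rho>)"
proof -
  have "psd (vecs (H_forms \<rho> 0)) (\<lambda>u v. 1 * ip (H_forms \<rho> 0) u v - ip (H_forms \<rho> 1) (weak_deriv \<rho> u) (weak_deriv \<rho> v))"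
    by (rule psd_cong[OF psd_subset[OF psd_L2 vecs_H_forms_subset]]) (simp add: H_forms_def L2_forms_def)
  moreover have "weak_deriv \<rho> u \<in> vecs (H_forms \<rho> 1)" if "u \<in> vecs (H_forms \<rho> 0)" for u
    using weak_deriv_L2[OF that] by (simp add: H_forms_def L2_forms_def)
  ultimately show ?thesis unfolding bounded_op_def by (intro conjI ballI exI[of _ 1]) auto
qed

lemma deriv_poly: "deriv (poly p) = poly (pderiv p)"
  by (rule ext) (rule DERIV_imp_deriv[OF poly_DERIV])

text \<open>The polynomial 0-forms carry the graph inner product of the larger space, so the
  constant 1 again leaves the \<open>L2_ip\<close> part as the remaining kernel.\<close>

lemma bounded_op_deriv:
  assumes "0 < \<rho>"
  shows "bounded_op (P_forms \<rho> 0) (P_forms \<rho> 1) deriv"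
proof -
  have vecs: "vecs (P_forms \<rho> 0) = {poly p |p. degree p \<le> 3}" by (simp add: P_forms_def)
  have "psd (vecs (P_forms \<rho> 0)) (\<lambda>u v. 1 * ip (P_forms \<rho> 0) u v - ip (P_forms \<rho> 1) (deriv u) (deriv v))"
  proof (rule psd_cong[OF psd_subset[OF psd_L2]])
    show "vecs (P_forms \<rho> 0) \<subseteq> L2_fun \<rho>" unfolding vecs using poly_L2 by blast
    fix u v assume "u \<in> vecs (P_forms \<rho> 0)" "v \<in> vecs (P_forms \<rho> 0)"
    then obtain p q where "u = poly p" "v = poly q" unfolding vecs by blast
    then show "L2_ip \<rho> u v = 1 * ip (P_forms \<rho> 0) u v - ip (P_forms \<rho> 1) (deriv u) (deriv v)"
      by (simp add: ip_P_forms_0[OF assms] deriv_poly) (simp add: P_forms_def H_forms_def L2_forms_def)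
  qed
  moreover have "deriv u \<in> vecs (P_forms \<rho> 1)" if "u \<in> vecs (P_forms \<rho> 0)" for u
  proof -
    from that obtain p where "u = poly p" "degree p \<le> 3" unfolding vecs by blast
    then show ?thesis
      by (auto simp: P_forms_def deriv_poly degree_pderiv)
  qed
  ultimately show ?thesis unfolding bounded_op_def by (intro conjI ballI exI[of _ 1]) auto
qed

text \<open>
  By induction on the rank, the norm of \<open>x + y\<close> being controlled by the parallelogram law
  \<open>\<parallel>x + y\<parallel>\<^sup>2 = 2 \<parallel>x\<parallel>\<^sup>2 + 2 \<parallel>y\<parallel>\<^sup>2 - \<parallel>x - y\<parallel>\<^sup>2\<close>.
\<close>

lemma psd_finite_rank:
  assumes "finite A" "\<And>i. i \<in> A \<Longrightarrow> K i \<in> L2_fun \<rho>" "\<And>i. i \<in> A \<Longrightarrow> \<phi> i \<in> L2_fun \<rho>"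
  shows "\<exists>C\<ge>0. psd (L2_fun \<rho>) (\<lambda>u v. C * L2_ip \<rho> u v -
           L2_ip \<rho> (\<lambda>x. \<Sum>i\<in>A. L2_ip \<rho> u (K i) * \<phi> i x) (\<lambda>x. \<Sum>i\<in>A. L2_ip \<rho> v (K i) * \<phi> i x))"
  using assms
proof (induction A rule: finite_induct)
  case empty
  have "L2_ip \<rho> (\<lambda>_. 0) (\<lambda>_. 0) = 0" by (simp add: L2_ip_def)
  then show ?case by (auto simp: psd_zero intro!: exI[of _ 0])
next
  case (insert i A)
  let ?T = "\<lambda>u x. \<Sum>i\<in>A. L2_ip \<rho> u (K i) * \<phi> i x" and ?S = "\<lambda>u x. L2_ip \<rho> u (K i) * \<phi> i x"
  let ?B = "L2_ip \<rho> (K i) (K i)" and ?G = "L2_ip \<rho> (\<phi> i) (\<phi> i)"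
  obtain C where C: "C \<ge> 0" "psd (L2_fun \<rho>) (\<lambda>u v. C * L2_ip \<rho> u v - L2_ip \<rho> (?T u) (?T v))"
    using insert by auto
  have mem: "?T u \<in> L2_fun \<rho>" "?S u \<in> L2_fun \<rho>" for u
    using insert.prems by (intro L2_fun_sum L2_fun_scale; simp)+
  have S: "L2_ip \<rho> (?S u) (?S v) = ?G * (L2_ip \<rho> u (K i) * L2_ip \<rho> v (K i))" for u v
    using L2_ip_scale_left[of \<rho> _ "\<phi> i"] by (simp add: L2_ip_commute[of \<rho> "\<phi> i" "\<lambda>x. _ * \<phi> i x"])
  \<comment> \<open>The rank-one summand is controlled by the Cauchy-Schwarz inequality in kernel
    form; \<open>?G\<close> accounts for the norm of its direction \<open>\<phi> i\<close>.\<close>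
  have "psd (L2_fun \<rho>) (\<lambda>u v. ?B * L2_ip \<rho> u v - L2_ip \<rho> u (K i) * L2_ip \<rho> v (K i))"
    using insert.prems by (intro psd_L2_linear_form) auto
  from psd_scale[OF this, of "2 * ?G"] psd_scale[OF C(2), of 2]
  have "psd (L2_fun \<rho>) (\<lambda>u v. 2 * ?G * (?B * L2_ip \<rho> u v - L2_ip \<rho> u (K i) * L2_ip \<rho> v (K i))
      + 2 * (C * L2_ip \<rho> u v - L2_ip \<rho> (?T u) (?T v)))"
    by (intro psd_add) (auto simp: L2_ip_nonneg)
  moreover have "psd (L2_fun \<rho>) (\<lambda>u v. L2_ip \<rho> (\<lambda>x. ?S u x - ?T u x) (\<lambda>x. ?S v x - ?T v x))"
    by (rule psd_pullback[OF psd_L2, where f = "\<lambda>u x. ?S u x - ?T u x"]) (intro L2_fun_diff mem)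
  ultimately have psd: "psd (L2_fun \<rho>) (\<lambda>u v.
      2 * ?G * (?B * L2_ip \<rho> u v - L2_ip \<rho> u (K i) * L2_ip \<rho> v (K i))
      + 2 * (C * L2_ip \<rho> u v - L2_ip \<rho> (?T u) (?T v))
      + L2_ip \<rho> (\<lambda>x. ?S u x - ?T u x) (\<lambda>x. ?S v x - ?T v x))"
    by (rule psd_add)
  have "psd (L2_fun \<rho>) (\<lambda>u v. (2 * ?G * ?B + 2 * C) * L2_ip \<rho> u v -
      L2_ip \<rho> (\<lambda>x. ?S u x + ?T u x) (\<lambda>x. ?S v x + ?T v x))"
  proof (rule psd_cong[OF psd])
    fix u v
    have D: "(\<lambda>x. ?S v x - ?T v x) \<in> L2_fun \<rho>" "(\<lambda>x. ?S v x + ?T v x) \<in> L2_fun \<rho>"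
      by (intro L2_fun_diff L2_fun_add mem)+
    have "L2_ip \<rho> (\<lambda>x. ?S u x - ?T u x) (\<lambda>x. ?S v x - ?T v x) =
        L2_ip \<rho> (?S u) (?S v) - L2_ip \<rho> (?S u) (?T v) - L2_ip \<rho> (?T u) (?S v) + L2_ip \<rho> (?T u) (?T v)"
      unfolding L2_ip_diff_left[OF mem(2,1) D(1)]
      unfolding L2_ip_commute[of \<rho> _ "\<lambda>x. ?S v x - ?T v x"]
      unfolding L2_ip_diff_left[OF mem(2,1) mem(1)] L2_ip_diff_left[OF mem(2,1) mem(2)]
      by (simp add: L2_ip_commute)
    moreover have "L2_ip \<rho> (\<lambda>x. ?S u x + ?T u x) (\<lambda>x. ?S v x + ?T v x) =
        L2_ip \<rho> (?S u) (?S v) + L2_ip \<rho> (?S u) (?T v) + L2_ip \<rho> (?T u) (?S v) + L2_ip \<rho> (?T u) (?T v)"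
      unfolding L2_ip_add_left[OF mem(2,1) D(2)]
      unfolding L2_ip_commute[of \<rho> _ "\<lambda>x. ?S v x + ?T v x"]
      unfolding L2_ip_add_left[OF mem(2,1) mem(1)] L2_ip_add_left[OF mem(2,1) mem(2)]
      by (simp add: L2_ip_commute)
    ultimately show "2 * ?G * (?B * L2_ip \<rho> u v - L2_ip \<rho> u (K i) * L2_ip \<rho> v (K i))
        + 2 * (C * L2_ip \<rho> u v - L2_ip \<rho> (?T u) (?T v))
        + L2_ip \<rho> (\<lambda>x. ?S u x - ?T u x) (\<lambda>x. ?S v x - ?T v x) =
        (2 * ?G * ?B + 2 * C) * L2_ip \<rho> u v -
        L2_ip \<rho> (\<lambda>x. ?S u x + ?T u x) (\<lambda>x. ?S v x + ?T v x)"
      unfolding S by (simp add: algebra_simps)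
  qed
  moreover have "0 \<le> 2 * ?G * ?B + 2 * C" using C(1) by (simp add: L2_ip_nonneg)
  ultimately show ?case using insert.hyps by (intro exI[of _ "2 * ?G * ?B + 2 * C"]) simp
qed

text \<open>The basis functions as polynomial objects, which makes \<open>degree\<close> and
  \<open>pderiv\<close> available.\<close>

definition basis_poly :: "nat \<Rightarrow> nat \<Rightarrow> real poly" where
  "basis_poly k i =
     (if k = 0 then
        (if i = 1 then [:0, 1, - 2, 1:]
         else if i = 2 then [:0, 0, - 1, 1:]
         else if i = 3 then [:- 1/2, 0, 3, - 2:]
         else [:1/2:])
      else
        (if i = 1 then [:1, - 4, 3:]
         else if i = 2 then [:0, - 2, 3:]
         else [:0, 6, - 6:]))"

lemma basis_fun_eq_poly: "basis_fun k i = poly (basis_poly k i)"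
  by (rule ext) (auto simp: basis_fun_def basis_poly_def power2_eq_square power3_eq_cube algebra_simps)

lemma degree_basis_poly: "degree (basis_poly k i) \<le> (if k = 0 then 3 else 2)"
  by (auto simp: basis_poly_def)

text \<open>All degrees of freedom are inner products with fixed functions, so the operator has
  finite rank. On 0-forms the target norm also contains the derivative, which is a second finite
  rank map with the same functionals and the differentiated basis; its constant is added.\<close>

lemma bounded_op_Pi_1d:
  assumes \<rho>: "0 < \<rho>" "\<rho> \<le> 1 / 3" and k: "k \<in> {0, 1}"
  shows "bounded_op (L2_forms \<rho> k) (P_forms \<rho> k) (Pi_1d \<rho> k)"
proof -
  define A where "A = {1..(if k = 0 then 4 else 3::nat)}"
  have "\<forall>i\<in>A. \<exists>K. K \<in> L2_fun \<rho> \<and> (\<forall>u\<in>L2_fun \<rho>. L2_dof \<rho> k i u = L2_ip \<rho> u K)"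
  proof
    fix i assume i: "i \<in> A"
    show "\<exists>K. K \<in> L2_fun \<rho> \<and> (\<forall>u\<in>L2_fun \<rho>. L2_dof \<rho> k i u = L2_ip \<rho> u K)"
    proof (cases "i = 4")
      case True
      with i k have "k = 0" by (auto simp: A_def split: if_splits)
      with True show ?thesis using L2_dof_0_4_kernel[OF \<rho>] by blast
    next
      case False
      with i have "i \<in> {1, 2, 3}" by (auto simp: A_def split: if_splits)
      from L2_dof_kernels[OF \<rho> this] obtain \<psi> where \<psi>: "smooth \<psi>"
        and dof: "\<And>u. u \<in> L2_fun \<rho> \<Longrightarrow> L2_dof \<rho> 1 i u = L2_ip \<rho> u \<psi>"
          "\<And>u. u \<in> L2_fun \<rho> \<Longrightarrow> L2_dof \<rho> 0 i u = - L2_ip \<rho> u (deriv \<psi>)" by blast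
      have L2: "\<psi> \<in> L2_fun \<rho>" "(\<lambda>x. - 1 * deriv \<psi> x) \<in> L2_fun \<rho>"
        by (intro L2_fun_scale L2_fun_continuous smooth_continuous_on smooth_deriv \<psi>)+
      have "- L2_ip \<rho> u (deriv \<psi>) = L2_ip \<rho> u (\<lambda>x. - 1 * deriv \<psi> x)" for u
        using L2_ip_scale_left[of \<rho> "- 1" "deriv \<psi>" u] by (simp add: L2_ip_commute)
      with L2 dof k show ?thesis by (metis empty_iff insert_iff)
    qed
  qed
  from bchoice[OF this] obtain K where
    K: "\<And>i. i \<in> A \<Longrightarrow> K i \<in> L2_fun \<rho>"
      "\<And>i u. i \<in> A \<Longrightarrow> u \<in> L2_fun \<rho> \<Longrightarrow> L2_dof \<rho> k i u = L2_ip \<rho> u (K i)" by blast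
  let ?P = "\<lambda>u. \<Sum>i\<in>A. smult (L2_ip \<rho> u (K i)) (basis_poly k i)"
  have poly: "poly (?P u) = (\<lambda>x. \<Sum>i\<in>A. L2_ip \<rho> u (K i) * poly (basis_poly k i) x)" for u
    by (rule ext) (simp add: poly_sum)
  have pderiv: "poly (pderiv (?P u)) = (\<lambda>x. \<Sum>i\<in>A. L2_ip \<rho> u (K i) * poly (pderiv (basis_poly k i)) x)" for u
    by (rule ext) (simp add: poly_sum higher_pderiv_sum[of 1, simplified] pderiv_smult)
  have Pi: "Pi_1d \<rho> k u = poly (?P u)" if "u \<in> L2_fun \<rho>" for u
    unfolding poly Pi_1d_def A_def[symmetric] using that K(2) by (simp add: basis_fun_eq_poly)
  have fin: "finite A" by (simp add: A_def)
  have "\<exists>C\<ge>0. psd (L2_fun \<rho>) (\<lambda>u v. C * L2_ip \<rho> u v - L2_ip \<rho> (poly (?P u)) (poly (?P v)))"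
    unfolding poly by (rule psd_finite_rank[OF fin K(1)]) (auto intro: poly_L2)
  then obtain C where C: "C \<ge> 0"
    "psd (L2_fun \<rho>) (\<lambda>u v. C * L2_ip \<rho> u v - L2_ip \<rho> (poly (?P u)) (poly (?P v)))"
    by (elim exE conjE) (rule that)
  have "\<exists>D\<ge>0. psd (L2_fun \<rho>)
      (\<lambda>u v. D * L2_ip \<rho> u v - L2_ip \<rho> (poly (pderiv (?P u))) (poly (pderiv (?P v))))"
    unfolding pderiv by (rule psd_finite_rank[OF fin K(1)]) (auto intro: poly_L2)
  then obtain D where D: "D \<ge> 0"
    "psd (L2_fun \<rho>) (\<lambda>u v. D * L2_ip \<rho> u v - L2_ip \<rho> (poly (pderiv (?P u))) (poly (pderiv (?P v))))"
    by (elim exE conjE) (rule that)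
  have "psd (L2_fun \<rho>) (\<lambda>u v. (if k = 0 then C + D else C) * L2_ip \<rho> u v
      - ip (P_forms \<rho> k) (Pi_1d \<rho> k u) (Pi_1d \<rho> k v))"
  proof (cases "k = 0")
    case True
    then show ?thesis
      by (intro psd_cong[OF psd_add[OF C(2) D(2)]])
        (simp add: Pi[unfolded True] ip_P_forms_0[OF \<rho>(1)] algebra_simps)
  next
    case False
    then show ?thesis
      by (intro psd_cong[OF C(2)]) (simp add: Pi P_forms_def H_forms_def L2_forms_def)
  qed
  moreover have "Pi_1d \<rho> k u \<in> vecs (P_forms \<rho> k)" if "u \<in> L2_fun \<rho>" for u
  proof -
    have "degree (?P u) \<le> (if k = 0 then 3 else 2)"
      using degree_basis_poly[of k] by (intro degree_sum_le fin) (meson degree_smult_le order_trans)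
    then show ?thesis unfolding Pi[OF that] P_forms_def by auto
  qed
  ultimately show ?thesis
    unfolding bounded_op_def using C(1) D(1)
    by (auto simp: L2_forms_def intro!: exI[of _ "if k = 0 then C + D else C"])
qed

section \<open>Components of the exterior derivative\<close>

lemma finite_chi: "finite (chi n k)"
  by (rule finite_subset[of _ "{..<n} \<rightarrow>\<^sub>E {0, 1}"]) (auto simp: chi_def intro: finite_PiE)

lemma chi_01: "i \<in> chi n k \<Longrightarrow> j < n \<Longrightarrow> i j \<in> {0, 1}"
  unfolding chi_def by (blast dest: PiE_mem)

text \<open>For fixed \<open>i'\<close>, such a pair amounts to a position where \<open>i'\<close>
  is 1 and which the derivative has raised from 0.\<close>

definition d_index :: "nat \<Rightarrow> nat \<Rightarrow> (nat \<Rightarrow> nat) \<Rightarrow> ((nat \<Rightarrow> nat) \<times> nat) set" where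
  "d_index n k i' = (SIGMA i : chi n k. {j. j < n \<and> i j = 0 \<and> i(j := 1) = i'})"

text \<open>Flattening the double sum into one sum of scalar multiples brings the derivative into
  the form that \<open>tensor_op_sum\<close> handles.\<close>

lemma tensor_d_eq:
  assumes "i' \<in> chi n (k + 1)"
  shows "tensor_d S D n k \<omega> i' = (\<lambda>v. \<Sum>x\<in>d_index n k i'. (- 1) ^ (\<Sum>l<snd x. fst x l) *
    tensor_op n (\<lambda>l. S (fst x l)) (\<lambda>l. S (i' l)) (\<lambda>l. if l = snd x then D else id) (\<omega> (fst x)) v)"
  using assms finite_chi unfolding tensor_d_def d_index_def
  by (simp add: sum.Sigma case_prod_beta)

theorem lemma7p7:
  fixes \<rho> :: real and n k :: nat
    and u :: "(real \<Rightarrow> real) tensor_kform"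
  assumes "0 < \<rho>" and "\<rho> \<le> 1 / 3"
    and "n \<ge> 1" and "k \<le> n - 1"
    and "u \<in> tensor_forms (H_forms \<rho>) n k"
  shows "Pi_tensor \<rho> n (k + 1) (H_to_L2 \<rho> n (k + 1) (d_H \<rho> n k u)) =
         d_P \<rho> n k (Pi_tensor \<rho> n k (H_to_L2 \<rho> n k u))"
proof
  fix i'
  note \<rho> = assms(1,2)
  show "Pi_tensor \<rho> n (k + 1) (H_to_L2 \<rho> n (k + 1) (d_H \<rho> n k u)) i' =
        d_P \<rho> n k (Pi_tensor \<rho> n k (H_to_L2 \<rho> n k u)) i'"
  proof (cases "i' \<in> chi n (k + 1)")
    \<comment> \<open>Both sides are restricted to \<open>chi n (k + 1)\<close> and equal
      \<open>undefined\<close> elsewhere.\<close>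
    case False
    then show ?thesis by (simp add: Pi_tensor_def tensor_forms_op_def d_P_def tensor_d_def)
  next
    case i': True
    let ?X = "d_index n k i'" and ?s = "\<lambda>x. (- 1) ^ (\<Sum>l<snd x. fst x l) :: real"
    let ?H = "\<lambda>i l. H_forms \<rho> (i l)" and ?L = "\<lambda>i l. L2_forms \<rho> (i l)" and ?P = "\<lambda>i l. P_forms \<rho> (i l)"
    let ?Pi = "\<lambda>i l. Pi_1d \<rho> (i l)"
    let ?D = "\<lambda>j l. if l = j then weak_deriv \<rho> else id" and ?d = "\<lambda>j l. if l = j then deriv else id"
    have spaces: "\<forall>l<n. psd_space (?H i l)" "\<forall>l<n. psd_space (?L i l)" "\<forall>l<n. psd_space (?P i l)" for i
      using psd_space_H psd_space_L2 psd_space_P[OF \<rho>(1)] by auto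
    have incl: "\<forall>l<n. bounded_op (?H i l) (?L i l) id" for i
      using bounded_op_H_L2 by blast
    have Pi: "\<forall>l<n. bounded_op (?L i l) (?P i l) (?Pi i l)" if "\<And>l. l < n \<Longrightarrow> i l \<in> {0, 1}" for i
      using bounded_op_Pi_1d[OF \<rho>] that by blast
    have x: "fst x \<in> chi n k" "fst x (snd x) = 0" "snd x < n" "i' = (fst x)(snd x := 1)" if "x \<in> ?X" for x
      using that by (auto simp: d_index_def)
    have D: "\<forall>l<n. bounded_op (?H (fst x) l) (?H i' l) (?D (snd x) l)" if "x \<in> ?X" for x
      using x[OF that] bounded_op_weak_deriv bounded_op_id by auto
    have d: "\<forall>l<n. bounded_op (?P (fst x) l) (?P i' l) (?d (snd x) l)" if "x \<in> ?X" for x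
      using x[OF that] bounded_op_deriv[OF \<rho>(1)] bounded_op_id by auto
    have Pi': "\<forall>l<n. bounded_op (?L i' l) (?P i' l) (?Pi i' l)"
      using chi_01[OF i'] by (intro Pi)
    have Pi_x: "\<forall>l<n. bounded_op (?L (fst x) l) (?P (fst x) l) (?Pi (fst x) l)" if "x \<in> ?X" for x
      using chi_01[OF x(1)[OF that]] by (intro Pi)
    have u: "u (fst x) \<in> hilbert_tensor n (?H (fst x))" if "x \<in> ?X" for x
      using assms(5) x(1)[OF that] unfolding tensor_forms_def by (rule PiE_mem)
    let ?\<Phi> = "\<lambda>x. tensor_op n (?H (fst x)) (?H i') (?D (snd x)) (u (fst x))"
    have \<Phi>: "?\<Phi> x \<in> hilbert_tensor n (?H i')" if "x \<in> ?X" for x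
      by (rule tensor_op_hilbert_tensor[OF spaces(1) spaces(1) D[OF that] u[OF that]])
    have \<Phi>': "tensor_op n (?H i') (?L i') (\<lambda>_. id) (?\<Phi> x) \<in> hilbert_tensor n (?L i')" if "x \<in> ?X" for x
      by (rule tensor_op_hilbert_tensor[OF spaces(1,2) incl \<Phi>[OF that]])
    have "Pi_tensor \<rho> n (k + 1) (H_to_L2 \<rho> n (k + 1) (d_H \<rho> n k u)) i' =
        tensor_op n (?L i') (?P i') (?Pi i') (tensor_op n (?H i') (?L i') (\<lambda>_. id)
          (\<lambda>v. \<Sum>x\<in>?X. ?s x * ?\<Phi> x v))"
      using i' by (simp add: Pi_tensor_def H_to_L2_def d_H_def tensor_forms_op_def tensor_d_eq)
    also have "tensor_op n (?H i') (?L i') (\<lambda>_. id) (\<lambda>v. \<Sum>x\<in>?X. ?s x * ?\<Phi> x v) =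
        (\<lambda>v. \<Sum>x\<in>?X. ?s x * tensor_op n (?H i') (?L i') (\<lambda>_. id) (?\<Phi> x) v)"
      by (rule tensor_op_sum[OF spaces(1,2) incl \<Phi>])
    also have "tensor_op n (?L i') (?P i') (?Pi i') \<dots> = (\<lambda>v. \<Sum>x\<in>?X. ?s x *
        tensor_op n (?L i') (?P i') (?Pi i') (tensor_op n (?H i') (?L i') (\<lambda>_. id) (?\<Phi> x)) v)"
      by (rule tensor_op_sum[OF spaces(2,3) Pi' \<Phi>'])
    \<comment> \<open>Inclusion and interpolation preserve the multi-degree, so both sides are sums
      over the same pairs with the same signs and can be compared term by term.\<close>
    also have "\<dots> = (\<lambda>v. \<Sum>x\<in>?X. ?s x *
        tensor_op n (?P (fst x)) (?P i') (?d (snd x)) (tensor_op n (?L (fst x)) (?P (fst x)) (?Pi (fst x))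
          (tensor_op n (?H (fst x)) (?L (fst x)) (\<lambda>_. id) (u (fst x)))) v)"
    proof (intro ext sum.cong refl arg_cong2[where f = "(*)"])
      fix v x assume xX: "x \<in> ?X"
      note D = D[OF xX] and d = d[OF xX] and u = u[OF xX] and Pi_x = Pi_x[OF xX] and x = x[OF xX]
      \<comment> \<open>Each threefold composition is collapsed into a single tensor operator acting
        on the component of \<open>u\<close>, so that the comparison can be made factor by
        factor.\<close>
      have HL: "\<forall>l<n. bounded_op (?H (fst x) l) (?L i' l) (\<lambda>w. id (?D (snd x) l w))"
        using D incl[of i'] bounded_op_comp by blast
      have HP: "\<forall>l<n. bounded_op (?H (fst x) l) (?P (fst x) l) (\<lambda>w. ?Pi (fst x) l (id w))"
        using Pi_x incl[of "fst x"] bounded_op_comp by blast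
      have lhs: "tensor_op n (?L i') (?P i') (?Pi i') (tensor_op n (?H i') (?L i') (\<lambda>_. id) (?\<Phi> x)) =
          tensor_op n (?H (fst x)) (?P i') (\<lambda>l w. ?Pi i' l (id (?D (snd x) l w))) (u (fst x))"
        unfolding tensor_op_comp[OF spaces(1) spaces(1,2) D incl u]
        by (rule tensor_op_comp[OF spaces(1,2,3) HL Pi' u])
      have rhs: "tensor_op n (?P (fst x)) (?P i') (?d (snd x)) (tensor_op n (?L (fst x)) (?P (fst x)) (?Pi (fst x))
          (tensor_op n (?H (fst x)) (?L (fst x)) (\<lambda>_. id) (u (fst x)))) =
          tensor_op n (?H (fst x)) (?P i') (\<lambda>l w. ?d (snd x) l (?Pi (fst x) l (id w))) (u (fst x))"
        unfolding tensor_op_comp[OF spaces(1,2,3) incl Pi_x u]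
        by (rule tensor_op_comp[OF spaces(1,3) spaces(3) HP d u])
      have "tensor_op n (?H (fst x)) (?P i') (\<lambda>l w. ?Pi i' l (id (?D (snd x) l w))) (u (fst x)) =
          tensor_op n (?H (fst x)) (?P i') (\<lambda>l w. ?d (snd x) l (?Pi (fst x) l (id w))) (u (fst x))"
      proof (rule tensor_op_cong[OF spaces(1,3) _ _ _ u])
        show "\<forall>l<n. bounded_op (?H (fst x) l) (?P i' l) (\<lambda>w. ?Pi i' l (id (?D (snd x) l w)))"
          using HL Pi' bounded_op_comp by blast
        show "\<forall>l<n. bounded_op (?H (fst x) l) (?P i' l) (\<lambda>w. ?d (snd x) l (?Pi (fst x) l (id w)))"
          using HP d bounded_op_comp by blast
        fix l w assume l: "l < n" and w: "w \<in> vecs (?H (fst x) l)"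
        show "?Pi i' l (id (?D (snd x) l w)) = ?d (snd x) l (?Pi (fst x) l (id w))"
        \<comment> \<open>In the differentiated slot this is the one-dimensional commutation. In
          every other slot \<open>i'\<close> and \<open>fst x\<close> agree, and both sides apply
          the same interpolation.\<close>
        proof (cases "l = snd x")
          case True
          then have "w \<in> L2_fun \<rho>" "is_weak_deriv \<rho> w (weak_deriv \<rho> w)"
            using w x(2) is_weak_deriv_weak_deriv by (auto simp: vecs_H_forms_0)
          from Pi_1d_weak_deriv[OF \<rho> this] True show ?thesis by (simp add: x)
        next
          case False
          then show ?thesis by (simp add: x(4))
        qed
      qed
      with lhs rhs show "tensor_op n (?L i') (?P i') (?Pi i') (tensor_op n (?H i') (?L i') (\<lambda>_. id) (?\<Phi> x)) v =
          tensor_op n (?P (fst x)) (?P i') (?d (snd x)) (tensor_op n (?L (fst x)) (?P (fst x)) (?Pi (fst x))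
          (tensor_op n (?H (fst x)) (?L (fst x)) (\<lambda>_. id) (u (fst x)))) v"
        by (simp only:)
    qed
    also have "\<dots> = d_P \<rho> n k (Pi_tensor \<rho> n k (H_to_L2 \<rho> n k u)) i'"
      using i' x(1) by (simp add: d_P_def tensor_d_eq Pi_tensor_def H_to_L2_def tensor_forms_op_def)
    finally show ?thesis .
  qed
qed

end
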